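(* Let $m$ be an even positive integer and let $S$ be an $m/2$-element subset of $\{0,1,\dots,m-1\}$. Let $p$ take values in an infinite set of primes satisfying $p\equiv 1\pmod m$. For each $p$, let $D$ be the union of the $m/2$ cyclotomic classes $C_s$ with $s\in S$ of $\mathbb{F}_p$ of order $m$, and suppose that, as $p\to\infty$, $$\frac{(\log p)^3}{p^2}\sum_{u\in\mathbb{F}_p^*}\Big(\big|(D+u)\cap D\big|-\frac{p}{4}\Big)^2\to 0.$$ For each $p$, let $f$ be a characteristic polynomial of $D$ and let $r,t$ be integers with $t\ge0$ (depending on $p$). Let $R$ and $T>0$ be real. If $r/p\to R$ and $t/p\to T$, then the following hold as $p\to\infty$: (i) If $\frac{p-1}{m}$ is even for every $p$, then $F(f_{r,t})\to\varphi_1(R,T)$. (ii) If $\frac{p-1}{m}$ is odd for every $p$, then $F(f_{r,t})\to\varphi_\nu(R,T)$, where $\nu=\left(\frac{4N}{m}-1\right)^2$ and $$N=\big|\{(s,s')\in S\times S: s-s'\equiv m/2 \pmod m\}\big|.$$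
   Context: Merit factor: for $f\in\mathbb{C}[z]$ and $1\le\alpha<\infty$ put $\|f\|_\alpha=\left(\frac{1}{2\pi}\int_0^{2\pi}|f(e^{i\phi})|^\alpha\,d\phi\right)^{1/\alpha}$. The merit factor of $f$ is $F(f)=\frac{\|f\|_2^4}{\|f\|_4^4-\|f\|_2^4}$, provided that the denominator is nonzero. Cyclotomic classes: for a positive integer $m$ and a prime $p\equiv1\pmod m$, fix a primitive element $\omega$ of $\mathbb{F}_p$. Let $C_0$ be the set of $m$-th powers in $\mathbb{F}_p^*$ and $C_s=\omega^sC_0$ for $s\in\mathbb{Z}$. The sets $C_0,\dots,C_{m-1}$ partition $\mathbb{F}_p^*$ and are called the cyclotomic classes of $\mathbb{F}_p$ of order $m$. Characteristic polynomials: for $D\subseteq\mathbb{F}_p$ put $\mathbf{1}_D(y)=1$ for $y\in D$ and $\mathbf{1}_D(y)=-1$ for $y\in\mathbb{F}_p\setminus D$. Fix a generator $v\in\mathbb{F}_p^*$ of the additive group of $\mathbb{F}_p$. For integers $r,t$ with $t\ge0$, put $f_{r,t}(z)=\sum_{j=0}^{t-1}\mathbf{1}_D((j+r)v)z^j$. The polynomial $f=f_{0,p}$ is called a characteristic polynomial of $D$ (it depends on the choice of $v$), and $f_{r,t}$ denotes the associated polynomial formed with the same $v$. For $u\in\mathbb{F}_p$, $D+u=\{d+u:d\in D\}$. The function $\varphi_\nu$: for real $\nu$, $R\in\mathbb{R}$ and $T>0$, $$\frac{1}{\varphi_\nu(R,T)}=1-\frac{2(1+\nu)T}{3}+4\sum_{m=1}^{\infty}\max\Big(0,1-\frac{m}{T}\Big)^2+\nu\sum_{m\in\mathbb{Z}}\max\Big(0,1-\Big|1+\frac{2R-m}{T}\Big|\Big)^2$$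 (here $m$ is a summation index). *)

theory Defs
  imports
    "HOL-Analysis.Analysis"
    "HOL-Computational_Algebra.Polynomial"
    "HOL-Number_Theory.Number_Theory"
begin

definition circle_norm :: "real \<Rightarrow> complex poly \<Rightarrow> real" where
  "circle_norm \<alpha> f =
    (1 / (2 * pi) * integral {0..2 * pi} (\<lambda>\<phi>. cmod (poly f (cis \<phi>)) powr \<alpha>)) powr (1 / \<alpha>)"

text \<open>If the denominator vanishes, the merit factor is undefined; the value is then 0
  by the convention on division.\<close>

definition merit_factor :: "complex poly \<Rightarrow> real" where
  "merit_factor f = circle_norm 2 f ^ 4 / (circle_norm 4 f ^ 4 - circle_norm 2 f ^ 4)"

text \<open>The field with \<open>p\<close> elements is represented by the least nonnegative residues modulo \<open>p\<close>.\<close>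

abbreviation GFp :: "nat \<Rightarrow> int ring" where
  "GFp p \<equiv> residue_ring (int p)"

definition primitive_element :: "nat \<Rightarrow> int \<Rightarrow> bool" where
  "primitive_element p \<omega> \<longleftrightarrow>
    \<omega> \<in> carrier (mult_of (GFp p)) \<and>
    generate (mult_of (GFp p)) {\<omega>} = carrier (mult_of (GFp p))"

definition mth_powers :: "nat \<Rightarrow> nat \<Rightarrow> int set" where
  "mth_powers p m = {x [^]\<^bsub>mult_of (GFp p)\<^esub> m | x. x \<in> carrier (mult_of (GFp p))}"

definition cyclotomic_class :: "nat \<Rightarrow> nat \<Rightarrow> int \<Rightarrow> int \<Rightarrow> int set" where
  "cyclotomic_class p m \<omega> s =
    (\<lambda>c. (\<omega> [^]\<^bsub>mult_of (GFp p)\<^esub> s) \<otimes>\<^bsub>mult_of (GFp p)\<^esub> c) ` mth_powers p m"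

definition translate :: "nat \<Rightarrow> int set \<Rightarrow> int \<Rightarrow> int set" where
  "translate p D u = (\<lambda>d. d \<oplus>\<^bsub>GFp p\<^esub> u) ` D"

definition pm_indicator :: "int set \<Rightarrow> int \<Rightarrow> complex" where
  "pm_indicator D y = (if y \<in> D then 1 else -1)"

definition additive_generator :: "nat \<Rightarrow> int \<Rightarrow> bool" where
  "additive_generator p v \<longleftrightarrow>
    v \<in> carrier (mult_of (GFp p)) \<and>
    generate (add_monoid (GFp p)) {v} = carrier (GFp p)"

text \<open>This is $f_{r,t}$; the characteristic polynomial of \<open>D\<close> with respect to \<open>v\<close>
  is the case \<open>r = 0\<close>, \<open>t = p\<close>. The index \<open>j + r\<close>, which may be negative, is reduced
  modulo \<open>p\<close> before it is multiplied by \<open>v\<close>.\<close>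

definition characteristic_poly :: "nat \<Rightarrow> int set \<Rightarrow> int \<Rightarrow> int \<Rightarrow> nat \<Rightarrow> complex poly" where
  "characteristic_poly p D v r t =
    (\<Sum>j<t. Polynomial.monom (pm_indicator D (((int j + r) mod int p) \<otimes>\<^bsub>GFp p\<^esub> v)) j)"

definition phi :: "real \<Rightarrow> real \<Rightarrow> real \<Rightarrow> real" where
  "phi \<nu> R T = 1 /
    (1 - 2 * (1 + \<nu>) * T / 3
     + 4 * (\<Sum>\<^sub>\<infinity>n\<in>{1::nat..}. (max 0 (1 - real n / T))\<^sup>2)
     + \<nu> * (\<Sum>\<^sub>\<infinity>n\<in>(UNIV :: int set). (max 0 (1 - \<bar>1 + (2 * R - real_of_int n) / T\<bar>))\<^sup>2))"

end

theory Submission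
  imports Defs "HOL-Real_Asymp.Real_Asymp"
begin

text \<open>Write $f_{r,t}=\sum_{j<t} a(j+r)z^j$, where the $\pm1$ sequence $a$ modulo $p$ is constant on the
  cyclotomic classes. Then $\|f_{r,t}\|_4^4=\sum a(j_0+r)a(j_1+r)a(j_2+r)a(j_3+r)$ over the
  quadruples in $[0,t)$ with $j_0+j_1=j_2+j_3$, and $F(f_{r,t})=t^2/(\|f_{r,t}\|_4^4-t^2)$. Expanding
  $a$ in its Fourier transform $\hat a$ modulo $p$ turns this into a weighted sum of the correlations
  $\frac1p\sum_\kappa \hat a(\kappa-k_0)\hat a(\kappa-k_1)\overline{\hat a(\kappa-k_2)\hat a(\kappa-k_3)}$,
  with weights of total absolute value $O((t+p\log p)^4)$.

  As $\hat a$ is again constant on the cyclotomic classes, with $|\hat a|=O(\sqrt p)$, a correlation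
  is determined up to $O(p^{3/2})$ by means over the classes, because the class patterns of
  $(\kappa-c)_{c\in X}$ are equidistributed. The equidistribution needs no character sums: Stepanov's
  method bounds the number of $x$ with prescribed $(x-c)^{(p-1)/m}$, $c\in X$, from above by
  $p/m^{|X|}+O(\sqrt p)$, and the bounds add up to $p+O(\sqrt p)$, so that each is
  attained up to $O(\sqrt p)$. The mean of $|\hat a|^2$ is about $p$ and occurs twice for $k_0=k_2$, $k_1=k_3$ and
  for $k_0=k_3$, $k_1=k_2$; the mean of $\hat a^2$, about $\pm p\sqrt\nu$, occurs for $k_0=k_1$, $k_2=k_3$; the
  other patterns are negligible. When all $k_i$ agree the correlation is the sum of the squared
  autocorrelations of $a$, which is $p^2(1+o(1))$ by hypothesis. The limit thus reduces to counting
  quadruples with $p\mid j_0-j_2$, $p\mid j_0-j_3$ or $p\mid j_0+j_1+2r$.\<close>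

section \<open>Stepanov's method for simultaneous power residues\<close>

text \<open>Single values of the Fourier transform are not known for general m, so the argument
  lives on what Parseval gives: means over the classes, and the bound |a-hat|^2 <= m (p + 1) on
  units, which follows because a class function has only m values there. The one mean that Parseval
  for \<open>a\<close> does not determine is that of the fourth power; this is the reason for a
  hypothesis on the translates of D. Divided by p^4, the weights cost no more than a factor of order
  (log p)^4, while the correlations are compared with p^2. Any fixed power saving in the
  equidistribution would therefore do, and constants may be wasted freely in Stepanov's method. The
  method is run on integer polynomials: F_p[x] is represented by integer polynomials up to multiples
  of \<open>[:int p:]\<close>, and "nonzero" means not divisible by this constant. A separate
  obstacle is that convergence of 1/F gives convergence of F only if the limit of 1/F is nonzero.
  Its positivity for all T > 0, all R and 0 <= \<nu> <= 1 needs lower bounds for the sums in the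
  limit function that are nearly sharp, uniformly in R.\<close>

lemma prime_elem_const_int_poly: "prime p \<Longrightarrow> prime_elem [:int p:]"
  by (simp add: prime_elem_const_poly_iff)

lemma const_poly_dvd_imp_dvd_poly: "[:c:] dvd f \<Longrightarrow> c dvd poly f x"
  by (auto elim!: dvdE)

lemma not_const_dvd_linear:
  assumes "prime p" shows "\<not> [:int p:] dvd [:-c, 1:]"
proof
  assume "[:int p:] dvd [:-c, 1:]"
  then have "int p dvd Polynomial.coeff [:-c, 1:] 1" unfolding const_poly_dvd_iff by blast
  then show False using assms by simp
qed

text \<open>Here \<open>v\<close> is the order of vanishing of \<open>h\<close> at \<open>c\<close>
  in F_p[x]. Division by x - c leaves the remainder h(c); as long as p divides it, it is absorbed
  into \<open>u\<close>, and the falling degree stops the process.\<close>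

lemma linear_power_factor_mod_prime:
  fixes h :: "int poly"
  assumes "prime p" and "\<not> [:int p:] dvd h"
  obtains v g u where "h = [:-c, 1:] ^ v * g + [:int p:] * u" and "v \<le> degree h"
    and "\<not> int p dvd poly g c"
proof -
  have "\<exists>v g u. h = [:-c, 1:] ^ v * g + [:int p:] * u \<and> v \<le> degree h \<and> \<not> int p dvd poly g c"
    using assms(2)
  proof (induction "degree h" arbitrary: h rule: less_induct)
    case less
    show ?case
    proof (cases "int p dvd poly h c")
      case False
      have "h = [:-c, 1:] ^ 0 * h + [:int p:] * 0" by simp
      then show ?thesis using False by blast
    next
      case True
      then obtain k where k: "poly h c = int p * k" by (elim dvdE)
      let ?g = "synthetic_div h c"
      have h: "h = [:-c, 1:] * ?g + [:int p:] * [:k:]"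
        using synthetic_div_correct'[of c h] k by (simp add: mult.commute)
      have "degree h \<noteq> 0"
      proof
        assume "degree h = 0"
        then obtain b where "h = [:b:]" by (auto elim: degree_eq_zeroE)
        with k less.prems show False by simp
      qed
      then have deg: "degree ?g < degree h" by (simp add: degree_synthetic_div)
      have "\<not> [:int p:] dvd ?g"
        using less.prems h by (metis dvd_add dvd_mult dvd_triv_left)
      from less.hyps[OF deg this] obtain v g u
        where g: "?g = [:-c, 1:] ^ v * g + [:int p:] * u" and v: "v \<le> degree ?g"
          and nz: "\<not> int p dvd poly g c" by blast
      have "h = [:-c, 1:] ^ Suc v * g + [:int p:] * ([:-c, 1:] * u + [:k:])"
        by (subst h, subst g) (simp only: power_Suc algebra_simps)
      moreover have "Suc v \<le> degree h" using v deg by linarith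
      ultimately show ?thesis using nz by blast
    qed
  qed
  then show ?thesis using that by blast
qed

text \<open>At \<open>l = 0\<close> the truncated \<open>l - 1\<close> is harmless because its
  coefficient is 0.\<close>

lemma higher_pderiv_linear_mult:
  fixes g :: "int poly"
  shows "(pderiv ^^ l) ([:-c, 1:] * g) =
    [:-c, 1:] * (pderiv ^^ l) g + of_nat l * (pderiv ^^ (l - 1)) g"
proof (induction l)
  case (Suc l)
  have 1: "pderiv (of_nat l * (pderiv ^^ (l - 1)) g) = of_nat l * (pderiv ^^ l) g"
    by (cases l) (simp_all add: pderiv_mult of_nat_poly pderiv_smult)
  have "(pderiv ^^ Suc l) ([:-c, 1:] * g) =
    pderiv ([:-c, 1:] * (pderiv ^^ l) g) + pderiv (of_nat l * (pderiv ^^ (l - 1)) g)"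
    using Suc by (simp add: pderiv_add)
  also have "\<dots> = [:-c, 1:] * (pderiv ^^ Suc l) g + of_nat (Suc l) * (pderiv ^^ l) g"
  proof -
    have D: "pderiv ([:-c, 1:] * f) = f + [:-c, 1:] * pderiv f" for f :: "int poly"
      by (simp add: pderiv_mult pderiv_pCons del: mult_pCons_left)
    then show ?thesis unfolding 1 D of_nat_Suc funpow.simps o_apply
      by (simp only: algebra_simps mult_1)
  qed
  finally show ?case by simp
qed simp

lemma higher_pderiv_const:
  "(pderiv ^^ l) ([:b:] :: int poly) = (if l = 0 then [:b:] else 0)"
  by (induction l) (auto simp: pderiv_pCons)

text \<open>In characteristic p, vanishing derivatives detect multiplicities only up to p, hence the
  bound on \<mu>. Dividing by x - c for one c lowers the degree and \<mu> c by one and keeps the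
  orders at the other points.\<close>

lemma sum_vanishing_orders_le_degree:
  fixes F :: "int poly" and \<mu> :: "int \<Rightarrow> nat"
  assumes p: "prime p" and X: "X \<subseteq> {0..<int p}" and F: "\<not> [:int p:] dvd F"
    and \<mu>: "\<And>x. x \<in> X \<Longrightarrow> \<mu> x \<le> p"
    and van: "\<And>x l. x \<in> X \<Longrightarrow> l < \<mu> x \<Longrightarrow> int p dvd poly ((pderiv ^^ l) F) x"
  shows "(\<Sum>x\<in>X. \<mu> x) \<le> degree F"
  using F \<mu> van
proof (induction "degree F" arbitrary: F \<mu> rule: less_induct)
  case less
  have fin: "finite X" using X finite_subset by blast
  show ?case
  proof (cases "\<exists>c\<in>X. \<mu> c > 0")
    case False
    then show ?thesis by simp
  next
    case True
    then obtain c where c: "c \<in> X" "\<mu> c > 0" by blast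
    have "int p dvd poly F c" using less.prems(3)[of c 0] c by simp
    then obtain k where k: "poly F c = int p * k" by (elim dvdE)
    let ?G = "synthetic_div F c"
    have FG: "F = [:-c, 1:] * ?G + [:int p * k:]"
      using synthetic_div_correct'[of c F] k by simp
    have F': "F = [:-c, 1:] * ?G + [:int p:] * [:k:]" using FG by (simp add: mult.commute)
    have "degree F \<noteq> 0"
    proof
      assume "degree F = 0"
      then obtain b where "F = [:b:]" by (auto elim: degree_eq_zeroE)
      with k less.prems show False by simp
    qed
    then have deg: "degree F = Suc (degree ?G)" by (simp add: degree_synthetic_div)
    have nG: "\<not> [:int p:] dvd ?G"
      using less.prems(1) F' by (metis dvd_add dvd_mult dvd_triv_left)
    have step: "int p dvd (x - c) * poly ((pderiv ^^ l) ?G) x +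
        int l * poly ((pderiv ^^ (l - 1)) ?G) x" if "x \<in> X" "l < \<mu> x" for x l
    proof -
      have eq: "(pderiv ^^ l) F = (pderiv ^^ l) ([:-c, 1:] * ?G) + (pderiv ^^ l) [:int p * k:]"
        by (subst FG) (induction l, simp_all add: pderiv_add)
      have "int p dvd poly ((pderiv ^^ l) F) x" using less.prems(3) that by blast
      moreover have "poly ((pderiv ^^ l) F) x = (x - c) * poly ((pderiv ^^ l) ?G) x +
        int l * poly ((pderiv ^^ (l - 1)) ?G) x + (if l = 0 then int p * k else 0)"
        unfolding eq higher_pderiv_linear_mult higher_pderiv_const
        by (simp add: algebra_simps)
      ultimately show ?thesis by (cases "l = 0") (auto simp: dvd_add_left_iff)
    qed
    let ?\<mu> = "\<mu>(c := \<mu> c - 1)"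
    have "(\<Sum>x\<in>X. ?\<mu> x) \<le> degree ?G"
    proof (rule less.hyps)
      show "degree ?G < degree F" using deg by simp
      show "\<not> [:int p:] dvd ?G" by (fact nG)
      show "?\<mu> x \<le> p" if "x \<in> X" for x using less.prems(2)[OF that] by auto
      show "int p dvd poly ((pderiv ^^ l) ?G) x" if "x \<in> X" "l < ?\<mu> x" for x l
      proof (cases "x = c")
        case True
        \<comment> \<open>At c itself the term with x - c vanishes and the factor l + 1 < p is
          invertible, which costs one order. At the other points x - c is invertible and an
          induction on l keeps the full order.\<close>
        then have l: "Suc l < \<mu> c" using that by simp
        from step[OF c(1) l] have "int p dvd int (Suc l) * poly ((pderiv ^^ l) ?G) c" by simp
        moreover have "\<not> int p dvd int (Suc l)"
          using l less.prems(2)[OF c(1)] by (auto dest!: zdvd_imp_le)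
        ultimately show ?thesis using p True by (simp add: prime_dvd_mult_iff)
      next
        case False
        have "\<not> int p dvd x - c"
        proof
          assume "int p dvd x - c"
          then have "x mod int p = c mod int p" by (simp add: mod_eq_dvd_iff)
          then show False using False X that(1) c(1)
            by (metis atLeastLessThan_iff mod_pos_pos_trivial subsetD)
        qed
        moreover have "l < \<mu> x" using that False by simp
        ultimately show ?thesis
        proof (induction l)
          case 0
          from step[OF that(1) 0(2)] 0 p show ?case by (simp add: prime_dvd_mult_iff)
        next
          case (Suc l)
          have "int p dvd poly ((pderiv ^^ l) ?G) x" using Suc by simp
          moreover have "int p dvd (x - c) * poly ((pderiv ^^ Suc l) ?G) x +
            int (Suc l) * poly ((pderiv ^^ l) ?G) x" using step[OF that(1) Suc.prems(2)] by simp
          ultimately have "int p dvd (x - c) * poly ((pderiv ^^ Suc l) ?G) x"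
            by (metis dvd_add_left_iff dvd_mult)
          then show ?case using p Suc.prems(1) by (simp add: prime_dvd_mult_iff)
        qed
      qed
    qed
    moreover have "(\<Sum>x\<in>X. \<mu> x) = Suc (\<Sum>x\<in>X. ?\<mu> x)"
      using fin c by (simp add: sum.remove[of X c])
    ultimately show ?thesis using deg by simp
  qed
qed

section \<open>Divisibility by x^s in F_p[x]\<close>

definition low_zero :: "nat \<Rightarrow> nat \<Rightarrow> int poly \<Rightarrow> bool" where
  "low_zero p s f \<longleftrightarrow> (\<forall>i<s. int p dvd Polynomial.coeff f i)"

lemma low_zero_mult: "low_zero p s f \<Longrightarrow> low_zero p s (g * f)"
  unfolding low_zero_def coeff_mult by (intro allI impI dvd_sum dvd_mult) auto

lemma low_zero_diff: "low_zero p s f \<Longrightarrow> low_zero p s g \<Longrightarrow> low_zero p s (f - g)"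
  unfolding low_zero_def by auto

lemma low_zero_mono: "low_zero p s f \<Longrightarrow> s' \<le> s \<Longrightarrow> low_zero p s' f"
  unfolding low_zero_def by auto

lemma low_zero_pderiv: "low_zero p s f \<Longrightarrow> low_zero p (s - 1) (pderiv f)"
  unfolding low_zero_def coeff_pderiv by (auto intro!: dvd_mult)

lemma low_zero_const_dvd: "[:int p:] dvd f \<Longrightarrow> low_zero p s f"
  unfolding low_zero_def const_poly_dvd_iff by blast

text \<open>As a power series over F_p, \<open>y\<close> is a unit, so x^s would divide
  \<open>h\<close> itself, whose degree is too small. The proof inspects the lowest coefficient of
  \<open>h\<close> that p does not divide.\<close>

lemma low_zero_mult_unit_imp_dvd:
  assumes p: "prime p" and low: "low_zero p s (h * y)" and deg: "degree h < s"
    and y: "\<not> int p dvd Polynomial.coeff y 0"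
  shows "[:int p:] dvd h"
proof (rule ccontr)
  assume "\<not> [:int p:] dvd h"
  then have ex: "\<exists>i. \<not> int p dvd Polynomial.coeff h i" by (simp add: const_poly_dvd_iff)
  define i where "i = (LEAST i. \<not> int p dvd Polynomial.coeff h i)"
  have i: "\<not> int p dvd Polynomial.coeff h i" unfolding i_def using ex by (rule LeastI_ex)
  have less: "int p dvd Polynomial.coeff h l" if "l < i" for l
    using that not_less_Least unfolding i_def by blast
  have "i \<le> degree h" using i by (metis coeff_eq_0 dvd_0_right not_le)
  then have "int p dvd Polynomial.coeff (h * y) i" using low deg by (simp add: low_zero_def)
  moreover have "Polynomial.coeff (h * y) i = (\<Sum>l<i. Polynomial.coeff h l * Polynomial.coeff y (i - l)) + Polynomial.coeff h i * Polynomial.coeff y 0"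
    unfolding coeff_mult by (simp add: lessThan_Suc_atMost[symmetric])
  moreover have "int p dvd (\<Sum>l<i. Polynomial.coeff h l * Polynomial.coeff y (i - l))"
    using less by (intro dvd_sum dvd_mult2) auto
  ultimately have "int p dvd Polynomial.coeff h i * Polynomial.coeff y 0" by (simp add: dvd_add_right_iff)
  then show False using i y p by (simp add: prime_dvd_mult_iff)
qed

section \<open>Products of powers, logarithmic derivatives, Wronskians\<close>

definition lin_prod :: "int set \<Rightarrow> int poly" where
  "lin_prod X = (\<Prod>c\<in>X. [:-c, 1:])"

text \<open>In the application q = (p - 1) / m. The degree is then of the order of p, but at a point
  where the q-th powers of all x - c are prescribed the value is a known constant.\<close>

definition pow_prod :: "int set \<Rightarrow> nat \<Rightarrow> (int \<Rightarrow> nat) \<Rightarrow> int poly" where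
  "pow_prod X q j = (\<Prod>c\<in>X. [:-c, 1:] ^ (j c * q))"

text \<open>The quotient \<open>log_num X q j\<close> / \<open>lin_prod X\<close> is the logarithmic
  derivative of \<open>pow_prod X q j\<close>. Both polynomials have degree at most
  \<open>card X\<close>, however large q is.\<close>

definition log_num :: "int set \<Rightarrow> nat \<Rightarrow> (int \<Rightarrow> nat) \<Rightarrow> int poly" where
  "log_num X q j = (\<Sum>c\<in>X. Polynomial.smult (int (j c * q)) (lin_prod (X - {c})))"

lemma linear_mult_pderiv_power:
  "[:-c, 1:] * pderiv ([:-c, 1:] ^ n) = Polynomial.smult (int n) ([:-c, 1:] ^ n :: int poly)"
proof (cases n)
  case (Suc k)
  have "pderiv [:-c, 1:] = 1" by (simp add: pderiv_pCons)
  then show ?thesis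
    unfolding Suc pderiv_power_Suc by (simp only: mult_1_right mult_smult_right power_Suc of_nat_id)
qed simp

lemma lin_prod_pderiv_pow_prod:
  assumes "finite X"
  shows "lin_prod X * pderiv (pow_prod X q j) = log_num X q j * pow_prod X q j"
proof -
  have "lin_prod X * (prod (\<lambda>c. [:-c, 1:] ^ (j c * q)) (X - {c}) * pderiv ([:-c, 1:] ^ (j c * q))) =
      Polynomial.smult (int (j c * q)) (lin_prod (X - {c})) * pow_prod X q j" if "c \<in> X" for c
  proof -
    have 1: "lin_prod X = [:-c, 1:] * lin_prod (X - {c})"
      unfolding lin_prod_def using assms that by (rule prod.remove)
    have 2: "pow_prod X q j = [:-c, 1:] ^ (j c * q) * prod (\<lambda>c. [:-c, 1:] ^ (j c * q)) (X - {c})"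
      unfolding pow_prod_def using assms that by (rule prod.remove)
    have "lin_prod X * (prod (\<lambda>c. [:-c, 1:] ^ (j c * q)) (X - {c}) * pderiv ([:-c, 1:] ^ (j c * q)))
       = lin_prod (X - {c}) * prod (\<lambda>c. [:-c, 1:] ^ (j c * q)) (X - {c}) *
          ([:-c, 1:] * pderiv ([:-c, 1:] ^ (j c * q)))"
      unfolding 1 by (simp only: mult_ac)
    also have "\<dots> = Polynomial.smult (int (j c * q)) (lin_prod (X - {c})) * pow_prod X q j"
      unfolding linear_mult_pderiv_power 2
      by (simp only: mult_smult_left mult_smult_right mult_ac)
    finally show ?thesis .
  qed
  then show ?thesis
    unfolding pow_prod_def pderiv_prod sum_distrib_left
    by (simp add: log_num_def sum_distrib_right pow_prod_def)
qed

lemma degree_lin_prod: "finite X \<Longrightarrow> degree (lin_prod X) \<le> card X"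
  unfolding lin_prod_def by (rule order_trans[OF degree_prod_sum_le]) auto

lemma degree_log_num: "finite X \<Longrightarrow> degree (log_num X q j) \<le> card X"
  unfolding log_num_def
  by (intro degree_sum_le order_trans[OF degree_smult_le] order_trans[OF degree_lin_prod])
    (auto intro: card_mono)

lemma degree_pow_prod:
  assumes "finite X" "\<And>c. c \<in> X \<Longrightarrow> j c * q \<le> b"
  shows "degree (pow_prod X q j) \<le> card X * b"
proof -
  have "degree (pow_prod X q j) \<le> (\<Sum>c\<in>X. degree ([:-c, 1:] ^ (j c * q) :: int poly))"
    unfolding pow_prod_def using degree_prod_sum_le[OF assms(1)] by (simp add: o_def)
  also have "\<dots> \<le> (\<Sum>c\<in>X. b)"
    using assms(2) by (intro sum_mono) (simp add: degree_linear_power)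
  finally show ?thesis by simp
qed

lemma coeff_0_pow_prod:
  assumes "prime p" "finite X" "\<And>c. c \<in> X \<Longrightarrow> \<not> int p dvd c"
  shows "\<not> int p dvd Polynomial.coeff (pow_prod X q j) 0"
proof -
  have "Polynomial.coeff (pow_prod X q j) 0 = (\<Prod>c\<in>X. (- c) ^ (j c * q))"
    unfolding poly_0_coeff_0[symmetric] pow_prod_def by (simp add: poly_prod)
  moreover have P: "prime (int p)" using assms(1) by simp
  ultimately show ?thesis using assms
    by (auto simp: prime_dvd_prod_iff dest!: prime_dvd_power[OF P])
qed

text \<open>The numerator of the logarithmic derivative of $(h_j y_j)/(h_i y_i)$, where $y_j$ is
  \<open>pow_prod X q j\<close>; its vanishing would make this quotient a constant of the derivation.\<close>

definition wronskian :: "int set \<Rightarrow> nat \<Rightarrow> (int \<Rightarrow> nat) \<Rightarrow> (int \<Rightarrow> nat) \<Rightarrow> int poly \<Rightarrow> int poly \<Rightarrow> int poly" where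
  "wronskian X q i j f g = f * (lin_prod X * pderiv g + log_num X q j * g)
     - g * (lin_prod X * pderiv f + log_num X q i * f)"

lemma poly_lin_prod_Diff:
  assumes "finite X" "c \<in> X"
  shows "poly (log_num X q j) c = int (j c * q) * poly (lin_prod (X - {c})) c"
proof -
  have "poly (lin_prod (X - {d})) c = 0" if "d \<in> X - {c}" for d
    using assms that by (auto simp: lin_prod_def poly_prod)
  then show ?thesis
    unfolding log_num_def poly_sum using assms by (simp add: sum.remove[of X c])
qed

text \<open>A residue computation: with y_j for \<open>pow_prod X q j\<close>, the logarithmic
  derivative of the quotient of (x - c)^b g y_j by (x - c)^a f y_i has the residue b - a + (j c - i
  c) q at c. The value of \<open>R\<close> at c is this residue times the values of f, g and the
  other linear factors.\<close>

lemma wronskian_linear_powers: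
  assumes X: "finite X" "c \<in> X"
  shows "\<exists>R. wronskian X q i j ([:-c, 1:] ^ a * f) ([:-c, 1:] ^ b * g) = [:-c, 1:] ^ (a + b) * R \<and>
    poly R c = (int b - int a + (int (j c) - int (i c)) * int q) *
      poly (lin_prod (X - {c})) c * poly f c * poly g c"
proof -
  define L :: "int poly" where "L = [:-c, 1:]"
  define G where "G = lin_prod (X - {c})"
  have lin: "lin_prod X = L * G"
    unfolding lin_prod_def L_def G_def using X by (rule prod.remove)
  have der: "L * pderiv (L ^ a * f) = L ^ a * (of_nat a * f + L * pderiv f)" for a f
  proof -
    have "L * pderiv (L ^ a * f) = f * (L * pderiv (L ^ a)) + L * L ^ a * pderiv f"
      unfolding pderiv_mult by (simp only: algebra_simps)
    also have "L * pderiv (L ^ a) = of_nat a * L ^ a"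
      unfolding L_def linear_mult_pderiv_power by (simp add: of_nat_poly)
    finally show ?thesis by (simp only: algebra_simps)
  qed
  define R where "R = f * (G * (of_nat b * g + L * pderiv g) + log_num X q j * g)
     - g * (G * (of_nat a * f + L * pderiv f) + log_num X q i * f)"
  have "wronskian X q i j (L ^ a * f) (L ^ b * g) =
     L ^ a * f * (G * (L * pderiv (L ^ b * g)) + log_num X q j * (L ^ b * g))
     - L ^ b * g * (G * (L * pderiv (L ^ a * f)) + log_num X q i * (L ^ a * f))"
    unfolding wronskian_def lin by (simp only: algebra_simps)
  also have "\<dots> = L ^ (a + b) * R"
    unfolding der R_def power_add by (simp only: algebra_simps)
  finally have 1: "wronskian X q i j (L ^ a * f) (L ^ b * g) = L ^ (a + b) * R" .
  have "poly L c = 0" by (simp add: L_def)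
  then have "poly R c = (int b - int a + (int (j c) - int (i c)) * int q) *
      poly G c * poly f c * poly g c"
    unfolding R_def by (simp add: poly_lin_prod_Diff[OF X] G_def[symmetric] algebra_simps)
  with 1 show ?thesis unfolding L_def G_def by blast
qed


text \<open>Constants have derivative zero, so the Wronskian is well defined on F_p[x]. This is
  needed because the factorizations at c hold only modulo p.\<close>

lemma wronskian_cong:
  assumes "P = [:b:]"
  shows "P dvd wronskian X q i j (f + P * u) (g + P * w) - wronskian X q i j f g"
proof -
  have P: "pderiv P = 0" using assms by (simp add: pderiv_pCons)
  have "wronskian X q i j (f + P * u) (g + P * w) - wronskian X q i j f g =
    P * (u * (lin_prod X * pderiv (g + P * w) + log_num X q j * (g + P * w))
      + f * (lin_prod X * pderiv w + log_num X q j * w)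
      - w * (lin_prod X * pderiv (f + P * u) + log_num X q i * (f + P * u))
      - g * (lin_prod X * pderiv u + log_num X q i * u))"
    unfolding wronskian_def pderiv_add pderiv_mult P mult_zero_right add_0_right
    by (simp only: algebra_simps)
  then show ?thesis by simp
qed

text \<open>If the Wronskian vanished modulo p, so would the residue b - a + (j c - i c) q.
  Multiplied by m, with q m = -1 modulo p, this makes m (b - a) - (j c - i c) divisible by p. By the
  bound \<open>d\<close> it is smaller than p, hence zero; but then m divides j c - i c, although 0
  < |j c - i c| < m.\<close>

lemma wronskian_not_dvd:
  assumes p: "prime p" and qm: "q * m = p - 1" and X: "X \<subseteq> {0..<int p}" and c: "c \<in> X"
    and ij: "i c < m" "j c < m" "i c \<noteq> j c"
    and f: "\<not> [:int p:] dvd f" "degree f \<le> d" and g: "\<not> [:int p:] dvd g" "degree g \<le> d"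
    and d: "m * (d + 1) < p"
  shows "\<not> [:int p:] dvd wronskian X q i j f g"
proof
  assume W: "[:int p:] dvd wronskian X q i j f g"
  have fin: "finite X" using X finite_subset by blast
  from f obtain a f' u where f': "f = [:-c, 1:] ^ a * f' + [:int p:] * u" "a \<le> degree f"
    "\<not> int p dvd poly f' c" using linear_power_factor_mod_prime[OF p] by metis
  from g obtain b g' w where g': "g = [:-c, 1:] ^ b * g' + [:int p:] * w" "b \<le> degree g"
    "\<not> int p dvd poly g' c" using linear_power_factor_mod_prime[OF p] by metis
  obtain R where R: "wronskian X q i j ([:-c, 1:] ^ a * f') ([:-c, 1:] ^ b * g') = [:-c, 1:] ^ (a + b) * R"
    "poly R c = (int b - int a + (int (j c) - int (i c)) * int q) *
      poly (lin_prod (X - {c})) c * poly f' c * poly g' c"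
    using wronskian_linear_powers[OF fin c] by blast
  have pe: "prime_elem [:int p:]" using p by (rule prime_elem_const_int_poly)
  have "[:int p:] dvd [:-c, 1:] ^ (a + b) * R"
    using wronskian_cong[OF refl, of "int p" X q i j "[:-c, 1:] ^ a * f'" u "[:-c, 1:] ^ b * g'" w] W
    unfolding f'(1)[symmetric] g'(1)[symmetric] R(1) by (metis dvd_diff_right_iff)
  then have "[:int p:] dvd R"
    using pe not_const_dvd_linear[OF p, of c] by (metis prime_elem_dvd_mult_iff prime_elem_dvd_power)
  then have "int p dvd poly R c" by (rule const_poly_dvd_imp_dvd_poly)
  moreover have pp: "prime (int p)" using p by simp
  moreover have "\<not> int p dvd poly (lin_prod (X - {c})) c"
  proof
    assume "int p dvd poly (lin_prod (X - {c})) c"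
    then obtain e where e: "e \<in> X - {c}" "int p dvd c - e"
      using fin pp by (auto simp: lin_prod_def poly_prod prime_dvd_prod_iff)
    then have "c mod int p = e mod int p" by (simp add: mod_eq_dvd_iff)
    then show False using e(1) c X by (metis DiffE atLeastLessThan_iff insertI1 mod_pos_pos_trivial subsetD)
  qed
  ultimately have "int p dvd int b - int a + (int (j c) - int (i c)) * int q"
    using f'(3) g'(3) unfolding R(2) by (simp add: prime_dvd_mult_iff)
  then have "int p dvd int m * (int b - int a + (int (j c) - int (i c)) * int q)" by (rule dvd_mult)
  moreover have "int m * (int b - int a + (int (j c) - int (i c)) * int q) =
     int m * (int b - int a) - (int (j c) - int (i c)) + (int (j c) - int (i c)) * int p"
  proof -
    have "int p = int q * int m + 1" using qm p
      by (metis le_add_diff_inverse2 of_nat_1 of_nat_add of_nat_mult prime_ge_1_nat)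
    then show ?thesis by (simp add: algebra_simps)
  qed
  ultimately have dvd: "int p dvd int m * (int b - int a) - (int (j c) - int (i c))"
    by (simp add: dvd_add_left_iff)
  have "\<bar>int m * (int b - int a) - (int (j c) - int (i c))\<bar> \<le> \<bar>int m * (int b - int a)\<bar> + \<bar>int (j c) - int (i c)\<bar>"
    by (rule abs_triangle_ineq4)
  moreover have "\<bar>int m * (int b - int a)\<bar> \<le> int m * int d"
    unfolding abs_mult using f'(2) g'(2) f(2) g(2) by (intro mult_mono) auto
  moreover have "\<bar>int (j c) - int (i c)\<bar> \<le> int m" using ij by auto
  moreover have "int m * int d + int m < int p"
    using d by (simp add: algebra_simps flip: of_nat_mult of_nat_add)
  ultimately have less: "\<bar>int m * (int b - int a) - (int (j c) - int (i c))\<bar> < int p" by linarith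
  have "int m * (int b - int a) - (int (j c) - int (i c)) = 0"
  proof (rule ccontr)
    assume "int m * (int b - int a) - (int (j c) - int (i c)) \<noteq> 0"
    from dvd_imp_le_int[OF this dvd] less show False by simp
  qed
  then have "int m dvd int (j c) - int (i c)" by (metis dvd_triv_left eq_iff_diff_eq_0)
  then have "\<bar>int m\<bar> \<le> \<bar>int (j c) - int (i c)\<bar>" using ij by (intro dvd_imp_le_int) auto
  then show False using ij by auto
qed

lemma degree_wronskian:
  assumes "finite X" "degree f \<le> d" "degree g \<le> d"
  shows "degree (wronskian X q i j f g) \<le> 2 * d + card X"
proof -
  have "degree (lin_prod X * pderiv h + log_num X q k * h) \<le> d + card X" if "degree h \<le> d" for h k
  proof (rule degree_add_le)
    show "degree (lin_prod X * pderiv h) \<le> d + card X"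
      using degree_mult_le[of "lin_prod X" "pderiv h"] degree_lin_prod[OF assms(1)] degree_pderiv[of h] that
      by linarith
    show "degree (log_num X q k * h) \<le> d + card X"
      using degree_mult_le[of "log_num X q k" h] degree_log_num[OF assms(1), of q k] that
      by linarith
  qed
  note * = this
  have "degree (f' * (lin_prod X * pderiv h + log_num X q k * h)) \<le> 2 * d + card X"
    if "degree h \<le> d" "degree f' \<le> d" for f' h k
    using degree_mult_le[of f' "lin_prod X * pderiv h + log_num X q k * h"] *[OF that(1), of k] that
    by linarith
  then show ?thesis
    unfolding wronskian_def using assms(2,3) by (intro degree_diff_le) auto
qed

text \<open>Induction on \<open>card J\<close>: dividing the relation by one of its terms and differentiating eliminates that
  term and replaces the other coefficients by Wronskians, which doubles the degree bound.\<close>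

lemma pow_prods_independent:
  assumes p: "prime p" and qm: "q * m = p - 1" and X: "X \<subseteq> {0..<int p}" "0 \<notin> X"
    and J: "finite J" "J \<subseteq> PiE X (\<lambda>_. {..<m})"
    and deg: "\<And>j. j \<in> J \<Longrightarrow> degree (h j) \<le> d"
    and low: "low_zero p s (\<Sum>j\<in>J. h j * pow_prod X q j)"
    and s: "2 ^ card J * (d + card X) + card J < s" and d: "m * (2 ^ card J * (d + card X) + 1) < p"
    and j: "j \<in> J"
  shows "[:int p:] dvd h j"
  using J deg low s d j
proof (induction "card J" arbitrary: J h d s j rule: less_induct)
  case less
  have finX: "finite X" using X(1) finite_subset by blast
  show ?case
  proof (rule ccontr)
    assume nj: "\<not> [:int p:] dvd h j"
    let ?J = "J - {j}"
    have card: "card J = Suc (card ?J)" using less.prems by (metis card_Suc_Diff1)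
    have le: "2 * d + card X + card X \<le> 2 * (d + card X)" by simp
    have pow: "2 ^ card J = 2 * (2::nat) ^ card ?J" using card by simp
    \<comment> \<open>The budget 2^|J| (d + n), n = \<open>card X\<close>, survives the step:
      Wronskians have the degree bound 2 d + n, one has (2 d + n) + n = 2 (d + n), and
      \<open>J\<close> has lost an element.\<close>
    have mono: "2 ^ card ?J * (2 * d + card X + card X) \<le> 2 ^ card J * (d + card X)"
      unfolding pow using mult_left_mono[OF le, of "2 ^ card ?J"] by (simp add: algebra_simps)
    have d1: "d + card X \<le> 2 ^ card J * (d + card X)" by simp
    have all: "[:int p:] dvd h i" if i: "i \<in> ?J" for i
    proof (rule ccontr)
      assume ni: "\<not> [:int p:] dvd h i"
      have ij: "i \<in> PiE X (\<lambda>_. {..<m})" "j \<in> PiE X (\<lambda>_. {..<m})" "i \<noteq> j"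
        using i less.prems by auto
      then obtain c where c: "c \<in> X" "j c \<noteq> i c" by (metis PiE_ext)
      have "[:int p:] dvd wronskian X q j i (h j) (h i)"
      proof (rule less.hyps[of ?J "\<lambda>i. wronskian X q j i (h j) (h i)" "2 * d + card X" "s - 1"])
        show "card ?J < card J" using card by simp
        show "finite ?J" "?J \<subseteq> PiE X (\<lambda>_. {..<m})" "i \<in> ?J" using less.prems i by auto
        show "degree (wronskian X q j i (h j) (h i)) \<le> 2 * d + card X" if "i \<in> ?J" for i
          using less.prems that by (intro degree_wronskian finX) auto
        show "2 ^ card ?J * (2 * d + card X + card X) + card ?J < s - 1"
          using less.prems(5) mono card by linarith
        show "m * (2 ^ card ?J * (2 * d + card X + card X) + 1) < p"
          using less.prems(6) mono by (meson add_le_mono1 le_less_trans mult_le_mono2)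
        let ?B = "\<Sum>j\<in>J. h j * pow_prod X q j"
        let ?T = "\<lambda>i. lin_prod X * pderiv (h i) + log_num X q i * h i"
        have B': "lin_prod X * pderiv ?B = (\<Sum>i\<in>J. ?T i * pow_prod X q i)"
          unfolding higher_pderiv_sum[of 1, simplified] sum_distrib_left
        proof (rule sum.cong[OF refl])
          fix i
          have "lin_prod X * pderiv (h i * pow_prod X q i) =
             h i * (lin_prod X * pderiv (pow_prod X q i)) + lin_prod X * pderiv (h i) * pow_prod X q i"
            unfolding pderiv_mult by (simp only: algebra_simps)
          then show "lin_prod X * pderiv (h i * pow_prod X q i) = ?T i * pow_prod X q i"
            unfolding lin_prod_pderiv_pow_prod[OF finX] by (simp only: algebra_simps)
        qed
        \<comment> \<open>Up to the factor y_j this is \<open>lin_prod X\<close> times the numerator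
          of the derivative of B / (h_j y_j), so the j-th term cancels. One derivative of
          \<open>?B\<close> is taken, hence the order s - 1 at 0.\<close>
        have "h j * (lin_prod X * pderiv ?B) - ?T j * ?B =
            (\<Sum>i\<in>J. wronskian X q j i (h j) (h i) * pow_prod X q i)"
          unfolding B' sum_distrib_left sum_subtractf[symmetric] wronskian_def
          by (intro sum.cong refl) (simp only: algebra_simps)
        also have "\<dots> = (\<Sum>i\<in>?J. wronskian X q j i (h j) (h i) * pow_prod X q i)"
          using less.prems by (simp add: sum.remove[of J j]) (simp add: wronskian_def)
        finally have eq: "(\<Sum>i\<in>?J. wronskian X q j i (h j) (h i) * pow_prod X q i) =
          h j * (lin_prod X * pderiv ?B) - ?T j * ?B" by simp
        show "low_zero p (s - 1) (\<Sum>i\<in>?J. wronskian X q j i (h j) (h i) * pow_prod X q i)"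
          unfolding eq
          by (intro low_zero_diff low_zero_mult low_zero_pderiv low_zero_mono[OF less.prems(4)] less.prems(4)) simp
      qed
      moreover have "\<not> [:int p:] dvd wronskian X q j i (h j) (h i)"
      proof (rule wronskian_not_dvd[OF p qm X(1) c(1)])
        show "j c < m" "i c < m" using ij c(1) by auto
        show "m * (d + 1) < p" using less.prems(6) d1
          by (meson add_le_mono1 le_add1 le_less_trans le_trans mult_le_mono2)
        show "degree (h j) \<le> d" "degree (h i) \<le> d" using less.prems i by auto
      qed (use c nj ni in auto)
      ultimately show False by blast
    qed
    \<comment> \<open>With every other coefficient zero modulo p, x^s divides h_j y_j, and y_j has a
      nonzero constant term because 0 is not in \<open>X\<close>.\<close>
    have "low_zero p s ((\<Sum>j\<in>J. h j * pow_prod X q j) - (\<Sum>i\<in>?J. h i * pow_prod X q i))"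
      using all by (intro low_zero_diff less.prems low_zero_const_dvd dvd_sum dvd_mult2)
    also have "(\<Sum>j\<in>J. h j * pow_prod X q j) - (\<Sum>i\<in>?J. h i * pow_prod X q i) = h j * pow_prod X q j"
      using less.prems by (simp add: sum.remove[of J j])
    finally have "[:int p:] dvd h j"
    proof (rule low_zero_mult_unit_imp_dvd[OF p])
      show "degree (h j) < s" using less.prems(3)[OF less.prems(7)] less.prems(5) d1 by linarith
      have "\<not> int p dvd c" if "c \<in> X" for c
        using that X by (metis atLeastLessThan_iff le_less not_le subsetD zdvd_imp_le)
      then show "\<not> int p dvd Polynomial.coeff (pow_prod X q j) 0"
        using finX by (intro coeff_0_pow_prod p) auto
    qed
    with nj show False by blast
  qed
qed

section \<open>The auxiliary polynomial and its derivatives\<close>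

text \<open>The polynomial r_l for which the l-th derivative of h y_j is r_l y_j /
  \<open>lin_prod X\<close>^l. The subtracted summand comes from differentiating the denominator.
  The degree grows by at most \<open>card X\<close> in each step, although y_j has large
  degree.\<close>

primrec reduced_pderiv :: "int set \<Rightarrow> nat \<Rightarrow> (int \<Rightarrow> nat) \<Rightarrow> nat \<Rightarrow> int poly \<Rightarrow> int poly" where
  "reduced_pderiv X q j 0 h = h"
| "reduced_pderiv X q j (Suc l) h = lin_prod X * pderiv (reduced_pderiv X q j l h)
     + log_num X q j * reduced_pderiv X q j l h
     - of_nat l * pderiv (lin_prod X) * reduced_pderiv X q j l h"

lemma reduced_pderiv_diff:
  "reduced_pderiv X q j l (f - g) = reduced_pderiv X q j l f - reduced_pderiv X q j l g"
proof (induction l)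
  case (Suc l)
  show ?case unfolding reduced_pderiv.simps Suc pderiv_diff by (simp only: algebra_simps)
qed simp

lemma degree_reduced_pderiv:
  assumes "finite X"
  shows "degree (reduced_pderiv X q j l h) \<le> degree h + l * card X"
proof (induction l)
  case (Suc l)
  let ?r = "reduced_pderiv X q j l h"
  have 1: "degree (lin_prod X * pderiv ?r) \<le> degree h + Suc l * card X"
    using degree_mult_le[of "lin_prod X" "pderiv ?r"] degree_lin_prod[OF assms] degree_pderiv[of ?r] Suc
    by simp
  have 2: "degree (log_num X q j * ?r) \<le> degree h + Suc l * card X"
    using degree_mult_le[of "log_num X q j" ?r] degree_log_num[OF assms, of q j] Suc by simp
  have "degree (of_nat l * pderiv (lin_prod X)) \<le> card X"
    using degree_mult_le[of "of_nat l" "pderiv (lin_prod X)"] degree_pderiv[of "lin_prod X"]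
      degree_lin_prod[OF assms] by simp
  then have 3: "degree (of_nat l * pderiv (lin_prod X) * ?r) \<le> degree h + Suc l * card X"
    using degree_mult_le[of "of_nat l * pderiv (lin_prod X)" ?r] Suc by simp
  show ?case using 1 2 3 by (auto intro!: degree_diff_le degree_add_le simp del: mult_Suc)
qed simp

text \<open>In the application \<open>z\<close> is x^(kp), whose derivative vanishes modulo p, so
  that it passes through the derivatives as a constant.\<close>

lemma lin_prod_power_higher_pderiv:
  assumes X: "finite X" and z: "[:b:] dvd pderiv z"
  shows "[:b:] dvd lin_prod X ^ l * (pderiv ^^ l) (h * pow_prod X q j * z)
    - reduced_pderiv X q j l h * pow_prod X q j * z"
proof (induction l)
  case (Suc l)
  let ?G = "lin_prod X" and ?r = "reduced_pderiv X q j l h" and ?y = "pow_prod X q j"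
  let ?D = "(pderiv ^^ l) (h * ?y * z)"
  obtain w where w: "pderiv z = [:b:] * w" using z by (elim dvdE)
  obtain u where "?G ^ l * ?D - ?r * ?y * z = [:b:] * u" using Suc by (elim dvdE)
  then have u: "?G ^ l * ?D = ?r * ?y * z + [:b:] * u" by (simp only: algebra_simps)
  have b: "pderiv [:b:] = 0" by (simp add: pderiv_pCons)
  have "pderiv (?G ^ l) = of_nat l * (?G ^ (l - 1) * pderiv ?G)"
    by (simp add: pderiv_power of_nat_poly)
  then have "pderiv (?G ^ l) * ?G = of_nat l * ?G ^ l * pderiv ?G"
    by (cases l) (simp_all add: mult_ac)
  then have "?G ^ Suc l * pderiv ?D = ?G * pderiv (?G ^ l * ?D) - of_nat l * pderiv ?G * (?G ^ l * ?D)"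
    unfolding pderiv_mult[of "?G ^ l"] by (simp add: algebra_simps)
  also have "pderiv (?G ^ l * ?D) = pderiv ?r * ?y * z + ?r * pderiv ?y * z + [:b:] * (?r * ?y * w + pderiv u)"
    unfolding u pderiv_add pderiv_mult w b by (simp only: algebra_simps mult_zero_right add_0_right)
  also have "?G * (pderiv ?r * ?y * z + ?r * pderiv ?y * z + [:b:] * (?r * ?y * w + pderiv u)) =
     ?G * pderiv ?r * ?y * z + ?r * (?G * pderiv ?y) * z + [:b:] * (?G * (?r * ?y * w + pderiv u))"
    by (simp only: algebra_simps)
  also have "\<dots> - of_nat l * pderiv ?G * (?G ^ l * ?D) = reduced_pderiv X q j (Suc l) h * ?y * z +
     [:b:] * (?G * (?r * ?y * w + pderiv u) - of_nat l * pderiv ?G * u)"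
    unfolding lin_prod_pderiv_pow_prod[OF X] u reduced_pderiv.simps by (simp only: algebra_simps)
  finally show ?case unfolding funpow.simps o_apply by (simp only: add_diff_cancel_left' dvd_triv_left)
qed simp

text \<open>Let \<open>k0\<close> be the lowest block containing a nonzero coefficient polynomial
  modulo p. The blocks below it vanish modulo p, and those above it begin p degrees later. If the
  whole sum vanished, x^p would therefore divide the inner sum of block \<open>k0\<close>, contrary
  to \<open>pow_prods_independent\<close>.\<close>

lemma stepanov_polynomial_not_dvd:
  assumes p: "prime p" and qm: "q * m = p - 1" and X: "X \<subseteq> {0..<int p}" "0 \<notin> X"
    and J: "finite J" "J \<subseteq> PiE X (\<lambda>_. {..<m})"
    and deg: "\<And>j k. j \<in> J \<Longrightarrow> degree (h j k) \<le> d"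
    and s: "2 ^ card J * (d + card X) + card J < p" and d: "m * (2 ^ card J * (d + card X) + 1) < p"
    and nd: "i \<in> J" "k1 < K" "\<not> [:int p:] dvd h i k1"
  shows "\<not> [:int p:] dvd (\<Sum>k<K. Polynomial.monom 1 (k * p) * (\<Sum>j\<in>J. h j k * pow_prod X q j))"
proof
  define B where "B k = (\<Sum>j\<in>J. h j k * pow_prod X q j)" for k
  define C where "C k = Polynomial.monom 1 (k * p) * B k" for k
  assume "[:int p:] dvd (\<Sum>k<K. Polynomial.monom 1 (k * p) * (\<Sum>j\<in>J. h j k * pow_prod X q j))"
  then have F: "[:int p:] dvd (\<Sum>k<K. C k)" unfolding B_def C_def .
  define k0 where "k0 = (LEAST k. \<exists>j\<in>J. \<not> [:int p:] dvd h j k)"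
  have "\<exists>k. \<exists>j\<in>J. \<not> [:int p:] dvd h j k" using nd by blast
  then have "\<exists>j\<in>J. \<not> [:int p:] dvd h j k0" unfolding k0_def by (rule LeastI_ex)
  then obtain i0 where i0: "i0 \<in> J" "\<not> [:int p:] dvd h i0 k0" by blast
  have less: "[:int p:] dvd h j k" if "k < k0" "j \<in> J" for j k
    using not_less_Least[of k "\<lambda>k. \<exists>j\<in>J. \<not> [:int p:] dvd h j k"] that unfolding k0_def by blast
  have "k0 \<le> k1" unfolding k0_def using nd by (intro Least_le) blast
  then have k0: "k0 < K" using nd by simp
  have split: "(\<Sum>k<K. C k) = (\<Sum>k<k0. C k) + C k0 + (\<Sum>k\<in>{k0<..<K}. C k)"
  proof -
    have "{..<K} = insert k0 ({..<k0} \<union> {k0<..<K})" using k0 by auto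
    then have "(\<Sum>k<K. C k) = C k0 + (\<Sum>k\<in>{..<k0} \<union> {k0<..<K}. C k)" by simp
    also have "(\<Sum>k\<in>{..<k0} \<union> {k0<..<K}. C k) = (\<Sum>k<k0. C k) + (\<Sum>k\<in>{k0<..<K}. C k)"
      by (intro sum.union_disjoint) auto
    finally show ?thesis by simp
  qed
  have "low_zero p p (B k0)"
    unfolding low_zero_def
  proof (intro allI impI)
    fix l assume l: "l < p"
    have "[:int p:] dvd (\<Sum>k<k0. C k)"
      unfolding C_def B_def using less by (intro dvd_sum dvd_mult dvd_mult2) auto
    then have "[:int p:] dvd C k0 + (\<Sum>k\<in>{k0<..<K}. C k)"
      using F unfolding split by (metis add.assoc dvd_add_right_iff)
    then have "int p dvd Polynomial.coeff (C k0 + (\<Sum>k\<in>{k0<..<K}. C k)) (k0 * p + l)"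
      unfolding const_poly_dvd_iff by blast
    moreover have "Polynomial.coeff (C k) (k0 * p + l) = 0" if "k0 < k" for k
    proof -
      have "Suc k0 * p \<le> k * p" using that by (intro mult_le_mono1) simp
      then show ?thesis using l unfolding C_def by (simp add: coeff_monom_mult)
    qed
    ultimately show "int p dvd Polynomial.coeff (B k0) l"
      by (simp add: coeff_sum C_def coeff_monom_mult)
  qed
  then have "[:int p:] dvd h i0 k0"
    unfolding B_def using pow_prods_independent[OF p qm X J, of "\<lambda>j. h j k0" d p i0] deg s d i0 by blast
  with i0 show False by blast
qed

text \<open>A homogeneous linear system over F_p with fewer equations than unknowns has a nonzero
  solution. The pigeonhole principle finds it as a difference of two reduced vectors, so
  \<open>L\<close> only has to respect such differences.\<close>

lemma pigeonhole_mod_linear: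
  fixes L :: "('a \<Rightarrow> int) \<Rightarrow> 'b \<Rightarrow> int"
  assumes p: "p > 1" and U: "finite U" and V: "finite V" "card V < card U"
    and lin: "\<And>u w e. u \<in> PiE U (\<lambda>_. {0..<int p}) \<Longrightarrow> w \<in> PiE U (\<lambda>_. {0..<int p}) \<Longrightarrow> e \<in> V \<Longrightarrow>
      L (\<lambda>x. u x - w x) e = L u e - L w e"
  obtains u x where "x \<in> U" "\<not> int p dvd u x" "\<And>e. e \<in> V \<Longrightarrow> int p dvd L u e"
proof -
  define f where "f u = (\<lambda>e\<in>V. L u e mod int p)" for u
  let ?A = "PiE U (\<lambda>_. {0..<int p})" and ?B = "PiE V (\<lambda>_. {0..<int p})"
  have "f ` ?A \<subseteq> ?B" using p by (auto simp: f_def)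
  then have "card (f ` ?A) \<le> card ?B" using V(1) by (intro card_mono finite_PiE) auto
  also have "\<dots> < card ?A" using U V p by (simp add: card_PiE)
  finally have "\<not> inj_on f ?A" by (rule pigeonhole)
  then obtain u w where uw: "u \<in> ?A" "w \<in> ?A" "u \<noteq> w" "f u = f w" unfolding inj_on_def by blast
  then obtain x where x: "x \<in> U" "u x \<noteq> w x" by (metis PiE_ext)
  have "\<not> int p dvd u x - w x"
  proof
    assume "int p dvd u x - w x"
    then have "u x mod int p = w x mod int p" by (simp add: mod_eq_dvd_iff)
    moreover have "u x \<in> {0..<int p}" "w x \<in> {0..<int p}" using uw x by auto
    ultimately show False using x by simp
  qed
  moreover have "int p dvd L (\<lambda>x. u x - w x) e" if e: "e \<in> V" for e
  proof -
    have "L u e mod int p = L w e mod int p" using uw(4) e unfolding f_def by (metis restrict_apply')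
    then show ?thesis unfolding lin[OF uw(1,2) e] by (simp add: mod_eq_dvd_iff)
  qed
  ultimately show ?thesis using that[of x "\<lambda>x. u x - w x"] x by blast
qed

text \<open>At a counted point $x$ one has $x^p=x$ and $y_j(x)=z_j$, so the $l$-th derivative of the auxiliary
  polynomial $\sum_k x^{kp}\sum_j h_{jk}y_j$ vanishes there if the polynomial of low degree below is
  zero modulo $p$; this is a linear system for the coefficients of the $h_{jk}$.\<close>

lemma stepanov_coefficients_exist:
  fixes K A M m :: nat and z :: "(int \<Rightarrow> nat) \<Rightarrow> int"
  assumes p: "prime p" and X: "finite X" and J: "finite J" and A: "A > 0"
    and size: "M * (A + K + M * card X) < card J * K * A"
  obtains h i k where "i \<in> J" "k < K" "\<not> [:int p:] dvd h i k" "\<And>j k. degree (h j k) < A"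
    "\<And>l. l < M \<Longrightarrow> [:int p:] dvd (\<Sum>k<K. \<Sum>j\<in>J. Polynomial.monom (z j) k * reduced_pderiv X q j l (h j k))"
proof -
  define hh where "hh u j k = (\<Sum>a<A. Polynomial.monom (u (j, k, a)) a)" for u :: "(int \<Rightarrow> nat) \<times> nat \<times> nat \<Rightarrow> int" and j k
  define Q where "Q u l = (\<Sum>k<K. \<Sum>j\<in>J. Polynomial.monom (z j) k * reduced_pderiv X q j l (hh u j k))" for u l
  \<comment> \<open>There is one unknown for each coefficient of each h_jk, and one equation for
    each coefficient of the M polynomials \<open>Q u l\<close>. These have degree less than A + K +
    M \<open>card X\<close>: A accounts for h_jk, K for the monomial, and \<open>card X\<close> for
    each derivative.\<close>
  let ?U = "J \<times> {..<K} \<times> {..<A}" and ?V = "{..<M} \<times> {..<A + K + M * card X}"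
  have hh_diff: "hh (\<lambda>x. u x - w x) j k = hh u j k - hh w j k" for u w j k
    unfolding hh_def by (simp add: sum_subtractf flip: diff_monom)
  have Q_diff: "Q (\<lambda>x. u x - w x) l = Q u l - Q w l" for u w l
    unfolding Q_def hh_diff reduced_pderiv_diff by (simp add: algebra_simps sum_subtractf)
  have deg: "degree (hh u j k) < A" for u j k
  proof -
    have "degree (hh u j k) \<le> A - 1" unfolding hh_def
      by (intro degree_sum_le order_trans[OF degree_monom_le]) auto
    then show ?thesis using A by simp
  qed
  obtain u x where u: "x \<in> ?U" "\<not> int p dvd u x"
    "\<And>e. e \<in> ?V \<Longrightarrow> int p dvd (\<lambda>u (l, i). Polynomial.coeff (Q u l) i) u e"
  proof (rule pigeonhole_mod_linear[of p ?U ?V "\<lambda>u (l, i). Polynomial.coeff (Q u l) i"])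
    show "1 < p" using p by (rule prime_gt_1_nat)
    show "finite ?U" "finite ?V" using J by auto
    show "card ?V < card ?U" using size by (simp add: card_cartesian_product mult.assoc)
  qed (auto simp: Q_diff)
  obtain i k a where x: "x = (i, k, a)" "i \<in> J" "k < K" "a < A" using u(1) by auto
  have "Polynomial.coeff (hh u i k) a = u (i, k, a)"
    unfolding hh_def coeff_sum using x by (simp add: if_distrib cong: if_cong)
  then have nd: "\<not> [:int p:] dvd hh u i k" using u(2) x by (metis const_poly_dvd_iff)
  have "[:int p:] dvd Q u l" if l: "l < M" for l
    unfolding const_poly_dvd_iff
  proof
    fix i
    show "int p dvd Polynomial.coeff (Q u l) i"
    proof (cases "i < A + K + M * card X")
      case True
      then show ?thesis using u(3)[of "(l, i)"] l by simp
    next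
      case False
      have "degree (Q u l) \<le> A + K + M * card X - 1"
        unfolding Q_def
      proof (intro degree_sum_le)
        fix k j assume k: "k \<in> {..<K}"
        have "l * card X \<le> M * card X" using l by simp
        then show "degree (Polynomial.monom (z j) k * reduced_pderiv X q j l (hh u j k)) \<le> A + K + M * card X - 1"
          using degree_mult_le[of "Polynomial.monom (z j) k" "reduced_pderiv X q j l (hh u j k)"]
            degree_monom_le[of "z j" k] degree_reduced_pderiv[OF X, of q j l "hh u j k"] deg[of u j k]
            k[unfolded lessThan_iff] A by linarith
      qed (use J in auto)
      then have "degree (Q u l) < i" using False A by linarith
      then show ?thesis by (simp add: coeff_eq_0)
    qed
  qed
  then show ?thesis using that[of i k "hh u"] x nd deg unfolding Q_def by blast
qed

text \<open>The second condition in \<open>M\<close> makes the auxiliary polynomial exist, and the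
  conditions \<open>d\<close> make it nonzero modulo p. It vanishes to order M at each counted point
  and has degree at most (K + n) p.\<close>

lemma stepanov_bound:
  fixes K A M m p q :: nat and \<zeta> :: "int \<Rightarrow> int"
  assumes p: "prime p" and qm: "q * m = p - 1" and X: "X \<subseteq> {0..<int p}" "0 \<notin> X"
    and n: "n = card X" and B: "B = m ^ n"
    and A: "A > 0" "A \<le> p" and K: "K > 0" and M: "M \<le> p" "M * (A + K + M * n) < B * K * A"
    and d: "2 ^ B * (A + n) + B < p" "m * (2 ^ B * (A + n) + 1) < p"
    and \<zeta>: "\<And>c. c \<in> X \<Longrightarrow> \<not> int p dvd \<zeta> c"
  shows "card {x \<in> {0..<int p}. \<forall>c\<in>X. [(x - c) ^ q = \<zeta> c] (mod int p)} * M \<le> (K + n) * p"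
proof -
  have fin: "finite X" using X(1) finite_subset by blast
  have pp: "prime (int p)" using p by simp
  define J where "J = PiE X (\<lambda>_. {..<m})"
  have J: "finite J" "J \<subseteq> PiE X (\<lambda>_. {..<m})" "card J = B"
    using fin by (auto simp: J_def card_PiE B n intro: finite_PiE)
  define z where "z j = (\<Prod>c\<in>X. \<zeta> c ^ j c)" for j :: "int \<Rightarrow> nat"
  obtain h i k where h: "i \<in> J" "k < K" "\<not> [:int p:] dvd h i k" "\<And>j k. degree (h j k) < A"
    "\<And>l. l < M \<Longrightarrow> [:int p:] dvd (\<Sum>k<K. \<Sum>j\<in>J. Polynomial.monom (z j) k * reduced_pderiv X q j l (h j k))"
  proof (rule stepanov_coefficients_exist[OF p fin J(1) A(1), where M = M and K = K and z = z and q = q])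
    show "M * (A + K + M * card X) < card J * K * A" using M(2) unfolding J(3) n .
  qed blast
  define F where "F = (\<Sum>k<K. Polynomial.monom 1 (k * p) * (\<Sum>j\<in>J. h j k * pow_prod X q j))"
  have F2: "F = (\<Sum>k<K. \<Sum>j\<in>J. h j k * pow_prod X q j * Polynomial.monom 1 (k * p))"
    unfolding F_def sum_distrib_left by (simp add: mult_ac)
  define N where "N = {x \<in> {0..<int p}. \<forall>c\<in>X. [(x - c) ^ q = \<zeta> c] (mod int p)}"
  have nd: "\<not> [:int p:] dvd F" unfolding F_def
  proof (rule stepanov_polynomial_not_dvd[OF p qm X J(1,2), where d = A and i = i and ?k1.0 = k])
    show "degree (h j k) \<le> A" for j k using h(4)[of j k] by simp
  qed (use d J n h in auto)
  have "(\<Sum>x\<in>N. M) \<le> degree F"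
  proof (rule sum_vanishing_orders_le_degree[OF p _ nd])
    show "N \<subseteq> {0..<int p}" by (auto simp: N_def)
    show "int p dvd poly ((pderiv ^^ l) F) x" if x: "x \<in> N" and l: "l < M" for x l
    proof -
      have xc: "[(x - c) ^ q = \<zeta> c] (mod int p)" if "c \<in> X" for c using x that by (auto simp: N_def)
      have "q > 0" using qm prime_gt_1_nat[OF p] by (cases "q = 0") auto
      \<comment> \<open>Since \<zeta> c is a unit and q > 0, no counted point is congruent to an
        element of \<open>X\<close>; powers of \<open>lin_prod X\<close> can be cancelled
        there.\<close>
      have nz: "\<not> int p dvd poly (lin_prod X) x"
      proof
        assume "int p dvd poly (lin_prod X) x"
        then obtain c where c: "c \<in> X" "int p dvd x - c"
          using fin pp by (auto simp: lin_prod_def poly_prod prime_dvd_prod_iff)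
        then have "int p dvd (x - c) ^ q" using \<open>q > 0\<close> by (metis dvd_power dvd_trans)
        then show False using xc[OF c(1)] \<zeta>[OF c(1)] by (metis cong_dvd_iff)
      qed
      have y: "[poly (pow_prod X q j) x = z j] (mod int p)" for j
        unfolding pow_prod_def z_def poly_prod
      proof (rule cong_prod)
        fix c assume "c \<in> X"
        have "poly ([:- c, 1:] ^ (j c * q)) x = ((x - c) ^ q) ^ j c"
          by (simp add: power_mult[symmetric] mult.commute)
        then show "[poly ([:- c, 1:] ^ (j c * q)) x = \<zeta> c ^ j c] (mod int p)"
          using cong_pow[OF xc[OF \<open>c \<in> X\<close>]] by simp
      qed
      have frob: "[x ^ (k * p) = x ^ k] (mod int p)" for k
      proof -
        have "[x ^ p = x] (mod int p)"
        proof (cases "int p dvd x")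
          case True
          moreover have "p > 0" using prime_gt_0_nat[OF p] .
          ultimately show ?thesis using dvd_power_le[of "int p" x 1 p]
            by (metis cong_0_iff cong_sym cong_trans dvd_power dvd_trans)
        next
          case False
          obtain y where y: "x = int y" using x by (auto simp: N_def dest: zero_le_imp_eq_int)
          have "[y ^ (p - 1) = 1] (mod p)" using False y by (intro fermat_theorem[OF p]) simp
          then have "[x ^ (p - 1) = 1] (mod int p)"
            unfolding y by (metis cong_int_iff of_nat_1 of_nat_power)
          then have "[x * x ^ (p - 1) = x * 1] (mod int p)" by (rule cong_scalar_left)
          then show ?thesis using prime_gt_0_nat[OF p] by (simp flip: power_Suc)
        qed
        then show ?thesis by (metis cong_pow mult.commute power_mult)
      qed
      \<comment> \<open>Modulo p, x^(kp) becomes x^k and y_j(x) becomes z_j, which turns the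
        derivative into a value of the low-degree polynomial that was arranged to be zero.\<close>
      have "poly (lin_prod X) x ^ l * poly ((pderiv ^^ l) F) x =
          (\<Sum>k<K. \<Sum>j\<in>J. poly (lin_prod X ^ l * (pderiv ^^ l) (h j k * pow_prod X q j * Polynomial.monom 1 (k * p))) x)"
        unfolding F2 higher_pderiv_sum poly_sum sum_distrib_left by simp
      also have "[\<dots> = (\<Sum>k<K. \<Sum>j\<in>J. poly (reduced_pderiv X q j l (h j k)) x * z j * x ^ k)] (mod int p)"
      proof (intro cong_sum)
        fix k j
        have "pderiv (Polynomial.monom 1 (k * p)) = [:int p:] * Polynomial.monom (int k) (k * p - 1)"
          by (simp add: pderiv_monom smult_monom)
        then have "[:int p:] dvd pderiv (Polynomial.monom 1 (k * p))" by (metis dvd_triv_left)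
        note lin_prod_power_higher_pderiv[OF fin this, where l = l and h = "h j k" and q = q and j = j]
        from const_poly_dvd_imp_dvd_poly[OF this, of x]
        have "[poly (lin_prod X ^ l * (pderiv ^^ l) (h j k * pow_prod X q j * Polynomial.monom 1 (k * p))) x =
           poly (reduced_pderiv X q j l (h j k)) x * poly (pow_prod X q j) x * x ^ (k * p)] (mod int p)"
          unfolding cong_iff_dvd_diff by (simp add: poly_monom)
        also have "[poly (reduced_pderiv X q j l (h j k)) x * poly (pow_prod X q j) x * x ^ (k * p) =
           poly (reduced_pderiv X q j l (h j k)) x * z j * x ^ k] (mod int p)"
          by (intro cong_mult cong_refl y frob)
        finally show "[poly (lin_prod X ^ l * (pderiv ^^ l) (h j k * pow_prod X q j * Polynomial.monom 1 (k * p))) x =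
           poly (reduced_pderiv X q j l (h j k)) x * z j * x ^ k] (mod int p)" .
      qed
      also have "(\<Sum>k<K. \<Sum>j\<in>J. poly (reduced_pderiv X q j l (h j k)) x * z j * x ^ k) =
         poly (\<Sum>k<K. \<Sum>j\<in>J. Polynomial.monom (z j) k * reduced_pderiv X q j l (h j k)) x"
        by (simp add: poly_sum poly_monom mult_ac)
      also have "[\<dots> = 0] (mod int p)"
        using const_poly_dvd_imp_dvd_poly[OF h(5)[OF l], of x] by (simp add: cong_0_iff)
      finally have "int p dvd poly (lin_prod X) x ^ l * poly ((pderiv ^^ l) F) x"
        by (simp add: cong_0_iff)
      then show ?thesis using nz pp by (metis prime_dvd_mult_iff prime_dvd_power)
    qed
  qed (use M in auto)
  also have "degree F \<le> (K + n) * p"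
    unfolding F_def
  proof (intro degree_sum_le)
    fix k assume k: "k \<in> {..<K}"
    have "degree (\<Sum>j\<in>J. h j k * pow_prod X q j) \<le> p + n * p"
    proof (intro degree_sum_le J)
      fix j assume j: "j \<in> J"
      have "degree (pow_prod X q j) \<le> n * p"
        unfolding n
      proof (rule degree_pow_prod[OF fin])
        fix c assume "c \<in> X"
        then have "j c < m" using j J(2) by auto
        then have "j c * q \<le> m * q" by simp
        also have "m * q \<le> p" using qm by (simp add: mult.commute)
        finally show "j c * q \<le> p" .
      qed
      then show "degree (h j k * pow_prod X q j) \<le> p + n * p"
        using degree_mult_le[of "h j k" "pow_prod X q j"] h(4)[of j k] A by linarith
    qed
    moreover have "Suc k * p \<le> K * p" using k by (intro mult_le_mono1) simp
    ultimately show "degree (Polynomial.monom 1 (k * p) * (\<Sum>j\<in>J. h j k * pow_prod X q j)) \<le> (K + n) * p"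
      using degree_mult_le[of "Polynomial.monom 1 (k * p)" "\<Sum>j\<in>J. h j k * pow_prod X q j"]
        degree_monom_le[of "1::int" "k * p"] by (simp add: algebra_simps)
  qed simp
  finally show ?thesis unfolding N_def by simp
qed

section \<open>Choice of the parameters and the uniform upper bound\<close>

lemma card_power_residues_le_of_large:
  fixes m n p q :: nat and \<zeta> :: "int \<Rightarrow> int"
  defines "B \<equiv> m ^ n"
  defines "c1 \<equiv> 4 * m * 2 ^ B"
  defines "c2 \<equiv> 4 * c1 * B * (1 + B * n)"
  assumes m: "m > 0" and p: "prime p" and qm: "q * m = p - 1" and X: "X \<subseteq> {0..<int p}" "0 \<notin> X"
    and n: "card X = n"
    and large: "2 * c1 + 4 * c2\<^sup>2 + 4 * (m * 2 ^ B * n + m + B) < p"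
    and \<zeta>: "\<And>c. c \<in> X \<Longrightarrow> \<not> int p dvd \<zeta> c"
  shows "real (card {x \<in> {0..<int p}. \<forall>c\<in>X. [(x - c) ^ q = \<zeta> c] (mod int p)})
    \<le> real p / real B + 4 * real c2 * (real B * real n + 1) * sqrt p"
proof -
  \<comment> \<open>With M = B K - 1 the solvability condition M (A + K + M n) < B K A becomes M (K
    + M n) < A. As A is proportional to p, this allows K of the order sqrt p. The constant
    \<open>c1\<close> keeps m 2^B A at most p / 4, as independence requires; \<open>c2\<close>
    secures B (1 + B n) K^2 < A.\<close>
  define A where "A = p div c1"
  define K where "K = nat \<lfloor>sqrt p / c2\<rfloor>"
  define M where "M = B * K - 1"
  define N where "N = card {x \<in> {0..<int p}. \<forall>c\<in>X. [(x - c) ^ q = \<zeta> c] (mod int p)}"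
  have B: "B > 0" using m by (simp add: B_def)
  have c1: "c1 > 0" using m by (simp add: c1_def)
  have c2: "c2 > 0" using c1 B by (simp add: c2_def)
  have "real (4 * c2\<^sup>2) \<le> real p" using large by (subst of_nat_le_iff) linarith
  then have "(2 * real c2)\<^sup>2 \<le> real p" by (simp add: power2_eq_square)
  then have "2 * real c2 \<le> sqrt p" by (rule real_le_rsqrt)
  then have K2: "2 \<le> sqrt p / c2" using c2 by (simp add: field_simps)
  have Kle: "real K \<le> sqrt p / c2" unfolding K_def using K2 by simp
  have Kge: "sqrt p / c2 - 1 < real K" unfolding K_def using K2 by linarith
  have "K \<ge> 2" unfolding K_def using K2 by (simp add: le_nat_iff le_floor_iff)
  have Khalf: "sqrt p / (2 * c2) \<le> real K" using Kge K2 by (simp add: field_simps)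
  have cA: "c1 * A \<le> p" unfolding A_def by simp
  have "p < c1 * A + c1" unfolding A_def using c1
    by (metis add.commute add_strict_left_mono div_mult_mod_eq mod_less_divisor mult.commute)
  then have Alow: "p < 2 * (c1 * A)" using large by linarith
  have "c2 * c2 * K\<^sup>2 \<le> p"
  proof -
    have "real c2 * real K \<le> sqrt p" using Kle c2 by (simp add: field_simps)
    then have "(real c2 * real K)\<^sup>2 \<le> (sqrt p)\<^sup>2" by (intro power_mono) auto
    then have "real (c2 * c2 * K\<^sup>2) \<le> real p" by (simp add: power2_eq_square mult_ac)
    then show ?thesis by (subst (asm) of_nat_le_iff)
  qed
  moreover have "c2 * K\<^sup>2 \<le> c2 * c2 * K\<^sup>2" using c2 by simp
  ultimately have "c2 * K\<^sup>2 \<le> p" by linarith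
  then have "4 * c1 * (B * (1 + B * n) * K\<^sup>2) \<le> p" by (simp only: c2_def mult_ac)
  then have "4 * c1 * (B * (1 + B * n) * K\<^sup>2) < 4 * c1 * A" using Alow by linarith
  then have KA: "B * (1 + B * n) * K\<^sup>2 < A" by simp
  have "B * K \<le> B * (1 + B * n) * K\<^sup>2"
  proof -
    have "1 * K \<le> (1 + B * n) * (K * K)" using \<open>K \<ge> 2\<close> by (intro mult_le_mono) auto
    then have "B * K \<le> B * ((1 + B * n) * (K * K))" by simp
    then show ?thesis unfolding power2_eq_square mult.assoc .
  qed
  then have "B * K < A" using KA by linarith
  have "A \<le> p" unfolding A_def by simp
  have BK: "B * K \<ge> 2" using mult_le_mono[OF Suc_leI[OF B] \<open>K \<ge> 2\<close>] by simp
  have "N * M \<le> (K + n) * p"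
    unfolding N_def
  proof (rule stepanov_bound[OF p qm X])
    show "A > 0" "A \<le> p" "K > 0" "M \<le> p" using \<open>B * K < A\<close> \<open>A \<le> p\<close> \<open>K \<ge> 2\<close> unfolding M_def by auto
    have "M * (K + M * n) \<le> (B * K) * (K + (B * K) * n)"
      unfolding M_def by (intro mult_le_mono add_mono) auto
    also have "\<dots> = B * (1 + B * n) * K\<^sup>2" by (simp add: power2_eq_square algebra_simps)
    also have "\<dots> < A" by (rule KA)
    finally have "M * (K + M * n) < A" .
    moreover have "B * K = Suc M" unfolding M_def using BK by simp
    ultimately show "M * (A + K + M * n) < B * K * A" by (simp add: algebra_simps)
    have "4 * (m * (2 ^ B * A)) \<le> p" using cA by (simp add: c1_def mult_ac)
    then show "m * (2 ^ B * (A + n) + 1) < p" using large by (simp add: algebra_simps)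
    have "2 ^ B * A \<le> m * (2 ^ B * A)" "2 ^ B * n \<le> m * (2 ^ B * n)" using m by simp_all
    then show "2 ^ B * (A + n) + B < p"
      using large \<open>4 * (m * (2 ^ B * A)) \<le> p\<close> unfolding distrib_left mult.assoc by linarith
  qed (use n B_def \<zeta> in auto)
  then have "real (N * M) \<le> real ((K + n) * p)" by (subst of_nat_le_iff)
  moreover have M: "real M = real B * real K - 1"
  proof -
    have "Suc M = B * K" unfolding M_def using BK by simp
    then have "real (Suc M) = real (B * K)" by (rule arg_cong)
    then show ?thesis by simp
  qed
  ultimately have NM: "real N * (real B * real K - 1) \<le> (real K + real n) * real p" by simp
  have "real 2 \<le> real (B * K)" using BK by (subst of_nat_le_iff)
  then have BK': "real B * real K - 1 > 0" by simp
  \<comment> \<open>Since B (K + n) = (B K - 1) + (B n + 1), dividing (K + n) p by B K - 1 gives p /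
    B plus a term of the order p / K, that is, sqrt p.\<close>
  have "real N - real p / real B \<le> real p * (real B * real n + 1) / (real B * (real B * real K - 1))"
  proof -
    have "real N \<le> (real K + real n) * real p / (real B * real K - 1)"
      using NM BK' by (simp add: pos_le_divide_eq)
    also have "\<dots> = real p / real B + real p * (real B * real n + 1) / (real B * (real B * real K - 1))"
      using BK' B by (simp add: field_simps)
    finally show ?thesis by simp
  qed
  also have "\<dots> \<le> real p * (real B * real n + 1) / (real K / 2)"
  proof (rule divide_left_mono)
    have "1 * (real K - 1) \<le> real B * (real B * real K - 1)"
      using B \<open>K \<ge> 2\<close> by (intro mult_mono diff_mono) (auto simp: Suc_le_eq)
    then show "real K / 2 \<le> real B * (real B * real K - 1)" using \<open>K \<ge> 2\<close> by simp
    show "0 < real B * (real B * real K - 1) * (real K / 2)" using BK' B \<open>K \<ge> 2\<close> by auto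
  qed simp
  also have "\<dots> \<le> real p * (real B * real n + 1) / (sqrt p / (2 * c2) / 2)"
  proof (rule divide_left_mono)
    show "sqrt p / (2 * c2) / 2 \<le> real K / 2" using Khalf by simp
    show "0 < real K / 2 * (sqrt p / (2 * c2) / 2)" using c2 \<open>K \<ge> 2\<close> prime_gt_0_nat[OF p] by simp
  qed simp
  also have "\<dots> = 4 * real c2 * (real B * real n + 1) * (real p / sqrt p)" by simp
  also have "real p / sqrt p = sqrt p" by (simp add: real_div_sqrt)
  finally show ?thesis unfolding N_def by simp
qed

text \<open>Primes up to \<open>p0\<close> are covered by the trivial bound p <= sqrt p0 sqrt p,
  which is the last summand of \<open>C\<close>. For larger p one has n < p, so some residue
  \<open>b\<close> lies outside \<open>X\<close>, and translating by \<open>b\<close> achieves that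
  0 is not in the set.\<close>

lemma card_power_residues_le:
  fixes m n :: nat
  assumes m: "m > 0"
  shows "\<exists>C\<ge>0. \<forall>p q X \<zeta>. prime p \<longrightarrow> q * m = p - 1 \<longrightarrow> X \<subseteq> {0..<int p} \<longrightarrow> card X = n \<longrightarrow>
    (\<forall>c\<in>X. \<not> int p dvd \<zeta> c) \<longrightarrow>
    real (card {x \<in> {0..<int p}. \<forall>c\<in>X. [(x - c) ^ q = \<zeta> c] (mod int p)})
      \<le> real p / real (m ^ n) + C * sqrt p"
proof -
  define B where "B = m ^ n"
  define c1 where "c1 = 4 * m * 2 ^ B"
  define c2 where "c2 = 4 * c1 * B * (1 + B * n)"
  define p0 where "p0 = 2 * c1 + 4 * c2\<^sup>2 + 4 * (m * 2 ^ B * n + m + B) + n"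
  define C where "C = 4 * real c2 * (real B * real n + 1) + sqrt p0"
  have bound: "real (card {x \<in> {0..<int p}. \<forall>c\<in>X. [(x - c) ^ q = \<zeta> c] (mod int p)})
      \<le> real p / real (m ^ n) + C * sqrt p"
    if p: "prime p" and qm: "q * m = p - 1" and X: "X \<subseteq> {0..<int p}" and n: "card X = n"
      and \<zeta>: "\<forall>c\<in>X. \<not> int p dvd \<zeta> c" for p q X \<zeta>
  proof (cases "p0 < p")
    case False
    have "real (card {x \<in> {0..<int p}. \<forall>c\<in>X. [(x - c) ^ q = \<zeta> c] (mod int p)}) \<le> real (card {0..<int p})"
      by (intro of_nat_mono card_mono) auto
    also have "\<dots> = sqrt p * sqrt p" by simp
    also have "\<dots> \<le> C * sqrt p"
      unfolding C_def using False by (intro mult_right_mono add_increasing) auto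
    finally show ?thesis by (simp add: add_increasing)
  next
    case True
    have fin: "finite X" using X finite_subset by blast
    have "card X < card {0..<int p}" using n True by (simp add: p0_def)
    then have "\<exists>b. b \<in> {0..<int p} \<and> b \<notin> X" using X card_mono fin by (metis not_le subsetI)
    then obtain b where b: "b \<in> {0..<int p}" "b \<notin> X" by blast
    define sh where "sh x = (x - b) mod int p" for x
    define ush where "ush x = (x + b) mod int p" for x
    have pp: "int p > 0" using prime_gt_0_nat[OF p] by simp
    have us: "ush (sh x) = x" if "x \<in> {0..<int p}" for x
      using that by (simp add: sh_def ush_def mod_simps)
    have su: "sh (ush x) = x" if "x \<in> {0..<int p}" for x
      using that by (simp add: sh_def ush_def mod_simps)
    have inj: "inj_on sh {0..<int p}" by (metis inj_onI us)
    define X' where "X' = sh ` X"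
    have X': "X' \<subseteq> {0..<int p}" using pp by (auto simp: X'_def sh_def)
    have "0 \<notin> X'"
    proof
      assume "0 \<in> X'"
      then obtain c where c: "c \<in> X" "sh c = 0" by (auto simp: X'_def)
      then have "c = ush 0" using us X by (metis subsetD)
      then show False using b c by (simp add: ush_def)
    qed
    have cX': "card X' = n" unfolding X'_def using n inj X by (metis card_image inj_on_subset)
    let ?N = "{x \<in> {0..<int p}. \<forall>c\<in>X. [(x - c) ^ q = \<zeta> c] (mod int p)}"
    let ?N' = "{x \<in> {0..<int p}. \<forall>c\<in>X'. [(x - c) ^ q = \<zeta> (ush c)] (mod int p)}"
    have "sh ` ?N \<subseteq> ?N'"
    proof
      fix y assume "y \<in> sh ` ?N"
      then obtain x where x: "x \<in> ?N" "y = sh x" by blast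
      have "[(y - c) ^ q = \<zeta> (ush c)] (mod int p)" if "c \<in> X'" for c
      proof -
        obtain d where d: "d \<in> X" "c = sh d" using \<open>c \<in> X'\<close> by (auto simp: X'_def)
        have "[y - c = x - d] (mod int p)" unfolding x d sh_def by (simp add: cong_def mod_simps)
        then have "[(y - c) ^ q = (x - d) ^ q] (mod int p)" by (rule cong_pow)
        moreover have "ush c = d" using d us X by auto
        ultimately show ?thesis using x(1) d(1) cong_trans by blast
      qed
      then show "y \<in> ?N'" using x pp by (auto simp: sh_def)
    qed
    moreover have "card (sh ` ?N) = card ?N"
      by (rule card_image) (rule inj_on_subset[OF inj], blast)
    moreover have "finite ?N'" by (rule finite_subset[of _ "{0..<int p}"]) auto
    ultimately have "card ?N \<le> card ?N'" by (metis (no_types, lifting) card_mono)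
    also have "real (card ?N') \<le> real p / real (m ^ n) + 4 * real c2 * (real (m ^ n) * real n + 1) * sqrt p"
      unfolding c2_def c1_def B_def
    proof (rule card_power_residues_le_of_large[OF m p qm X' \<open>0 \<notin> X'\<close> cX'])
      show "2 * (4 * m * 2 ^ m ^ n) + 4 * (4 * (4 * m * 2 ^ m ^ n) * m ^ n * (1 + m ^ n * n))\<^sup>2 +
        4 * (m * 2 ^ m ^ n * n + m + m ^ n) < p"
        using True unfolding p0_def c2_def c1_def B_def by linarith
      show "\<not> int p dvd \<zeta> (ush c)" if "c \<in> X'" for c
        using that \<zeta> us X unfolding X'_def by (metis imageE subsetD)
    qed
    also have "\<dots> \<le> real p / real (m ^ n) + C * sqrt p"
      unfolding C_def B_def by (intro add_left_mono mult_right_mono) auto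
    finally show ?thesis by simp
  qed
  have "C \<ge> 0" unfolding C_def by simp
  with bound show ?thesis by blast
qed

section \<open>Equidistribution of cyclotomic classes\<close>

text \<open>For q = (p - 1) / m, two units have the same q-th power exactly if they lie in the same
  cyclotomic class. The value at 0 stays free.\<close>

definition class_function :: "nat \<Rightarrow> nat \<Rightarrow> (int \<Rightarrow> 'a) \<Rightarrow> bool" where
  "class_function p q f \<longleftrightarrow> (\<forall>x. f (x mod int p) = f x) \<and>
     (\<forall>x y. \<not> int p dvd x \<longrightarrow> \<not> int p dvd y \<longrightarrow> [x ^ q = y ^ q] (mod int p) \<longrightarrow> f x = f y)"

text \<open>For a primitive root g the powers g^s with s < m represent the m classes.\<close>

definition class_mean :: "nat \<Rightarrow> nat \<Rightarrow> (int \<Rightarrow> complex) \<Rightarrow> complex" where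
  "class_mean m g f = (\<Sum>s<m. f (int g ^ s)) / of_nat m"

lemma bij_betw_primroot_powers:
  assumes p: "prime p" and g: "residue_primroot p g"
  shows "bij_betw (\<lambda>e. int (g ^ e mod p)) {..<p - 1} {1..<int p}"
proof -
  have "bij_betw (\<lambda>e. g ^ e mod p) {..<p - 1} {0<..<p}"
    using residue_primroot_is_generator[OF prime_gt_1_nat[OF p] g] p
    by (simp add: totient_prime totatives_prime)
  moreover have "bij_betw int {0<..<p} {1..<int p}"
    by (rule bij_betwI[of _ _ _ nat]) auto
  ultimately show ?thesis using bij_betw_trans[of "\<lambda>e. g ^ e mod p" "{..<p - 1}" "{0<..<p}" int "{1..<int p}"]
    by (simp add: o_def)
qed

lemma primroot_power_exists:
  assumes p: "prime p" and g: "residue_primroot p g" and x: "\<not> int p dvd x"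
  shows "\<exists>e<p - 1. [x = int g ^ e] (mod int p)"
proof -
  have "0 < x mod int p" using x prime_gt_0_nat[OF p]
    by (metis dvd_eq_mod_eq_0 le_less of_nat_0_less_iff pos_mod_sign)
  then have "x mod int p \<in> {1..<int p}" using prime_gt_0_nat[OF p] by simp
  then obtain e where "e < p - 1" "x mod int p = int (g ^ e mod p)"
    using bij_betw_primroot_powers[OF p g] unfolding bij_betw_def by (metis (no_types, lifting) imageE lessThan_iff)
  then show ?thesis by (intro exI[of _ e]) (simp add: cong_def zmod_int)
qed

lemma primroot_power_not_dvd:
  assumes p: "prime p" and g: "residue_primroot p g"
  shows "\<not> int p dvd int g ^ e"
proof -
  have "coprime p g" using g by (simp add: residue_primroot_def)
  then have "\<not> p dvd g ^ e" using p
    by (metis coprime_absorb_left not_prime_unit prime_dvd_power)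
  then show ?thesis by (metis int_dvd_int_iff of_nat_power)
qed

lemma primroot_power_order:
  assumes p: "prime p" and g: "residue_primroot p g"
  shows "[int g ^ (p - 1) = 1] (mod int p)"
proof -
  have "\<not> p dvd g" using primroot_power_not_dvd[OF p g, of 1] by simp
  then have "[g ^ (p - 1) = 1] (mod p)" by (rule fermat_theorem[OF p])
  then show ?thesis by (metis cong_int_iff of_nat_1 of_nat_power)
qed

text \<open>The residues outside \<open>X\<close> split into B = m^n patterns, one for each choice
  of the classes of the x - c, and the product is constant on each. The n points of \<open>X\<close>
  add a bounded number of terms.\<close>

lemma class_function_equidistribution:
  fixes m n :: nat
  assumes m: "m > 0"
  shows "\<exists>C\<ge>0. \<forall>p q g X f W. prime p \<longrightarrow> q * m = p - 1 \<longrightarrow> residue_primroot p g \<longrightarrow>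
    X \<subseteq> {0..<int p} \<longrightarrow> card X = n \<longrightarrow>
    (\<forall>c\<in>X. class_function p q (f c) \<and> (\<forall>x. cmod (f c x) \<le> W c)) \<longrightarrow>
    cmod ((\<Sum>x\<in>{0..<int p}. \<Prod>c\<in>X. f c (x - c)) - of_nat p * (\<Prod>c\<in>X. class_mean m g (f c)))
      \<le> C * sqrt p * (\<Prod>c\<in>X. W c)"
proof -
  define B where "B = m ^ n"
  obtain C where C: "C \<ge> 0" and count: "\<And>p q X \<zeta>. prime p \<Longrightarrow> q * m = p - 1 \<Longrightarrow> X \<subseteq> {0..<int p} \<Longrightarrow>
    card X = n \<Longrightarrow> (\<forall>c\<in>X. \<not> int p dvd \<zeta> c) \<Longrightarrow>
    real (card {x \<in> {0..<int p}. \<forall>c\<in>X. [(x - c) ^ q = \<zeta> c] (mod int p)}) \<le> real p / real B + C * sqrt p"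
    using card_power_residues_le[OF m, of n] unfolding B_def by blast
  define C' where "C' = real B * (real B * C + real n) + real n"
  have "cmod ((\<Sum>x\<in>{0..<int p}. \<Prod>c\<in>X. f c (x - c)) - of_nat p * (\<Prod>c\<in>X. class_mean m g (f c)))
      \<le> C' * sqrt p * (\<Prod>c\<in>X. W c)"
    if p: "prime p" and qm: "q * m = p - 1" and g: "residue_primroot p g"
      and X: "X \<subseteq> {0..<int p}" and n: "card X = n"
      and f: "\<forall>c\<in>X. class_function p q (f c) \<and> (\<forall>x. cmod (f c x) \<le> W c)"
    for p q g X and f :: "int \<Rightarrow> int \<Rightarrow> complex" and W
  proof -
    have fin: "finite X" using X finite_subset by blast
    have p1: "p > 1" using prime_gt_1_nat[OF p] .
    have pp: "prime (int p)" using p by simp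
    have q0: "q > 0" using qm p1 by (cases "q = 0") auto
    have mp: "m \<le> p - 1" using qm q0 by (metis le_add1 mult.commute mult_eq_if not_gr_zero)
    have sq1: "1 \<le> sqrt p" using p1 by simp
    define S where "S = PiE X (\<lambda>_. {..<m})"
    have S: "finite S" "card S = B"
      using fin n by (auto simp: S_def card_PiE B_def intro: finite_PiE)
    have B1: "B \<ge> 1" using m by (simp add: B_def Suc_le_eq)
    define N where "N \<sigma> = {x \<in> {0..<int p}. \<forall>c\<in>X. [(x - c) ^ q = (int g ^ \<sigma> c) ^ q] (mod int p)}" for \<sigma>
    have finN: "finite (N \<sigma>)" for \<sigma>
      unfolding N_def by (rule finite_subset[of _ "{0..<int p}"]) auto
    have gnd: "\<not> int p dvd int g ^ s" if "s < m" for s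
      by (rule primroot_power_not_dvd[OF p g])
    have up: "real (card (N \<sigma>)) \<le> real p / real B + C * sqrt p" if "\<sigma> \<in> S" for \<sigma>
      unfolding N_def
    proof (rule count[OF p qm X n], intro ballI notI)
      fix c assume c: "c \<in> X" "int p dvd (int g ^ \<sigma> c) ^ q"
      then have "int p dvd int g ^ \<sigma> c" using pp by (metis prime_dvd_power)
      moreover have "\<sigma> c < m" using that c(1) by (auto simp: S_def)
      ultimately show False using gnd by blast
    qed
    have order: "[int g ^ (m * q) = 1] (mod int p)"
      using primroot_power_order[OF p g] qm by (simp add: mult.commute)
    \<comment> \<open>The exponents s q and s' q are below p - 1, where the powers of a primitive
      root are distinct.\<close>
    have pw_inj: "s = s'" if "[(int g ^ s) ^ q = (int g ^ s') ^ q] (mod int p)" "s < m" "s' < m" for s s'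
    proof -
      have "[int (g ^ (s * q)) = int (g ^ (s' * q))] (mod int p)" using that(1) by (simp add: power_mult)
      then have "int (g ^ (s * q) mod p) = int (g ^ (s' * q) mod p)" by (simp add: cong_def zmod_int)
      moreover have "s * q < p - 1" "s' * q < p - 1" using that q0 unfolding qm[symmetric]
        by (simp_all add: mult.commute)
      ultimately have "s * q = s' * q"
        using bij_betw_primroot_powers[OF p g] unfolding bij_betw_def inj_on_def by blast
      then show ?thesis using q0 by simp
    qed
    have disj: "N \<sigma> \<inter> N \<tau> = {}" if \<sigma>: "\<sigma> \<in> S" "\<tau> \<in> S" "\<sigma> \<noteq> \<tau>" for \<sigma> \<tau>
    proof (rule ccontr)
      assume "N \<sigma> \<inter> N \<tau> \<noteq> {}"
      then obtain x where x: "x \<in> N \<sigma>" "x \<in> N \<tau>" by blast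
      have "\<sigma> c = \<tau> c" if c: "c \<in> X" for c
      proof (rule pw_inj)
        show "[(int g ^ \<sigma> c) ^ q = (int g ^ \<tau> c) ^ q] (mod int p)"
        proof (rule cong_trans[OF cong_sym])
          show "[(x - c) ^ q = (int g ^ \<sigma> c) ^ q] (mod int p)" using x(1) c by (simp add: N_def)
          show "[(x - c) ^ q = (int g ^ \<tau> c) ^ q] (mod int p)" using x(2) c by (simp add: N_def)
        qed
      qed (use \<sigma> c in \<open>auto simp: S_def\<close>)
      then show False using \<sigma> unfolding S_def by (metis PiE_ext)
    qed
    have union: "(\<Union>\<sigma>\<in>S. N \<sigma>) = {0..<int p} - X"
    proof (intro equalityI subsetI)
      fix x assume "x \<in> (\<Union>\<sigma>\<in>S. N \<sigma>)"
      then obtain \<sigma> where \<sigma>: "\<sigma> \<in> S" "x \<in> N \<sigma>" by blast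
      have "x \<notin> X"
      proof
        assume x: "x \<in> X"
        then have "[(x - x) ^ q = (int g ^ \<sigma> x) ^ q] (mod int p)" using \<sigma> unfolding N_def by blast
        then have "[0 = (int g ^ \<sigma> x) ^ q] (mod int p)" using q0 by (simp add: zero_power)
        then have "int p dvd (int g ^ \<sigma> x) ^ q" using cong_0_iff cong_sym by blast
        then have "int p dvd int g ^ \<sigma> x" using pp by (metis prime_dvd_power)
        moreover have "\<sigma> x < m" using \<sigma> x by (auto simp: S_def)
        ultimately show False using gnd by blast
      qed
      then show "x \<in> {0..<int p} - X" using \<sigma> by (auto simp: N_def)
    next
      fix x assume x: "x \<in> {0..<int p} - X"
      have "\<exists>s<m. [(x - c) ^ q = (int g ^ s) ^ q] (mod int p)" if c: "c \<in> X" for c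
      proof -
        have "\<not> int p dvd x - c"
        proof
          assume "int p dvd x - c"
          then have "x mod int p = c mod int p" by (simp add: mod_eq_dvd_iff)
          then have "x = c" using x c X
            by (metis DiffD1 atLeastLessThan_iff mod_pos_pos_trivial subsetD)
          then show False using x c by blast
        qed
        from primroot_power_exists[OF p g this] obtain e where e: "[x - c = int g ^ e] (mod int p)" by blast
        have "[(x - c) ^ q = (int g ^ e) ^ q] (mod int p)" using e by (rule cong_pow)
        also have "(int g ^ e) ^ q = (int g ^ (m * q)) ^ (e div m) * (int g ^ (e mod m)) ^ q"
        proof -
          have "e * q = (m * q) * (e div m) + (e mod m) * q"
            by (metis distrib_right mult.assoc mult.commute mult_div_mod_eq)
          then show ?thesis by (metis power_add power_mult)
        qed
        also have "[(int g ^ (m * q)) ^ (e div m) * (int g ^ (e mod m)) ^ q = 1 ^ (e div m) * (int g ^ (e mod m)) ^ q] (mod int p)"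
          by (intro cong_mult cong_pow order cong_refl)
        finally have "[(x - c) ^ q = (int g ^ (e mod m)) ^ q] (mod int p)" by simp
        then show ?thesis using m by (intro exI[of _ "e mod m"]) simp
      qed
      then obtain s where s: "\<And>c. c \<in> X \<Longrightarrow> s c < m \<and> [(x - c) ^ q = (int g ^ s c) ^ q] (mod int p)"
        by metis
      then have "restrict s X \<in> S" "x \<in> N (restrict s X)" using x by (auto simp: S_def N_def)
      then show "x \<in> (\<Union>\<sigma>\<in>S. N \<sigma>)" by blast
    qed
    have total: "(\<Sum>\<sigma>\<in>S. real (card (N \<sigma>))) = real p - real n"
    proof -
      have "card (\<Union>\<sigma>\<in>S. N \<sigma>) = (\<Sum>\<sigma>\<in>S. card (N \<sigma>))"
        using S finN disj by (intro card_UN_disjoint) auto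
      moreover have "card ({0..<int p} - X) = p - n" using fin X n by (simp add: card_Diff_subset)
      moreover have "n \<le> p" using n card_mono[OF _ X] by simp
      ultimately show ?thesis unfolding union by (simp flip: of_nat_sum add: of_nat_diff)
    qed
    \<comment> \<open>The lower bound comes from subtraction: all counts add up to p - n, and each
      of the other B - 1 exceeds p / B by at most C sqrt p.\<close>
    have dev: "\<bar>real (card (N \<sigma>)) - real p / real B\<bar> \<le> (real B * C + real n) * sqrt p" if \<sigma>: "\<sigma> \<in> S" for \<sigma>
    proof (rule abs_leI)
      have "C * sqrt p \<le> (real B * C + real n) * sqrt p"
        using B1 C by (intro mult_right_mono add_increasing2) (auto simp: mult_le_cancel_right1)
      then show "real (card (N \<sigma>)) - real p / real B \<le> (real B * C + real n) * sqrt p" using up[OF \<sigma>] by linarith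
      have "(\<Sum>\<tau>\<in>S - {\<sigma>}. real (card (N \<tau>))) \<le> (\<Sum>\<tau>\<in>S - {\<sigma>}. real p / real B + C * sqrt p)"
        by (intro sum_mono up) auto
      also have "\<dots> = (real B - 1) * (real p / real B + C * sqrt p)"
        using S \<sigma> B1 by (simp add: card_Diff_singleton of_nat_diff)
      finally have "real p - real n \<le> real (card (N \<sigma>)) + (real B - 1) * (real p / real B + C * sqrt p)"
        using total S \<sigma> by (simp add: sum.remove[of S \<sigma>])
      moreover have "(real B - 1) * (real p / real B + C * sqrt p) = real p - real p / real B + (real B - 1) * C * sqrt p"
        using B1 by (simp add: field_simps)
      moreover have "(real B - 1) * C * sqrt p + real n \<le> (real B * C + real n) * sqrt p"
      proof -
        have "real n * 1 \<le> real n * sqrt p" using sq1 by (intro mult_left_mono) auto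
        moreover have "0 \<le> C * sqrt p" using C by simp
        ultimately show ?thesis by (simp add: algebra_simps)
      qed
      ultimately show "- (real (card (N \<sigma>)) - real p / real B) \<le> (real B * C + real n) * sqrt p" by linarith
    qed
    define V where "V = (\<Prod>c\<in>X. W c)"
    have W0: "0 \<le> W c" if "c \<in> X" for c using f that by (meson norm_ge_zero order_trans)
    have V: "0 \<le> V" unfolding V_def using W0 by (intro prod_nonneg) auto
    have fV: "cmod (\<Prod>c\<in>X. f c (h c)) \<le> V" for h
      unfolding V_def prod_norm[symmetric] using f by (intro prod_mono) auto
    define v where "v \<sigma> = (\<Prod>c\<in>X. f c (int g ^ \<sigma> c))" for \<sigma>
    have val: "(\<Prod>c\<in>X. f c (x - c)) = v \<sigma>" if \<sigma>: "\<sigma> \<in> S" "x \<in> N \<sigma>" for x \<sigma>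
      unfolding v_def
    proof (rule prod.cong[OF refl])
      fix c assume c: "c \<in> X"
      have 1: "\<not> int p dvd int g ^ \<sigma> c" using gnd \<sigma> c by (auto simp: S_def)
      have 2: "[(x - c) ^ q = (int g ^ \<sigma> c) ^ q] (mod int p)" using \<sigma> c by (simp add: N_def)
      have 3: "\<not> int p dvd x - c"
      proof
        assume "int p dvd x - c"
        then have "int p dvd (x - c) ^ q" using q0 by (metis dvd_power dvd_trans)
        then have "int p dvd (int g ^ \<sigma> c) ^ q" using 2 cong_dvd_iff by blast
        then show False using 1 pp by (metis prime_dvd_power)
      qed
      from f c have "class_function p q (f c)" by blast
      with 1 2 3 show "f c (x - c) = f c (int g ^ \<sigma> c)" unfolding class_function_def by blast
    qed
    have "(\<Sum>x\<in>{0..<int p}. \<Prod>c\<in>X. f c (x - c)) =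
      (\<Sum>x\<in>{0..<int p} - X. \<Prod>c\<in>X. f c (x - c)) + (\<Sum>x\<in>X. \<Prod>c\<in>X. f c (x - c))"
      by (rule sum.subset_diff[OF X]) simp
    also have "(\<Sum>x\<in>{0..<int p} - X. \<Prod>c\<in>X. f c (x - c)) = (\<Sum>\<sigma>\<in>S. of_nat (card (N \<sigma>)) * v \<sigma>)"
    proof -
      have "(\<Sum>x\<in>{0..<int p} - X. \<Prod>c\<in>X. f c (x - c)) = (\<Sum>\<sigma>\<in>S. \<Sum>x\<in>N \<sigma>. \<Prod>c\<in>X. f c (x - c))"
        unfolding union[symmetric] using S finN disj by (intro sum.UNION_disjoint) auto
      also have "\<dots> = (\<Sum>\<sigma>\<in>S. of_nat (card (N \<sigma>)) * v \<sigma>)"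
        by (intro sum.cong refl) (simp add: val)
      finally show ?thesis .
    qed
    finally have eq1: "(\<Sum>x\<in>{0..<int p}. \<Prod>c\<in>X. f c (x - c)) =
      (\<Sum>\<sigma>\<in>S. of_nat (card (N \<sigma>)) * v \<sigma>) + (\<Sum>x\<in>X. \<Prod>c\<in>X. f c (x - c))" .
    have eq2: "of_nat p * (\<Prod>c\<in>X. class_mean m g (f c)) = (\<Sum>\<sigma>\<in>S. of_real (real p / real B) * v \<sigma>)"
    proof -
      have "(\<Prod>c\<in>X. class_mean m g (f c)) = (\<Prod>c\<in>X. \<Sum>s<m. f c (int g ^ s)) / of_nat B"
        unfolding class_mean_def prod_dividef using n by (simp add: B_def)
      also have "(\<Prod>c\<in>X. \<Sum>s<m. f c (int g ^ s)) = (\<Sum>\<sigma>\<in>S. v \<sigma>)"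
        unfolding S_def v_def by (rule prod_sum_PiE) (use fin in auto)
      finally show ?thesis by (simp add: sum_distrib_left sum_divide_distrib)
    qed
    have eq: "(\<Sum>x\<in>{0..<int p}. \<Prod>c\<in>X. f c (x - c)) - of_nat p * (\<Prod>c\<in>X. class_mean m g (f c)) =
      (\<Sum>\<sigma>\<in>S. of_real (real (card (N \<sigma>)) - real p / real B) * v \<sigma>) + (\<Sum>x\<in>X. \<Prod>c\<in>X. f c (x - c))"
      unfolding eq1 eq2 by (simp add: algebra_simps sum_subtractf)
    let ?A = "\<Sum>\<sigma>\<in>S. of_real (real (card (N \<sigma>)) - real p / real B) * v \<sigma>"
    let ?E = "\<Sum>x\<in>X. \<Prod>c\<in>X. f c (x - c)"
    have 1: "cmod ?A \<le> (\<Sum>\<sigma>\<in>S. (real B * C + real n) * sqrt p * V)"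
    proof (rule sum_norm_le)
      fix \<sigma> assume "\<sigma> \<in> S"
      then show "cmod (of_real (real (card (N \<sigma>)) - real p / real B) * v \<sigma>) \<le> (real B * C + real n) * sqrt p * V"
        unfolding norm_mult norm_of_real using dev fV[of "\<lambda>c. int g ^ \<sigma> c"] C
        by (intro mult_mono) (auto simp: v_def)
    qed
    have 2: "cmod ?E \<le> (\<Sum>x\<in>X. V)"
      by (intro sum_norm_le fV)
    have "real n * V \<le> real n * V * sqrt p"
      using mult_left_mono[OF sq1, of "real n * V"] V by simp
    with 1 2 norm_triangle_ineq[of ?A ?E]
    have "cmod (?A + ?E) \<le> real B * ((real B * C + real n) * sqrt p * V) + real n * V * sqrt p"
      using S n by simp
    then show ?thesis
      unfolding eq V_def[symmetric] C'_def by (simp add: algebra_simps)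
  qed
  moreover have "C' \<ge> 0" unfolding C'_def using C by simp
  ultimately show ?thesis by blast
qed

section \<open>Fourier transform modulo a prime\<close>

lemma bij_betw_mod_add:
  fixes p :: nat assumes "p > 0"
  shows "bij_betw (\<lambda>x. (x + c) mod int p) {0..<int p} {0..<int p}"
  using assms by (intro bij_betwI[of _ _ _ "\<lambda>x. (x - c) mod int p"]) (auto simp: mod_simps)

lemma bij_betw_mod_mult:
  fixes p :: nat assumes "prime p" "\<not> int p dvd w"
  shows "bij_betw (\<lambda>x. (w * x) mod int p) {0..<int p} {0..<int p}"
proof -
  have p: "p > 0" using assms prime_gt_0_nat by blast
  have "coprime w (int p)"
    using assms by (metis coprime_commute prime_imp_coprime prime_nat_int_transfer)
  then obtain v where v: "[w * v = 1] (mod int p)" using cong_solve_coprime_int by blast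
  have inv: "[v * (w * x) = x] (mod int p)" "[w * (v * x) = x] (mod int p)" for x
    using cong_mult[OF v cong_refl[of x]] by (simp_all add: mult_ac)
  show ?thesis
    using p by (intro bij_betwI[of _ _ _ "\<lambda>x. (v * x) mod int p"])
      (use inv in \<open>auto simp: mod_simps cong_def\<close>)
qed

lemma sum_residues_add:
  fixes p :: nat assumes "p > 0" "\<And>x. f (x mod int p) = f x"
  shows "(\<Sum>x\<in>{0..<int p}. f (x + c)) = (\<Sum>x\<in>{0..<int p}. f x)"
  using sum.reindex_bij_betw[OF bij_betw_mod_add[OF assms(1)], of f c] assms(2) by simp

lemma sum_residues_mult:
  fixes p :: nat assumes "prime p" "\<not> int p dvd w" "\<And>x. f (x mod int p) = f x"
  shows "(\<Sum>x\<in>{0..<int p}. f (w * x)) = (\<Sum>x\<in>{0..<int p}. f x)"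
  using sum.reindex_bij_betw[OF bij_betw_mod_mult[OF assms(1,2)], of f] assms(3) by simp

lemma sum_residues_minus:
  fixes p :: nat assumes "p > 0" "\<And>x. f (x mod int p) = f x"
  shows "(\<Sum>x\<in>{0..<int p}. f (c - x)) = (\<Sum>x\<in>{0..<int p}. f x)"
proof -
  have "bij_betw (\<lambda>x. (c - x) mod int p) {0..<int p} {0..<int p}"
    using assms(1) by (intro bij_betwI[of _ _ _ "\<lambda>x. (c - x) mod int p"]) (auto simp: mod_simps)
  from sum.reindex_bij_betw[OF this, of f] show ?thesis using assms(2) by simp
qed

definition unity :: "nat \<Rightarrow> int \<Rightarrow> complex" where
  "unity p y = cis (2 * pi * of_int y / of_nat p)"

lemma unity_0 [simp]: "unity p 0 = 1"
  by (simp add: unity_def)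

lemma unity_add: "unity p (x + y) = unity p x * unity p y"
  by (simp add: unity_def cis_mult ring_distribs add_divide_distrib)

lemma cnj_unity: "cnj (unity p x) = unity p (- x)"
  by (simp add: unity_def cis_cnj)

lemma norm_unity [simp]: "cmod (unity p x) = 1"
  by (simp add: unity_def)

lemma unity_eq_1_iff:
  assumes "p > 0" shows "unity p y = 1 \<longleftrightarrow> int p dvd y"
proof
  assume "unity p y = 1"
  then have "cos (2 * pi * of_int y / of_nat p) = 1"
    unfolding unity_def by (metis cis.sel(1) one_complex.sel(1))
  then obtain n :: int where "2 * pi * of_int y / of_nat p = of_int n * 2 * pi"
    unfolding cos_one_2pi_int by blast
  then have "real_of_int y = of_int n * of_nat p" using assms by (simp add: field_simps)
  then have "y = n * int p" by (metis of_int_eq_iff of_int_mult of_int_of_nat_eq)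
  then show "int p dvd y" by simp
next
  assume "int p dvd y"
  then obtain n where "y = int p * n" by (elim dvdE)
  then have "2 * pi * of_int y / of_nat p = 2 * pi * of_int n" using assms by simp
  then show "unity p y = 1" unfolding unity_def by (metis Ints_of_int cis_multiple_2pi)
qed

lemma unity_mod [simp]: assumes "p > 0" shows "unity p (y mod int p) = unity p y"
proof -
  have "unity p y = unity p (y mod int p) * unity p (int p * (y div int p))"
    by (simp flip: unity_add)
  then show ?thesis using unity_eq_1_iff[OF assms, of "int p * (y div int p)"] by simp
qed

lemma unity_mult_mod [simp]:
  assumes "p > 0"
  shows "unity p (x mod int p * y) = unity p (x * y)" "unity p (y * (x mod int p)) = unity p (y * x)"
  using unity_mod[OF assms, of "x mod int p * y"] unity_mod[OF assms, of "x * y"]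
  by (simp_all add: mod_simps mult.commute)

lemma sum_unity:
  assumes "p > 0"
  shows "(\<Sum>k\<in>{0..<int p}. unity p (k * y)) = (if int p dvd y then of_nat p else 0)"
proof (cases "int p dvd y")
  case True
  then have "unity p (k * y) = 1" for k using unity_eq_1_iff[OF assms] by simp
  then show ?thesis using True by simp
next
  case False
  have "(\<Sum>k\<in>{0..<int p}. unity p (k * y)) = (\<Sum>k\<in>{0..<int p}. unity p ((k + 1) * y))"
    by (rule sum_residues_add[symmetric]) (use assms in simp_all)
  also have "\<dots> = (\<Sum>k\<in>{0..<int p}. unity p (k * y)) * unity p y"
    by (simp add: ring_distribs unity_add sum_distrib_right)
  finally have "(\<Sum>k\<in>{0..<int p}. unity p (k * y)) * (unity p y - 1) = 0" by (simp add: algebra_simps)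
  then show ?thesis using False unity_eq_1_iff[OF assms] by simp
qed

definition dft :: "nat \<Rightarrow> (int \<Rightarrow> real) \<Rightarrow> int \<Rightarrow> complex" where
  "dft p a k = (\<Sum>x\<in>{0..<int p}. of_real (a x) * unity p (k * x))"

lemma dft_mod [simp]: "p > 0 \<Longrightarrow> dft p a (k mod int p) = dft p a k"
  by (simp add: dft_def)

lemma sum_dft_unity:
  assumes "p > 0" "\<And>x. a (x mod int p) = a x"
  shows "(\<Sum>k\<in>{0..<int p}. dft p a k * unity p (k * y)) = of_nat p * of_real (a (- y))"
proof -
  have "(\<Sum>k\<in>{0..<int p}. dft p a k * unity p (k * y)) =
      (\<Sum>k\<in>{0..<int p}. \<Sum>x\<in>{0..<int p}. of_real (a x) * unity p (k * (x + y)))"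
    by (simp add: dft_def sum_distrib_right distrib_left unity_add mult.assoc)
  also have "\<dots> = (\<Sum>x\<in>{0..<int p}. of_real (a x) * (\<Sum>k\<in>{0..<int p}. unity p (k * (x + y))))"
    by (subst sum.swap) (simp add: sum_distrib_left)
  also have "\<dots> = (\<Sum>x\<in>{0..<int p}. if x = (- y) mod int p then of_nat p * of_real (a x) else 0)"
  proof (rule sum.cong[OF refl])
    fix x assume "x \<in> {0..<int p}"
    then have "int p dvd x + y \<longleftrightarrow> x = (- y) mod int p"
      using mod_eq_dvd_iff[of x "int p" "- y"] by simp
    then show "of_real (a x) * (\<Sum>k\<in>{0..<int p}. unity p (k * (x + y))) =
      (if x = (- y) mod int p then of_nat p * of_real (a x) else 0)"
      by (simp add: sum_unity assms)
  qed
  also have "\<dots> = of_nat p * of_real (a (- y))" using assms by (simp add: sum.delta)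
  finally show ?thesis .
qed

text \<open>\<open>dft\<close> carries the positive sign in the exponent. Taking the coefficient at
  - k lets the inversion carry it too, which is the sign convention of the kernel used
  later.\<close>

lemma dft_inversion:
  assumes "p > 0" "\<And>x. a (x mod int p) = a x"
  shows "of_real (a y) = (\<Sum>k\<in>{0..<int p}. dft p a (- k) * unity p (k * y)) / of_nat p"
proof -
  have "(\<Sum>k\<in>{0..<int p}. dft p a (0 - k) * unity p (- (0 - k) * y)) =
    (\<Sum>k\<in>{0..<int p}. dft p a k * unity p (- k * y))"
  proof (rule sum_residues_minus)
    fix k
    show "dft p a (k mod int p) * unity p (- (k mod int p) * y) = dft p a k * unity p (- k * y)"
      using assms(1) unity_mult_mod(1)[of p k "- y"] by simp
  qed (rule assms(1))
  then show ?thesis using sum_dft_unity[of p a "- y"] assms(2) assms(1) by simp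
qed

text \<open>Parseval without conjugation correlates \<open>a\<close> with its reflection; this is
  the source of \<nu>.\<close>

lemma sum_dft_mult_dft:
  assumes "p > 0" "\<And>x. a (x mod int p) = a x"
  shows "(\<Sum>k\<in>{0..<int p}. dft p a k * dft p a k) = of_nat p * of_real (\<Sum>x\<in>{0..<int p}. a x * a (- x))"
proof -
  have "(\<Sum>k\<in>{0..<int p}. dft p a k * dft p a k) =
      (\<Sum>k\<in>{0..<int p}. \<Sum>x\<in>{0..<int p}. of_real (a x) * (dft p a k * unity p (k * x)))"
    by (subst (2) dft_def) (simp add: sum_distrib_left mult_ac)
  also have "\<dots> = (\<Sum>x\<in>{0..<int p}. of_real (a x) * (\<Sum>k\<in>{0..<int p}. dft p a k * unity p (k * x)))"
    by (subst sum.swap) (simp add: sum_distrib_left)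
  finally show ?thesis by (simp only: sum_dft_unity assms) (simp add: sum_distrib_left mult_ac)
qed

lemma parseval:
  assumes "p > 0" "\<And>x. a (x mod int p) = a x"
  shows "(\<Sum>k\<in>{0..<int p}. dft p a k * cnj (dft p a k)) = of_nat p * of_real (\<Sum>x\<in>{0..<int p}. a x * a x)"
proof -
  have "(\<Sum>k\<in>{0..<int p}. dft p a k * cnj (dft p a k)) =
      (\<Sum>k\<in>{0..<int p}. \<Sum>x\<in>{0..<int p}. of_real (a x) * (dft p a k * unity p (k * (- x))))"
    by (subst (2) dft_def) (simp add: sum_distrib_left mult_ac cnj_unity)
  also have "\<dots> = (\<Sum>x\<in>{0..<int p}. of_real (a x) * (\<Sum>k\<in>{0..<int p}. dft p a k * unity p (k * (- x))))"
    by (subst sum.swap) (simp add: sum_distrib_left)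
  finally show ?thesis by (simp only: sum_dft_unity assms) (simp add: sum_distrib_left mult_ac)
qed

section \<open>Autocorrelation and the fourth moment of the transform\<close>

definition autocorr :: "nat \<Rightarrow> (int \<Rightarrow> real) \<Rightarrow> int \<Rightarrow> real" where
  "autocorr p a u = (\<Sum>x\<in>{0..<int p}. a x * a (x + u))"

lemma autocorr_mod:
  assumes "\<And>x. a (x mod int p) = a x" shows "autocorr p a (u mod int p) = autocorr p a u"
proof -
  have "a (x + u mod int p) = a (x + u)" for x
    using assms[of "x + u mod int p"] assms[of "x + u"] by (simp add: mod_simps)
  then show ?thesis by (simp add: autocorr_def)
qed

text \<open>The Wiener-Khinchin identity modulo p.\<close>

lemma dft_autocorr:
  assumes p: "p > 0" and a: "\<And>x. a (x mod int p) = a x"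
  shows "dft p (autocorr p a) k = dft p a k * cnj (dft p a k)"
proof -
  have "dft p (autocorr p a) k =
      (\<Sum>u\<in>{0..<int p}. \<Sum>x\<in>{0..<int p}. of_real (a x * a (x + u)) * unity p (k * u))"
    by (simp add: dft_def autocorr_def sum_distrib_right)
  also have "\<dots> = (\<Sum>x\<in>{0..<int p}. \<Sum>u\<in>{0..<int p}. of_real (a x) * unity p (k * (- x)) * (of_real (a (u + x)) * unity p (k * (u + x))))"
  proof (subst sum.swap, intro sum.cong refl)
    fix x u
    have "unity p (k * u) = unity p (k * (- x)) * unity p (k * (u + x))"
      by (simp add: algebra_simps flip: unity_add)
    then show "of_real (a x * a (x + u)) * unity p (k * u) =
      of_real (a x) * unity p (k * (- x)) * (of_real (a (u + x)) * unity p (k * (u + x)))"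
      by (simp add: add.commute)
  qed
  also have "\<dots> = (\<Sum>x\<in>{0..<int p}. of_real (a x) * unity p (k * (- x)) * (\<Sum>u\<in>{0..<int p}. of_real (a (u + x)) * unity p (k * (u + x))))"
    by (simp add: sum_distrib_left)
  also have "\<dots> = (\<Sum>x\<in>{0..<int p}. of_real (a x) * unity p (k * (- x)) * dft p a k)"
  proof (rule sum.cong[OF refl])
    fix x
    show "of_real (a x) * unity p (k * (- x)) * (\<Sum>u\<in>{0..<int p}. of_real (a (u + x)) * unity p (k * (u + x))) =
      of_real (a x) * unity p (k * (- x)) * dft p a k"
      using sum_residues_add[OF p, of "\<lambda>u. of_real (a u) * unity p (k * u)" x] p a
      by (simp add: dft_def)
  qed
  also have "\<dots> = dft p a k * (\<Sum>x\<in>{0..<int p}. of_real (a x) * unity p (k * (- x)))"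
    by (simp add: sum_distrib_left mult_ac)
  also have "(\<Sum>x\<in>{0..<int p}. of_real (a x) * unity p (k * (- x))) = cnj (dft p a k)"
    by (simp add: dft_def cnj_unity)
  finally show ?thesis .
qed

text \<open>Parseval for the autocorrelation, whose transform is the squared modulus.\<close>

lemma sum_norm_dft_power4:
  assumes "p > 0" "\<And>x. a (x mod int p) = a x"
  shows "(\<Sum>k\<in>{0..<int p}. (dft p a k * cnj (dft p a k)) * (dft p a k * cnj (dft p a k))) =
    of_nat p * of_real (\<Sum>u\<in>{0..<int p}. (autocorr p a u)\<^sup>2)"
  using parseval[of p "autocorr p a"] assms
  by (simp add: autocorr_mod dft_autocorr power2_eq_square mult_ac)

section \<open>Class functions and their means\<close>

text \<open>For k and l in the same class, l = k w with w^q = 1. Multiplication by such a w maps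
  every class to itself, so the substitution of w x for x carries one transform value into the
  other.\<close>

lemma class_function_dft:
  assumes p: "prime p" and a: "class_function p q a"
  shows "class_function p q (dft p a)"
  unfolding class_function_def
proof (intro conjI allI impI)
  have p0: "p > 0" using p prime_gt_0_nat by blast
  show "dft p a (x mod int p) = dft p a x" for x using p0 by simp
  fix k l assume k: "\<not> int p dvd k" and l: "\<not> int p dvd l" and kl: "[k ^ q = l ^ q] (mod int p)"
  have pp: "prime (int p)" using p by simp
  have "coprime k (int p)" using k pp by (metis coprime_commute prime_imp_coprime)
  then obtain v where v: "[k * v = 1] (mod int p)" using cong_solve_coprime_int by blast
  define w where "w = v * l"
  have w: "[k * w = l] (mod int p)"
    using cong_mult[OF v cong_refl[of l]] by (simp add: w_def mult_ac)
  then have wnd: "\<not> int p dvd w" using l by (meson cong_dvd_iff dvd_mult)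
  have "[k ^ q * w ^ q = k ^ q * 1] (mod int p)"
    using cong_pow[OF w, of q] kl by (simp add: power_mult_distrib) (metis cong_sym cong_trans)
  moreover have "coprime (k ^ q) (int p)" using \<open>coprime k (int p)\<close> by simp
  ultimately have w1: "[w ^ q = 1] (mod int p)" using cong_mult_lcancel by blast
  have aw: "a (w * x) = a x" for x
  proof (cases "int p dvd x")
    case True
    then have "(w * x) mod int p = x mod int p" by (simp add: mod_eq_0_iff_dvd)
    then show ?thesis using a unfolding class_function_def by metis
  next
    case False
    then have "\<not> int p dvd w * x" using wnd pp by (simp add: prime_dvd_mult_iff)
    moreover have "[(w * x) ^ q = x ^ q] (mod int p)"
      using cong_mult[OF w1 cong_refl[of "x ^ q"]] by (simp add: power_mult_distrib)
    ultimately show ?thesis using a False unfolding class_function_def by blast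
  qed
  have "dft p a l = dft p a (k * w)" using w p0 by (metis cong_def dft_mod)
  also have "\<dots> = (\<Sum>x\<in>{0..<int p}. of_real (a (w * x)) * unity p (k * (w * x)))"
    by (simp add: dft_def aw mult.assoc)
  also have "\<dots> = dft p a k"
    unfolding dft_def using a p0
    by (intro sum_residues_mult[OF p wnd, of "\<lambda>x. of_real (a x) * unity p (k * x)"]) (simp add: class_function_def)
  finally show "dft p a k = dft p a l" by simp
qed

lemma class_function_comp: "class_function p q f \<Longrightarrow> class_function p q (\<lambda>x. h (f x))"
  unfolding class_function_def by (intro conjI allI impI arg_cong[of _ _ h]) blast+

lemma class_function_prod:
  assumes "\<And>i. i \<in> I \<Longrightarrow> class_function p q (G i)"
  shows "class_function p q (\<lambda>x. \<Prod>i\<in>I. G i x)"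
proof -
  have "(\<Prod>i\<in>I. G i (x mod int p)) = (\<Prod>i\<in>I. G i x)" for x
    using assms by (intro prod.cong) (auto simp: class_function_def)
  moreover have "(\<Prod>i\<in>I. G i x) = (\<Prod>i\<in>I. G i y)"
    if "\<not> int p dvd x" "\<not> int p dvd y" "[x ^ q = y ^ q] (mod int p)" for x y
    using assms that unfolding class_function_def by (intro prod.cong) blast+
  ultimately show ?thesis unfolding class_function_def by blast
qed

lemma class_mean_cnj: "class_mean m g (\<lambda>x. cnj (f x)) = cnj (class_mean m g f)"
  by (simp add: class_mean_def)

lemma norm_class_mean_le:
  assumes "m > 0" "\<And>x. cmod (f x) \<le> W"
  shows "cmod (class_mean m g f) \<le> W"
proof -
  have "cmod (\<Sum>s<m. f (int g ^ s)) \<le> (\<Sum>s<m. W)" by (intro sum_norm_le assms)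
  then show ?thesis using assms(1) by (simp add: class_mean_def norm_divide divide_le_eq mult.commute)
qed

lemma class_function_primroot_power:
  assumes p: "prime p" and qm: "q * m = p - 1" and g: "residue_primroot p g" and f: "class_function p q f"
  shows "f (int g ^ e) = f (int g ^ (e mod m))"
proof -
  have "(int g ^ e) ^ q = (int g ^ (p - 1)) ^ (e div m) * (int g ^ (e mod m)) ^ q"
  proof -
    have "e * q = (p - 1) * (e div m) + (e mod m) * q"
      unfolding qm[symmetric] by (metis distrib_right mult.assoc mult.commute mult_div_mod_eq)
    then show ?thesis by (metis power_add power_mult)
  qed
  also have "[\<dots> = 1 ^ (e div m) * (int g ^ (e mod m)) ^ q] (mod int p)"
    by (intro cong_mult cong_pow primroot_power_order[OF p g] cong_refl)
  finally have "[(int g ^ e) ^ q = (int g ^ (e mod m)) ^ q] (mod int p)" by simp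
  then show ?thesis using f primroot_power_not_dvd[OF p g] unfolding class_function_def by blast
qed

lemma sum_mod_blocks: "(\<Sum>e<q * m. h (e mod m)) = of_nat q * (\<Sum>s<m. h s :: 'a :: comm_semiring_1)"
proof (induction q)
  case (Suc q)
  have "(\<Sum>e<Suc q * m. h (e mod m)) = (\<Sum>e<q * m. h (e mod m)) + (\<Sum>e\<in>{q * m..<q * m + m}. h (e mod m))"
    using sum.atLeastLessThan_concat[of 0 "q * m" "Suc q * m" "\<lambda>e. h (e mod m)"]
    by (simp add: lessThan_atLeast0 add.commute)
  also have "(\<Sum>e\<in>{q * m..<q * m + m}. h (e mod m)) = (\<Sum>s<m. h s)"
    by (simp add: sum.atLeastLessThan_shift_0[of _ "q * m"] lessThan_atLeast0)
  finally show ?case unfolding Suc by (simp add: algebra_simps)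
qed simp

lemma sum_primroot_powers:
  assumes p: "prime p" and g: "residue_primroot p g" and f: "\<And>x. f (x mod int p) = f x"
  shows "(\<Sum>x\<in>{1..<int p}. f x) = (\<Sum>e<p - 1. f (int g ^ e))"
proof -
  have "f (int (g ^ e mod p)) = f (int g ^ e)" for e
    using f[of "int g ^ e"] by (simp add: zmod_int)
  then show ?thesis using sum.reindex_bij_betw[OF bij_betw_primroot_powers[OF p g], of f] by simp
qed

text \<open>All classes have the size q, so the mean over representatives is the mean over all
  units. Complete sums, which Parseval evaluates, thus determine the class means.\<close>

lemma class_mean_eq:
  assumes p: "prime p" and qm: "q * m = p - 1" and g: "residue_primroot p g" and f: "class_function p q f"
  shows "class_mean m g f = ((\<Sum>x\<in>{0..<int p}. f x) - f 0) / of_nat (p - 1)"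
proof -
  have p1: "p > 1" using prime_gt_1_nat[OF p] .
  then have q0: "q > 0" using qm by (cases "q = 0") auto
  have "{0..<int p} = insert 0 {1..<int p}" using p1 by auto
  then have "(\<Sum>x\<in>{0..<int p}. f x) - f 0 = (\<Sum>x\<in>{1..<int p}. f x)" by simp
  also have "\<dots> = (\<Sum>e<p - 1. f (int g ^ e))"
    using f by (intro sum_primroot_powers p g) (simp add: class_function_def)
  also have "\<dots> = (\<Sum>e<q * m. f (int g ^ (e mod m)))"
    unfolding qm by (rule sum.cong[OF refl]) (rule class_function_primroot_power[OF assms])
  also have "\<dots> = of_nat q * (\<Sum>s<m. f (int g ^ s))" by (rule sum_mod_blocks)
  finally show ?thesis unfolding class_mean_def qm[symmetric] using q0 by simp
qed

section \<open>Balanced sequences that are constant on the classes\<close>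

text \<open>The sum is -1 because D consists of half of the units, and 0 carries the value
  -1.\<close>

locale balanced_class_sequence =
  fixes m p g :: nat and a :: "int \<Rightarrow> real"
  assumes m: "m > 0" and p: "prime p" and m_dvd: "m dvd p - 1" and g: "residue_primroot p g"
    and a_class: "class_function p ((p - 1) div m) a"
    and a_pm: "a x = 1 \<or> a x = -1"
    and a_sum: "(\<Sum>x\<in>{0..<int p}. a x) = -1"
begin

definition q :: nat where "q = (p - 1) div m"

lemma p0: "p > 0" and p1: "p > 1" and p2: "p \<ge> 2"
  using p prime_gt_0_nat prime_gt_1_nat prime_ge_2_nat by auto

lemma qm: "q * m = p - 1" and a_class': "class_function p q a"
  using m_dvd a_class by (simp_all add: q_def)

lemma a_mod: "a (x mod int p) = a x"
  using a_class unfolding class_function_def by blast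

lemma a_sq: "a x * a x = 1"
  using a_pm[of x] by auto

lemma dft_class: "class_function p q (dft p a)"
  using class_function_dft[OF p a_class'] .

lemma dft_0: "dft p a 0 = -1"
  using a_sum by (simp add: dft_def flip: of_real_sum)

text \<open>The transform adds up to p a(0) and equals -1 at 0, so its mean over the units is
  bounded, although the mean of its squared modulus is p + 1. This makes frequencies that occur only
  once negligible.\<close>

lemma class_mean_dft: "cmod (class_mean m g (dft p a)) \<le> 3"
proof -
  have "class_mean m g (dft p a) = (of_nat p * of_real (a 0) + 1) / of_nat (p - 1)"
    unfolding class_mean_eq[OF p qm g dft_class]
    using sum_dft_unity[where p = p and a = a and y = 0] p0 a_mod by (simp add: dft_0)
  also have "cmod \<dots> \<le> 3"
  proof -
    have "cmod (of_nat p * of_real (a 0) + 1) \<le> real p + 1"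
      using norm_triangle_ineq[of "of_nat p * of_real (a 0) :: complex" 1] a_pm[of 0] by (auto simp: norm_mult)
    also have "\<dots> \<le> 3 * real (p - 1)" using p2 by (simp add: of_nat_diff)
    finally show ?thesis unfolding norm_divide norm_of_nat using p1 by (simp add: divide_le_eq)
  qed
  finally show ?thesis .
qed

lemma class_mean_dft_norm:
  "class_mean m g (\<lambda>x. dft p a x * cnj (dft p a x)) = of_nat (p + 1)"
proof -
  have "class_function p q (\<lambda>x. dft p a x * cnj (dft p a x))"
    by (rule class_function_comp[OF dft_class])
  from class_mean_eq[OF p qm g this]
  have "class_mean m g (\<lambda>x. dft p a x * cnj (dft p a x)) = (of_nat p * of_nat p - 1) / of_nat (p - 1)"
    using parseval[where p = p and a = a] p0 a_mod by (simp add: a_sq dft_0)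
  also have "of_nat p * of_nat p - 1 = (of_nat (p + 1) * of_nat (p - 1) :: complex)"
    using p1 by (simp add: of_nat_diff algebra_simps)
  finally show ?thesis using p1 by simp
qed

definition reflection_corr :: real where
  "reflection_corr = (\<Sum>x\<in>{0..<int p}. a x * a (- x))"

lemma abs_reflection_corr: "\<bar>reflection_corr\<bar> \<le> real p"
proof -
  have "\<bar>reflection_corr\<bar> \<le> (\<Sum>x\<in>{0..<int p}. \<bar>a x * a (- x)\<bar>)"
    unfolding reflection_corr_def by (rule sum_abs)
  also have "\<dots> = (\<Sum>x\<in>{0..<int p}. 1)"
    using a_pm by (intro sum.cong refl) (metis abs_minus_cancel abs_mult abs_one mult_1)
  finally show ?thesis by simp
qed

text \<open>The exact value is (p c - 1) / (p - 1) with c = \<open>reflection_corr\<close>. As it is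
  real, the conjugate square has the same mean.\<close>

lemma class_mean_dft_square:
  "\<exists>\<beta>. class_mean m g (\<lambda>x. dft p a x * dft p a x) = of_real \<beta> \<and> \<bar>\<beta> - reflection_corr\<bar> \<le> 3"
proof -
  have "class_function p q (\<lambda>x. dft p a x * dft p a x)"
    by (rule class_function_comp[OF dft_class])
  from class_mean_eq[OF p qm g this]
  have "class_mean m g (\<lambda>x. dft p a x * dft p a x) = of_real ((real p * reflection_corr - 1) / real (p - 1))"
    using sum_dft_mult_dft[where p = p and a = a] p0 a_mod by (simp add: reflection_corr_def dft_0)
  moreover have "(real p * reflection_corr - 1) / real (p - 1) - reflection_corr = (reflection_corr - 1) / real (p - 1)"
    using p1 by (simp add: of_nat_diff field_simps)
  moreover have "\<bar>(reflection_corr - 1) / real (p - 1)\<bar> \<le> 3"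
  proof -
    have "\<bar>reflection_corr - 1\<bar> \<le> real p + 1" using abs_reflection_corr by linarith
    also have "\<dots> \<le> 3 * real (p - 1)" using p2 by (simp add: of_nat_diff)
    finally show ?thesis using p1 by (simp add: abs_divide divide_le_eq)
  qed
  ultimately show ?thesis by metis
qed

text \<open>The squared modulus takes at most m values on the units, all nonnegative and with mean p
  + 1 over the classes; each is therefore at most m (p + 1). No evaluation of Gauss sums
  enters.\<close>

lemma norm_dft_le: "cmod (dft p a k) \<le> sqrt (2 * m * p)"
proof (cases "int p dvd k")
  case True
  then have "dft p a k = dft p a 0" using dft_mod[OF p0, of a k] by (simp add: dvd_eq_mod_eq_0)
  moreover have "1 \<le> 2 * m * p" using m p0 by (simp add: Suc_le_eq)
  then have "1 \<le> real (2 * m * p)" by (metis of_nat_1 of_nat_le_iff)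
  ultimately show ?thesis by (simp add: dft_0)
next
  case False
  define F where "F x = dft p a x * cnj (dft p a x)" for x
  have F: "F x = of_real ((cmod (dft p a x))\<^sup>2)" for x unfolding F_def by (metis complex_norm_square)
  obtain e where e: "[k = int g ^ e] (mod int p)" using primroot_power_exists[OF p g False] by blast
  have "dft p a k = dft p a (int g ^ e)" using e p0 by (metis cong_def dft_mod)
  also have "\<dots> = dft p a (int g ^ (e mod m))" by (rule class_function_primroot_power[OF p qm g dft_class])
  finally have "(cmod (dft p a k))\<^sup>2 = (cmod (dft p a (int g ^ (e mod m))))\<^sup>2" by simp
  also have "\<dots> \<le> (\<Sum>s<m. (cmod (dft p a (int g ^ s)))\<^sup>2)"
    using m by (intro member_le_sum) auto
  also have "\<dots> = real m * real (p + 1)"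
  proof -
    have "of_real (\<Sum>s<m. (cmod (dft p a (int g ^ s)))\<^sup>2) = of_nat m * class_mean m g F"
      using m by (simp add: class_mean_def F)
    also have "class_mean m g F = of_nat (p + 1)" unfolding F_def by (rule class_mean_dft_norm)
    also have "of_nat m * of_nat (p + 1) = complex_of_real (real m * real (p + 1))" by simp
    finally show ?thesis unfolding of_real_eq_iff .
  qed
  also have "\<dots> \<le> real m * real (2 * p)" using p2 by (intro mult_left_mono) auto
  finally show ?thesis by (intro real_le_rsqrt) (simp add: mult_ac)
qed

text \<open>In the expansion of |f|^4 two factors are plain and two conjugated.\<close>

definition dft4 :: "nat \<Rightarrow> int \<Rightarrow> complex" where
  "dft4 i x = (if i < 2 then dft p a x else cnj (dft p a x))"

lemma dft4_class: "class_function p q (dft4 i)"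
  unfolding dft4_def by (rule class_function_comp[OF dft_class])

lemma norm_dft4_le: "cmod (dft4 i x) \<le> sqrt (2 * m * p)"
  unfolding dft4_def using norm_dft_le by simp

lemma class_mean_dft4: "cmod (class_mean m g (dft4 i)) \<le> 3"
  unfolding dft4_def using class_mean_dft by (cases "i < 2") (simp_all add: class_mean_cnj)

text \<open>Indices with the same frequency c see the same point, so their factors form one class
  function with one mean.\<close>

definition fiber_mean :: "(nat \<Rightarrow> int) \<Rightarrow> int \<Rightarrow> complex" where
  "fiber_mean k c = class_mean m g (\<lambda>x. \<Prod>i\<in>{i \<in> {..<4}. k i = c}. dft4 i x)"

lemma norm_fiber_mean_le: "cmod (fiber_mean k c) \<le> (\<Prod>i\<in>{i \<in> {..<4}. k i = c}. sqrt (2 * m * p))"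
  unfolding fiber_mean_def
  by (intro norm_class_mean_le m) (simp only: prod_norm[symmetric], intro prod_mono conjI norm_ge_zero norm_dft4_le)

end

section \<open>Correlations of four Fourier coefficients\<close>

text \<open>Equidistribution is applied to the set of distinct frequencies, with one class function
  per fiber. There are at most four of them, so the constants for n <= 4 are added. Whatever the
  fibers, the bounds multiply to sqrt (2 m p)^4.\<close>

lemma four_point_sum:
  assumes "m > 0"
  shows "\<exists>C\<ge>0. \<forall>p g a k. balanced_class_sequence m p g a \<longrightarrow> (\<forall>i<4. k i \<in> {0..<int p}) \<longrightarrow>
    cmod ((\<Sum>\<kappa>\<in>{0..<int p}. \<Prod>i<4. balanced_class_sequence.dft4 p a i (\<kappa> - k i))
      - of_nat p * (\<Prod>c\<in>k ` {..<4}. balanced_class_sequence.fiber_mean m p g a k c)) \<le> C * (real p)\<^sup>2 * sqrt p"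
proof -
  define Q where "Q n C \<longleftrightarrow> C \<ge> 0 \<and> (\<forall>p q g X f W. prime p \<longrightarrow> q * m = p - 1 \<longrightarrow> residue_primroot p g \<longrightarrow>
    X \<subseteq> {0..<int p} \<longrightarrow> card X = n \<longrightarrow>
    (\<forall>c\<in>X. class_function p q (f c) \<and> (\<forall>x. cmod (f c x) \<le> W c)) \<longrightarrow>
    cmod ((\<Sum>x\<in>{0..<int p}. \<Prod>c\<in>X. f c (x - c)) - of_nat p * (\<Prod>c\<in>X. class_mean m g (f c)))
      \<le> C * sqrt p * (\<Prod>c\<in>X. W c))" for n C
  have "\<exists>C. Q n C" for n
    using class_function_equidistribution[OF assms, of n] unfolding Q_def by blast
  then obtain C where "\<And>n. Q n (C n)" by metis
  then have C: "\<And>n. C n \<ge> 0" and bound: "\<And>n p q g X f W. prime p \<Longrightarrow> q * m = p - 1 \<Longrightarrow> residue_primroot p g \<Longrightarrow>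
    X \<subseteq> {0..<int p} \<Longrightarrow> card X = n \<Longrightarrow>
    (\<forall>c\<in>X. class_function p q (f c) \<and> (\<forall>x. cmod (f c x) \<le> W c)) \<Longrightarrow>
    cmod ((\<Sum>x\<in>{0..<int p}. \<Prod>c\<in>X. f c (x - c)) - of_nat p * (\<Prod>c\<in>X. class_mean m g (f c)))
      \<le> C n * sqrt p * (\<Prod>c\<in>X. W c)"
    unfolding Q_def by blast+
  define C' where "C' = (\<Sum>n\<le>4. C n) * (2 * real m)\<^sup>2"
  have "cmod ((\<Sum>\<kappa>\<in>{0..<int p}. \<Prod>i<4. balanced_class_sequence.dft4 p a i (\<kappa> - k i))
      - of_nat p * (\<Prod>c\<in>k ` {..<4}. balanced_class_sequence.fiber_mean m p g a k c)) \<le> C' * (real p)\<^sup>2 * sqrt p"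
    if a: "balanced_class_sequence m p g a" and k: "\<forall>i<4. k i \<in> {0..<int p}" for p g a and k :: "nat \<Rightarrow> int"
  proof -
    interpret balanced_class_sequence m p g a by (rule a)
    define X where "X = k ` {..<4}"
    define n where "n = card X"
    define f where "f c x = (\<Prod>i\<in>{i \<in> {..<4}. k i = c}. dft4 i x)" for c x
    define W where "W c = (\<Prod>i\<in>{i \<in> {..<4}. k i = c}. sqrt (2 * m * p))" for c
    have n: "n \<le> 4" unfolding n_def X_def using card_image_le[of "{..<4::nat}" k] by simp
    have group: "(\<Prod>c\<in>X. \<Prod>i\<in>{i \<in> {..<4}. k i = c}. h i) = (\<Prod>i<4. h i)" for h :: "nat \<Rightarrow> 'b :: comm_monoid_mult"
      unfolding X_def by (rule prod.group) auto
    have "cmod ((\<Sum>x\<in>{0..<int p}. \<Prod>c\<in>X. f c (x - c)) - of_nat p * (\<Prod>c\<in>X. class_mean m g (f c)))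
      \<le> C n * sqrt p * (\<Prod>c\<in>X. W c)"
    proof (rule bound[OF p qm g])
      show "X \<subseteq> {0..<int p}" using k by (auto simp: X_def)
      show "\<forall>c\<in>X. class_function p q (f c) \<and> (\<forall>x. cmod (f c x) \<le> W c)"
      proof (intro ballI conjI allI)
        show "class_function p q (f c)" for c
          unfolding f_def by (intro class_function_prod dft4_class)
        show "cmod (f c x) \<le> W c" for c x
          unfolding f_def W_def
          by (simp only: prod_norm[symmetric], intro prod_mono conjI norm_ge_zero norm_dft4_le)
      qed
    qed (simp add: n_def)
    also have "(\<Prod>c\<in>X. W c) = (2 * real m * real p)\<^sup>2"
    proof -
      have 4: "y ^ 4 = (y\<^sup>2)\<^sup>2" for y :: real by (simp flip: power_mult)
      have "(\<Prod>c\<in>X. W c) = sqrt (2 * m * p) ^ 4" unfolding W_def group by simp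
      also from 4[of "sqrt (2 * m * p)"] have "sqrt (2 * m * p) ^ 4 = ((sqrt (2 * m * p))\<^sup>2)\<^sup>2" .
      also have sq: "(sqrt (2 * m * p))\<^sup>2 = 2 * real m * real p" by simp
      finally show ?thesis .
    qed
    also have "(\<Sum>x\<in>{0..<int p}. \<Prod>c\<in>X. f c (x - c)) = (\<Sum>\<kappa>\<in>{0..<int p}. \<Prod>i<4. dft4 i (\<kappa> - k i))"
    proof (rule sum.cong[OF refl])
      fix x
      have "(\<Prod>c\<in>X. f c (x - c)) = (\<Prod>c\<in>X. \<Prod>i\<in>{i \<in> {..<4}. k i = c}. dft4 i (x - k i))"
        unfolding f_def by (intro prod.cong refl) auto
      then show "(\<Prod>c\<in>X. f c (x - c)) = (\<Prod>i<4. dft4 i (x - k i))" unfolding group .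
    qed
    also have "C n * sqrt p * (2 * real m * real p)\<^sup>2 \<le> C' * (real p)\<^sup>2 * sqrt p"
    proof -
      have "C n \<le> (\<Sum>n\<le>4. C n)" using n C by (intro member_le_sum) auto
      then have "C n * ((2 * real m)\<^sup>2 * (real p)\<^sup>2 * sqrt p) \<le> (\<Sum>n\<le>4. C n) * ((2 * real m)\<^sup>2 * (real p)\<^sup>2 * sqrt p)"
        by (intro mult_right_mono) auto
      then show ?thesis by (simp add: C'_def power_mult_distrib mult_ac)
    qed
    finally show ?thesis unfolding X_def f_def fiber_mean_def .
  qed
  moreover have "C' \<ge> 0" unfolding C'_def using C by (intro mult_nonneg_nonneg sum_nonneg) auto
  ultimately show ?thesis by blast
qed

context balanced_class_sequence
begin

definition fourth_corr :: "(nat \<Rightarrow> int) \<Rightarrow> complex" where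
  "fourth_corr k = (\<Sum>\<kappa>\<in>{0..<int p}. \<Prod>i<4. dft4 i (\<kappa> - k i)) / of_nat p"

text \<open>One summand for each way to pair the four indices. When all frequencies agree this is
  not the true size of the correlation; \<open>quad_sum_main\<close> makes up for it.\<close>

definition fourth_corr_main :: "(nat \<Rightarrow> int) \<Rightarrow> real" where
  "fourth_corr_main k = (if k 0 = k 2 \<and> k 1 = k 3 then (real p)\<^sup>2 else 0)
     + (if k 0 = k 3 \<and> k 1 = k 2 then (real p)\<^sup>2 else 0)
     + (if k 0 = k 1 \<and> k 2 = k 3 then reflection_corr\<^sup>2 else 0)"

lemma lessThan_4: "{..<4 :: nat} = {0, 1, 2, 3}"
  by auto

text \<open>The mean belonging to the isolated frequency is bounded; the remaining three factors
  cost sqrt (2 m p) each. Compared with the trivial bound, a factor sqrt p is saved.\<close>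

lemma prod_fiber_mean_isolated:
  assumes j: "j < 4" and iso: "\<And>i. i < 4 \<Longrightarrow> i \<noteq> j \<Longrightarrow> k i \<noteq> k j"
  shows "cmod (\<Prod>c\<in>k ` {..<4}. fiber_mean k c) \<le> 3 * sqrt (2 * m * p) ^ 3"
proof -
  define w where "w = sqrt (2 * m * p)"
  have w: "w > 0" unfolding w_def using m p0 by simp
  let ?X = "k ` {..<4}" and ?f = "\<lambda>c. {i \<in> {..<4}. k i = c}"
  have fj: "?f (k j) = {j}" using j iso by auto
  have kj: "k j \<in> ?X" using j by auto
  have "w ^ 4 = (\<Prod>i<4::nat. w)" by simp
  also have "\<dots> = (\<Prod>c\<in>?X. \<Prod>i\<in>?f c. w)" by (rule prod.group[symmetric]) auto
  also have "\<dots> = w * (\<Prod>c\<in>?X - {k j}. \<Prod>i\<in>?f c. w)"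
    by (subst prod.remove[OF _ kj]) (simp, simp only: fj prod.insert[OF finite.emptyI] empty_iff not_False_eq_True prod.empty mult_1_right)
  finally have rest: "(\<Prod>c\<in>?X - {k j}. \<Prod>i\<in>?f c. w) = w ^ 3"
    using w by (simp add: power_Suc numeral_eq_Suc del: prod_constant)
  have "cmod (\<Prod>c\<in>?X. fiber_mean k c) = cmod (fiber_mean k (k j)) * (\<Prod>c\<in>?X - {k j}. cmod (fiber_mean k c))"
    by (subst prod.remove[OF _ kj]) (simp_all add: norm_mult prod_norm)
  also have "\<dots> \<le> 3 * (\<Prod>c\<in>?X - {k j}. \<Prod>i\<in>?f c. w)"
  proof (intro mult_mono prod_mono)
    have "fiber_mean k (k j) = class_mean m g (dft4 j)" unfolding fiber_mean_def fj by simp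
    then show "cmod (fiber_mean k (k j)) \<le> 3" using class_mean_dft4 by simp
    show "0 \<le> (\<Prod>c\<in>?X - {k j}. cmod (fiber_mean k c))" by (intro prod_nonneg) auto
    show "0 \<le> cmod (fiber_mean k c) \<and> cmod (fiber_mean k c) \<le> (\<Prod>i\<in>?f c. w)" for c
      using norm_fiber_mean_le[of k c] unfolding w_def by simp
  qed simp
  finally show ?thesis unfolding rest unfolding w_def .
qed

text \<open>Four frequencies that are not all equal either have an isolated one or form two distinct
  pairs. In the constant, 6 m sqrt (2 m) is 3 (2 m)^(3/2) from the first case; 15 covers 2 p + 1 and
  3 (2 p + 3) from the pairs.\<close>

lemma prod_fiber_mean_main:
  assumes k: "\<not> (k 0 = k 1 \<and> k 0 = k 2 \<and> k 0 = k 3)"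
  shows "cmod ((\<Prod>c\<in>k ` {..<4}. fiber_mean k c) - of_real (fourth_corr_main k))
    \<le> (6 * m * sqrt (2 * m) + 15) * (real p * sqrt p)"
proof -
  have sq: "1 \<le> sqrt p" using p1 by simp
  have psq: "real p \<le> real p * sqrt p" using mult_left_mono[OF sq, of "real p"] by simp
  have p1': "1 \<le> real p" using p1 by simp
  consider (iso) j where "j < 4" "\<And>i. i < 4 \<Longrightarrow> i \<noteq> j \<Longrightarrow> k i \<noteq> k j"
    | (a) "k 0 = k 2" "k 1 = k 3" "k 0 \<noteq> k 1"
    | (b) "k 0 = k 3" "k 1 = k 2" "k 0 \<noteq> k 1"
    | (c) "k 0 = k 1" "k 2 = k 3" "k 0 \<noteq> k 2"
  proof -
    have less4: "i = 0 \<or> i = 1 \<or> i = 2 \<or> i = 3" if "i < 4" for i :: nat using that by linarith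
    show ?thesis
    proof (cases "\<exists>j<4. \<forall>i<4. i \<noteq> j \<longrightarrow> k i \<noteq> k j")
      case True
      then show ?thesis using iso by blast
    next
      case False
      then have n: "\<exists>i<4. i \<noteq> j \<and> k i = k j" if "j < 4" for j using that by blast
      have "k 1 = k 0 \<or> k 2 = k 0 \<or> k 3 = k 0" using n[of 0] less4 by force
      moreover have "k 0 = k 1 \<or> k 2 = k 1 \<or> k 3 = k 1" using n[of 1] less4 by force
      moreover have "k 0 = k 2 \<or> k 1 = k 2 \<or> k 3 = k 2" using n[of 2] less4 by force
      moreover have "k 0 = k 3 \<or> k 1 = k 3 \<or> k 2 = k 3" using n[of 3] less4 by force
      ultimately have "(k 0 = k 2 \<and> k 1 = k 3 \<and> k 0 \<noteq> k 1) \<or> (k 0 = k 3 \<and> k 1 = k 2 \<and> k 0 \<noteq> k 1)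
          \<or> (k 0 = k 1 \<and> k 2 = k 3 \<and> k 0 \<noteq> k 2)"
        using k by (smt (verit))
      then show ?thesis using a b c by blast
    qed
  qed
  then show ?thesis
  proof cases
    case iso
    have "fourth_corr_main k = 0"
    proof -
      have "j = 0 \<or> j = 1 \<or> j = 2 \<or> j = 3" using iso(1) by linarith
      then show ?thesis
      proof (elim disjE)
        assume "j = 0"
        then show ?thesis using iso(2)[of 1] iso(2)[of 2] iso(2)[of 3] by (simp add: fourth_corr_main_def)
      next
        assume "j = 1"
        then show ?thesis using iso(2)[of 0] iso(2)[of 2] iso(2)[of 3] by (simp add: fourth_corr_main_def)
      next
        assume "j = 2"
        then show ?thesis using iso(2)[of 0] iso(2)[of 1] iso(2)[of 3] by (simp add: fourth_corr_main_def)
      next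
        assume "j = 3"
        then show ?thesis using iso(2)[of 0] iso(2)[of 1] iso(2)[of 2] by (simp add: fourth_corr_main_def)
      qed
    qed
    then have "cmod ((\<Prod>c\<in>k ` {..<4}. fiber_mean k c) - of_real (fourth_corr_main k)) \<le> 3 * sqrt (2 * m * p) ^ 3"
      using prod_fiber_mean_isolated[of j k] iso by simp
    also have "3 * sqrt (2 * m * p) ^ 3 = (6 * m * sqrt (2 * m)) * (real p * sqrt p)"
      by (simp add: power3_eq_cube real_sqrt_mult mult_ac)
    also have "\<dots> \<le> (6 * m * sqrt (2 * m) + 15) * (real p * sqrt p)"
      by (intro mult_right_mono) auto
    finally show ?thesis .
  next
    case a
    have X: "k ` {..<4} = {k 0, k 1}" using a by (auto simp: lessThan_4)
    have f: "{i \<in> {..<4}. k i = k 0} = {0, 2}" "{i \<in> {..<4}. k i = k 1} = {1, 3}"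
      using a by (auto simp: lessThan_4)
    have "(\<Prod>c\<in>k ` {..<4}. fiber_mean k c) = of_nat (p + 1) * of_nat (p + 1)"
    proof -
      have "(\<Prod>c\<in>k ` {..<4}. fiber_mean k c) = fiber_mean k (k 0) * fiber_mean k (k 1)"
        unfolding X using a(3) by simp
      also have "\<dots> = of_nat (p + 1) * of_nat (p + 1)"
        unfolding fiber_mean_def f using class_mean_dft_norm by (simp add: dft4_def)
      finally show ?thesis .
    qed
    moreover have "fourth_corr_main k = (real p)\<^sup>2" using a by (simp add: fourth_corr_main_def)
    ultimately have "(\<Prod>c\<in>k ` {..<4}. fiber_mean k c) - of_real (fourth_corr_main k) = of_real (2 * real p + 1)"
      by (simp add: power2_eq_square algebra_simps)
    then have "cmod ((\<Prod>c\<in>k ` {..<4}. fiber_mean k c) - of_real (fourth_corr_main k)) = 2 * real p + 1"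
      by (simp only: norm_of_real, simp?)
    also have "\<dots> \<le> 15 * (real p * sqrt p)" using psq p1' by linarith
    also have "\<dots> \<le> (6 * m * sqrt (2 * m) + 15) * (real p * sqrt p)"
      by (intro mult_right_mono) auto
    finally show ?thesis .
  next
    case b
    have X: "k ` {..<4} = {k 0, k 1}" using b by (auto simp: lessThan_4)
    have f: "{i \<in> {..<4}. k i = k 0} = {0, 3}" "{i \<in> {..<4}. k i = k 1} = {1, 2}"
      using b by (auto simp: lessThan_4)
    have "(\<Prod>c\<in>k ` {..<4}. fiber_mean k c) = of_nat (p + 1) * of_nat (p + 1)"
    proof -
      have "(\<Prod>c\<in>k ` {..<4}. fiber_mean k c) = fiber_mean k (k 0) * fiber_mean k (k 1)"
        unfolding X using b(3) by simp
      also have "\<dots> = of_nat (p + 1) * of_nat (p + 1)"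
        unfolding fiber_mean_def f using class_mean_dft_norm by (simp add: dft4_def)
      finally show ?thesis .
    qed
    moreover have "fourth_corr_main k = (real p)\<^sup>2" using b by (simp add: fourth_corr_main_def)
    ultimately have "(\<Prod>c\<in>k ` {..<4}. fiber_mean k c) - of_real (fourth_corr_main k) = of_real (2 * real p + 1)"
      by (simp add: power2_eq_square algebra_simps)
    then have "cmod ((\<Prod>c\<in>k ` {..<4}. fiber_mean k c) - of_real (fourth_corr_main k)) = 2 * real p + 1"
      by (simp only: norm_of_real, simp?)
    also have "\<dots> \<le> 15 * (real p * sqrt p)" using psq p1' by linarith
    also have "\<dots> \<le> (6 * m * sqrt (2 * m) + 15) * (real p * sqrt p)"
      by (intro mult_right_mono) auto
    finally show ?thesis .
  next
    case c
    obtain \<beta> where \<beta>: "class_mean m g (\<lambda>x. dft p a x * dft p a x) = of_real \<beta>" "\<bar>\<beta> - reflection_corr\<bar> \<le> 3"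
      using class_mean_dft_square by blast
    have X: "k ` {..<4} = {k 0, k 2}" using c by (auto simp: lessThan_4)
    have f: "{i \<in> {..<4}. k i = k 0} = {0, 1}" "{i \<in> {..<4}. k i = k 2} = {2, 3}"
      using c by (auto simp: lessThan_4)
    have "class_mean m g (\<lambda>x. cnj (dft p a x) * cnj (dft p a x)) = of_real \<beta>"
      using class_mean_cnj[of m g "\<lambda>x. dft p a x * dft p a x"] \<beta>(1) by simp
    note \<beta>' = this
    have "(\<Prod>c\<in>k ` {..<4}. fiber_mean k c) = fiber_mean k (k 0) * fiber_mean k (k 2)"
      unfolding X using c(3) by simp
    also have "\<dots> = of_real \<beta> * of_real \<beta>"
      unfolding fiber_mean_def f using \<beta>(1) \<beta>' by (simp add: dft4_def)
    finally have "(\<Prod>c\<in>k ` {..<4}. fiber_mean k c) = of_real \<beta> * of_real \<beta>" .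
    moreover have "fourth_corr_main k = reflection_corr\<^sup>2" using c by (simp add: fourth_corr_main_def)
    ultimately have "(\<Prod>c\<in>k ` {..<4}. fiber_mean k c) - of_real (fourth_corr_main k)
        = of_real ((\<beta> - reflection_corr) * (\<beta> + reflection_corr))"
      by (simp add: power2_eq_square algebra_simps)
    then have "cmod ((\<Prod>c\<in>k ` {..<4}. fiber_mean k c) - of_real (fourth_corr_main k)) = \<bar>\<beta> - reflection_corr\<bar> * \<bar>\<beta> + reflection_corr\<bar>"
      by (simp only: norm_of_real abs_mult)
    also have "\<dots> \<le> 3 * (2 * real p + 3)"
      using \<beta>(2) abs_reflection_corr by (intro mult_mono) auto
    also have "\<dots> \<le> 15 * real p" using p1' by simp
    also have "\<dots> \<le> 15 * (real p * sqrt p)" using psq by (rule mult_left_mono) simp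
    also have "\<dots> \<le> (6 * m * sqrt (2 * m) + 15) * (real p * sqrt p)"
      by (intro mult_right_mono) auto
    finally show ?thesis .
  qed
qed

text \<open>A class mean would not help here, since Parseval for \<open>a\<close> says nothing about
  fourth powers; the case is evaluated exactly instead.\<close>

lemma fourth_corr_const:
  assumes "\<And>i. i < 4 \<Longrightarrow> k i = c"
  shows "fourth_corr k = of_real (\<Sum>u\<in>{0..<int p}. (autocorr p a u)\<^sup>2)"
proof -
  define H where "H x = (dft p a x * cnj (dft p a x)) * (dft p a x * cnj (dft p a x))" for x
  have "(\<Prod>i<4. dft4 i (\<kappa> - k i)) = H (\<kappa> + (- c))" for \<kappa>
    using assms by (simp add: lessThan_4 dft4_def H_def mult_ac)
  then have "(\<Sum>\<kappa>\<in>{0..<int p}. \<Prod>i<4. dft4 i (\<kappa> - k i)) = (\<Sum>\<kappa>\<in>{0..<int p}. H (\<kappa> + (- c)))" by simp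
  also have "\<dots> = (\<Sum>\<kappa>\<in>{0..<int p}. H \<kappa>)"
    by (rule sum_residues_add[OF p0]) (simp add: H_def p0)
  also have "\<dots> = of_nat p * of_real (\<Sum>u\<in>{0..<int p}. (autocorr p a u)\<^sup>2)"
    unfolding H_def by (rule sum_norm_dft_power4) (simp_all add: p0 a_mod)
  finally show ?thesis unfolding fourth_corr_def using p0 by simp
qed

end

lemma fourth_corr_estimate:
  assumes "m > 0"
  shows "\<exists>C\<ge>0. \<forall>p g a k. balanced_class_sequence m p g a \<longrightarrow> (\<forall>i<4. k i \<in> {0..<int p}) \<longrightarrow>
    \<not> (k 0 = k 1 \<and> k 0 = k 2 \<and> k 0 = k 3) \<longrightarrow>
    cmod (balanced_class_sequence.fourth_corr p a k - of_real (balanced_class_sequence.fourth_corr_main p a k))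
      \<le> C * (real p * sqrt p)"
proof -
  obtain C where C: "C \<ge> 0" and bound: "\<And>p g a k. balanced_class_sequence m p g a \<Longrightarrow> (\<forall>i<4. k i \<in> {0..<int p}) \<Longrightarrow>
    cmod ((\<Sum>\<kappa>\<in>{0..<int p}. \<Prod>i<4. balanced_class_sequence.dft4 p a i (\<kappa> - k i))
      - of_nat p * (\<Prod>c\<in>k ` {..<4}. balanced_class_sequence.fiber_mean m p g a k c)) \<le> C * (real p)\<^sup>2 * sqrt p"
    using four_point_sum[OF assms] by blast
  define C' where "C' = C + (6 * m * sqrt (2 * m) + 15)"
  have "cmod (balanced_class_sequence.fourth_corr p a k - of_real (balanced_class_sequence.fourth_corr_main p a k))
      \<le> C' * (real p * sqrt p)"
    if a: "balanced_class_sequence m p g a" and k: "\<forall>i<4. k i \<in> {0..<int p}"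
      "\<not> (k 0 = k 1 \<and> k 0 = k 2 \<and> k 0 = k 3)" for p g a and k :: "nat \<Rightarrow> int"
  proof -
    interpret balanced_class_sequence m p g a by (rule a)
    let ?S = "\<Sum>\<kappa>\<in>{0..<int p}. \<Prod>i<4. dft4 i (\<kappa> - k i)" and ?P = "\<Prod>c\<in>k ` {..<4}. fiber_mean k c"
    have "cmod (?S - of_nat p * ?P) \<le> C * (real p)\<^sup>2 * sqrt p" by (rule bound[OF a k(1)])
    moreover have "fourth_corr k - ?P = (?S - of_nat p * ?P) / of_nat p"
      using p0 by (simp add: fourth_corr_def field_simps)
    ultimately have "cmod (fourth_corr k - ?P) \<le> C * (real p)\<^sup>2 * sqrt p / real p"
      using p0 by (simp add: norm_divide divide_right_mono)
    also have "\<dots> = C * (real p * sqrt p)" using p0 by (simp add: power2_eq_square)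
    finally have "cmod (fourth_corr k - ?P) \<le> C * (real p * sqrt p)" .
    then show ?thesis
      using prod_fiber_mean_main[OF k(2)] norm_triangle_ineq[of "fourth_corr k - ?P" "?P - of_real (fourth_corr_main k)"]
      unfolding C'_def by (simp add: algebra_simps)
  qed
  moreover have "C' \<ge> 0" unfolding C'_def using C by simp
  ultimately show ?thesis by blast
qed

section \<open>Additive quadruples in an interval\<close>

text \<open>By concavity the sine lies above its chord on the interval from 0 to pi / 2.\<close>

lemma sin_ge_linear:
  assumes "0 \<le> x" "x \<le> 1 / 2" shows "2 * x \<le> sin (pi * x)"
proof -
  have "convex_on {0..pi} (\<lambda>x. - sin x)"
    by (rule f''_ge0_imp_convex[where f' = "\<lambda>x. - cos x" and f'' = "\<lambda>x. sin x"])
      (auto intro!: derivative_eq_intros sin_ge_zero)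
  then have "- sin ((1 - 2 * x) *\<^sub>R 0 + (2 * x) *\<^sub>R (pi / 2)) \<le> (1 - 2 * x) * - sin 0 + (2 * x) * - sin (pi / 2)"
    using assms by (intro convex_onD) auto
  then show ?thesis by (simp add: mult.commute)
qed

lemma sin_ge_min:
  assumes "0 \<le> x" "x \<le> 1" shows "2 * min x (1 - x) \<le> sin (pi * x)"
proof (cases "x \<le> 1 / 2")
  case True
  then show ?thesis using sin_ge_linear[of x] assms by (simp add: min_def)
next
  case False
  have "sin (pi * (1 - x)) = sin (pi * x)" by (simp add: algebra_simps sin_diff)
  then show ?thesis using sin_ge_linear[of "1 - x"] assms False by (simp add: min_def)
qed

definition dirichlet_sum :: "nat \<Rightarrow> real \<Rightarrow> complex" where
  "dirichlet_sum t x = (\<Sum>j<t. cis (2 * pi * x * real j))"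

lemma norm_dirichlet_sum_le: "cmod (dirichlet_sum t x) \<le> real t"
  unfolding dirichlet_sum_def by (rule order_trans[OF norm_sum]) simp

lemma dirichlet_sum_minus: "dirichlet_sum t (- x) = cnj (dirichlet_sum t x)"
  by (simp add: dirichlet_sum_def cis_cnj)

lemma dirichlet_sum_add_int: "dirichlet_sum t (x + of_int n) = dirichlet_sum t x"
proof -
  have "cis (2 * pi * (x + of_int n) * real j) = cis (2 * pi * x * real j)" for j
  proof -
    have "cis (2 * pi * (x + of_int n) * real j) = cis (2 * pi * x * real j) * cis (2 * pi * of_int (n * int j))"
      by (simp add: cis_mult algebra_simps)
    then show ?thesis by (simp only: cis_multiple_2pi[OF Ints_of_int] mult_1_right)
  qed
  then show ?thesis by (simp add: dirichlet_sum_def)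
qed

text \<open>The geometric series is at most 2 / |1 - z|, and |1 - z| = 2 sin (pi x) is at least four
  times the distance of x to the nearest integer. The sum of the two reciprocals replaces the
  maximum, so that it can be summed over a grid.\<close>

lemma norm_dirichlet_sum_le_inverse:
  assumes "0 < x" "x < 1"
  shows "cmod (dirichlet_sum t x) \<le> (1 / x + 1 / (1 - x)) / 2"
proof -
  let ?z = "cis (2 * pi * x)"
  have "dirichlet_sum t x = (\<Sum>j<t. ?z ^ j)"
    unfolding dirichlet_sum_def by (intro sum.cong refl) (simp add: Complex.DeMoivre mult.commute)
  then have "(1 - ?z) * dirichlet_sum t x = 1 - ?z ^ t"
    by (simp add: one_diff_power_eq)
  then have "cmod (1 - ?z) * cmod (dirichlet_sum t x) = cmod (1 - ?z ^ t)" by (metis norm_mult)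
  also have "\<dots> \<le> 2"
    using norm_triangle_ineq4[of 1 "?z ^ t"] by (simp add: norm_power)
  finally have 1: "cmod (1 - ?z) * cmod (dirichlet_sum t x) \<le> 2" .
  have 2: "cmod (1 - ?z) = 2 * sin (pi * x)"
  proof -
    have "(cmod (1 - ?z))\<^sup>2 = (1 - cos (2 * (pi * x)))\<^sup>2 + (sin (2 * (pi * x)))\<^sup>2"
      by (simp add: cmod_power2 mult.assoc)
    also have "\<dots> = (2 * sin (pi * x))\<^sup>2"
      unfolding cos_double_sin sin_double
    proof -
      define S C where "S = sin (pi * x)" and "C = cos (pi * x)"
      have "(1 - (1 - 2 * S\<^sup>2))\<^sup>2 + (2 * S * C)\<^sup>2 = 4 * S\<^sup>2 * (S\<^sup>2 + C\<^sup>2)"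
        by (simp add: power2_eq_square algebra_simps)
      also have "S\<^sup>2 + C\<^sup>2 = 1" unfolding S_def C_def by (rule sin_cos_squared_add)
      finally have "(1 - (1 - 2 * S\<^sup>2))\<^sup>2 + (2 * S * C)\<^sup>2 = (2 * S)\<^sup>2" by (simp add: power2_eq_square)
      then show "(1 - (1 - 2 * (sin (pi * x))\<^sup>2))\<^sup>2 + (2 * sin (pi * x) * cos (pi * x))\<^sup>2 = (2 * sin (pi * x))\<^sup>2"
        unfolding S_def C_def .
    qed
    finally show ?thesis
      using assms by (intro power2_eq_imp_eq[of "cmod (1 - ?z)"]) (auto intro!: sin_ge_zero mult_nonneg_nonneg)
  qed
  define \<mu> where "\<mu> = min x (1 - x)"
  have \<mu>: "\<mu> > 0" using assms by (simp add: \<mu>_def)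
  have "4 * \<mu> \<le> 2 * sin (pi * x)" using sin_ge_min[of x] assms unfolding \<mu>_def by simp
  then have "4 * \<mu> * cmod (dirichlet_sum t x) \<le> 2"
    using 1 unfolding 2 by (meson mult_right_mono norm_ge_zero order_trans)
  then have "cmod (dirichlet_sum t x) \<le> 1 / \<mu> / 2" using \<mu> by (simp add: field_simps)
  also have "1 / \<mu> \<le> 1 / x + 1 / (1 - x)" using assms by (auto simp: \<mu>_def min_def)
  finally show ?thesis by simp
qed

lemma harm_le: "n > 0 \<Longrightarrow> harm n \<le> ln (real n) + 1"
  using decseqD[OF decseq_harm_diff_ln, of 0 "n - 1"] by (simp add: harm_def)

text \<open>By periodicity the grid may be moved to the points z + k / p with 0 <= z < 1 / p. Only k
  = 0 and k = p - 1 can come arbitrarily close to an integer and receive the trivial bound t; the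
  others give harmonic sums.\<close>

lemma sum_norm_dirichlet_sum_le:
  fixes p t :: nat
  assumes p: "p > 0"
  shows "(\<Sum>k\<in>{0..<int p}. cmod (dirichlet_sum t (y + of_int k / of_nat p))) \<le> 2 * real t + real p * (1 + ln p)"
proof -
  define s where "s = \<lfloor>y * p\<rfloor>"
  define z where "z = y - of_int s / of_nat p"
  define f where "f k = cmod (dirichlet_sum t (z + of_int k / of_nat p))" for k :: int
  have z: "0 \<le> z" "z < 1 / p"
  proof -
    have "z = (y * p - of_int s) / p" using p by (simp add: z_def field_simps)
    moreover have "0 \<le> y * p - of_int s" "y * p - of_int s < 1" unfolding s_def by linarith+
    ultimately show "0 \<le> z" "z < 1 / p" using p by (simp_all add: divide_strict_right_mono)
  qed
  have f_mod: "f (k mod int p) = f k" for k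
  proof -
    have "real_of_int k = of_int (k mod int p) + of_nat p * of_int (k div int p)"
      by (metis mult_div_mod_eq add.commute of_int_add of_int_mult of_int_of_nat_eq)
    then have "z + of_int k / of_nat p = z + of_int (k mod int p) / of_nat p + of_int (k div int p)"
      using p by (simp add: field_simps)
    then show ?thesis unfolding f_def using dirichlet_sum_add_int by metis
  qed
  have "(\<Sum>k\<in>{0..<int p}. cmod (dirichlet_sum t (y + of_int k / of_nat p))) = (\<Sum>k\<in>{0..<int p}. f (k + s))"
    unfolding f_def z_def by (simp add: add_divide_distrib)
  also have "\<dots> = (\<Sum>k\<in>{0..<int p}. f k)" by (rule sum_residues_add[of p f]) (simp_all add: p f_mod)
  also have "\<dots> = (\<Sum>k<p. f (int k))"
    by (rule sum.reindex_bij_witness[of _ int nat]) auto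
  \<comment> \<open>For 0 < k < p - 1 the point x = z + k / p satisfies 1 / x <= p / k and 1 / (1 -
    x) <= p / (p - 1 - k). The reflection of k to p - 1 - k identifies the two resulting
    sums.\<close>
  also have "\<dots> \<le> (\<Sum>k<p. (if k = 0 then real t else 0) + (if k = p - 1 then real t else 0)
      + (if k = 0 then 0 else p / (2 * real k)) + (if k = p - 1 then 0 else p / (2 * real (p - 1 - k))))"
  proof (rule sum_mono)
    fix k assume "k \<in> {..<p}"
    then have k: "k < p" by simp
    show "f (int k) \<le> (if k = 0 then real t else 0) + (if k = p - 1 then real t else 0)
      + (if k = 0 then 0 else p / (2 * real k)) + (if k = p - 1 then 0 else p / (2 * real (p - 1 - k)))"
    proof (cases "k = 0 \<or> k = p - 1")
      case True
      have "f (int k) \<le> real t" unfolding f_def by (rule norm_dirichlet_sum_le)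
      moreover have "real t \<le> (if k = 0 then real t else 0) + (if k = p - 1 then real t else 0)"
        using True by auto
      moreover have "0 \<le> (if k = 0 then 0 else p / (2 * real k))"
        "0 \<le> (if k = p - 1 then 0 else p / (2 * real (p - 1 - k)))" by (simp_all del: of_nat_diff)
      ultimately show ?thesis by linarith
    next
      case False
      define x where "x = z + of_int (int k) / of_nat p"
      have x: "real k / p \<le> x" "x < real (Suc k) / p"
        using z unfolding x_def by (simp_all add: add_divide_distrib)
      have kp: "real k / p > 0" using False p by simp
      have "Suc k < p" using False k by auto
      then have "real (Suc k) < real p" by (subst of_nat_less_iff)
      then have sk: "real (Suc k) / p < 1" using p by simp
      have "f (int k) \<le> (1 / x + 1 / (1 - x)) / 2"
        unfolding f_def x_def[symmetric] using x kp sk by (intro norm_dirichlet_sum_le_inverse) linarith+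
      also have "\<dots> \<le> (1 / (real k / p) + 1 / (1 - real (Suc k) / p)) / 2"
        using x kp sk by (intro divide_right_mono add_mono divide_left_mono mult_pos_pos) auto
      also have "1 - real (Suc k) / p = real (p - 1 - k) / p"
        using p k by (simp add: field_simps of_nat_diff)
      finally show ?thesis using False by (simp add: add_divide_distrib mult.commute)
    qed
  qed
  also have "\<dots> = 2 * real t + 2 * (\<Sum>k<p. if k = 0 then 0 else p / (2 * real k))"
  proof -
    have "(\<Sum>k<p. if k = p - 1 then 0 else p / (2 * real (p - 1 - k))) = (\<Sum>k<p. if k = 0 then 0 else p / (2 * real k))"
      by (rule sum.reindex_bij_witness[of _ "\<lambda>k. p - 1 - k" "\<lambda>k. p - 1 - k"]) auto
    moreover have "(\<Sum>k<p. if k = 0 then real t else 0) = real t" using p by (simp add: sum.delta)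
    moreover have "(\<Sum>k<p. if k = p - 1 then real t else 0) = real t" using p by (simp add: sum.delta)
    ultimately show ?thesis by (simp only: sum.distrib)
  qed
  also have "2 * (\<Sum>k<p. if k = 0 then 0 else p / (2 * real k)) \<le> real p * harm p"
  proof -
    have "(\<Sum>k<p. if k = 0 then 0 else p / (2 * real k)) \<le> (\<Sum>k=1..p. p / (2 * real k))"
      by (rule order_trans[OF sum_mono2[of "{..p}"]], simp, force, simp)
        (simp add: atMost_atLeast0 sum.atLeast_Suc_atMost)
    also have "2 * \<dots> = real p * harm p"
      by (simp add: harm_def sum_distrib_left field_simps)
    finally show ?thesis by simp
  qed
  also have "real p * harm p \<le> real p * (1 + ln p)"
    using harm_le[OF p] p by (intro mult_left_mono) auto
  finally show ?thesis by simp
qed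

section \<open>The Fourier kernel of additive quadruples\<close>

definition sgn4 :: "nat \<Rightarrow> int" where
  "sgn4 i = (if i < 2 then 1 else -1)"

text \<open>Quadruples are extensional functions, so that \<open>prod_sum_PiE\<close> expands a
  product of four sums over them.\<close>

definition quads :: "nat \<Rightarrow> (nat \<Rightarrow> nat) set" where
  "quads t = {j \<in> PiE {..<4} (\<lambda>_. {..<t}). j 0 + j 1 = j 2 + j 3}"

lemma finite_quads [simp]: "finite (quads t)"
  unfolding quads_def by (rule finite_subset[of _ "PiE {..<4} (\<lambda>_. {..<t})"]) (auto intro: finite_PiE)

lemma sum_sgn4: "(\<Sum>i<4. sgn4 i * f i) = f 0 + f 1 - f 2 - f 3"
  by (simp add: sgn4_def numeral_eq_Suc)

lemma unity_sum: "finite A \<Longrightarrow> unity p (\<Sum>i\<in>A. f i) = (\<Prod>i\<in>A. unity p (f i))"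
  by (induction A rule: finite_induct) (simp_all add: unity_add)

text \<open>The modulus $2t+1$ exceeds $|j_0+j_1-j_2-j_3|$, so a congruence is an equality.\<close>

lemma quads_indicator:
  assumes j: "j \<in> PiE {..<4} (\<lambda>_. {..<t})"
  shows "(\<Sum>\<theta>\<in>{0..<int (2 * t + 1)}. \<Prod>i<4. unity (2 * t + 1) (\<theta> * (sgn4 i * int (j i)))) / of_nat (2 * t + 1) =
    (if j \<in> quads t then 1 else 0)"
proof -
  have b: "j i < t" if "i < 4" for i using j that by auto
  have "(\<Sum>\<theta>\<in>{0..<int (2 * t + 1)}. \<Prod>i<4. unity (2 * t + 1) (\<theta> * (sgn4 i * int (j i)))) =
      (\<Sum>\<theta>\<in>{0..<int (2 * t + 1)}. unity (2 * t + 1) (\<theta> * (\<Sum>i<4. sgn4 i * int (j i))))"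
    unfolding sum_distrib_left by (simp add: unity_sum)
  also have "\<dots> = (if int (2 * t + 1) dvd (\<Sum>i<4. sgn4 i * int (j i)) then of_nat (2 * t + 1) else 0)"
    by (rule sum_unity) simp
  also have "(\<Sum>i<4. sgn4 i * int (j i)) = int (j 0) + int (j 1) - int (j 2) - int (j 3)" by (rule sum_sgn4)
  also have "int (2 * t + 1) dvd int (j 0) + int (j 1) - int (j 2) - int (j 3) \<longleftrightarrow> j 0 + j 1 = j 2 + j 3"
  proof
    assume d: "int (2 * t + 1) dvd int (j 0) + int (j 1) - int (j 2) - int (j 3)"
    have "\<bar>int (j 0) + int (j 1) - int (j 2) - int (j 3)\<bar> < int (2 * t + 1)"
      using b[of 0] b[of 1] b[of 2] b[of 3] by simp
    then have "int (j 0) + int (j 1) - int (j 2) - int (j 3) = 0"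
      using d by (metis dvd_imp_le_int abs_of_nat not_le)
    then show "j 0 + j 1 = j 2 + j 3" by linarith
  next
    assume "j 0 + j 1 = j 2 + j 3"
    then have "int (j 0) + int (j 1) - int (j 2) - int (j 3) = 0" by linarith
    then show "int (2 * t + 1) dvd int (j 0) + int (j 1) - int (j 2) - int (j 3)" by simp
  qed
  also have "(if j 0 + j 1 = j 2 + j 3 then of_nat (2 * t + 1) else 0) / of_nat (2 * t + 1) =
      (if j \<in> quads t then 1 else (0::complex))"
    using j by (simp add: quads_def del: of_nat_Suc of_nat_add)
  finally show ?thesis .
qed

definition quad_kernel :: "nat \<Rightarrow> nat \<Rightarrow> int \<Rightarrow> (nat \<Rightarrow> int) \<Rightarrow> complex" where
  "quad_kernel p t r k = (\<Sum>j\<in>quads t. \<Prod>i<4. unity p (sgn4 i * k i * (int (j i) + r)))"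

text \<open>A common shift \<kappa> contributes the character value at \<kappa> times the signed sum
  of the j_i + r. The signs add up to 0, so r cancels, and the rest vanishes on
  \<open>quads t\<close>.\<close>

lemma quad_kernel_shift:
  assumes "p > 0"
  shows "quad_kernel p t r (\<lambda>i\<in>{..<4}. (k i + \<kappa>) mod int p) = quad_kernel p t r k"
  unfolding quad_kernel_def
proof (rule sum.cong[OF refl])
  fix j assume j: "j \<in> quads t"
  have "(\<Prod>i<4. unity p (sgn4 i * (\<lambda>i\<in>{..<4}. (k i + \<kappa>) mod int p) i * (int (j i) + r)))
     = (\<Prod>i<4. unity p (sgn4 i * k i * (int (j i) + r)) * unity p (\<kappa> * (sgn4 i * (int (j i) + r))))"
  proof (rule prod.cong[OF refl])
    fix i :: nat assume i: "i \<in> {..<4}"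
    have "unity p (sgn4 i * ((k i + \<kappa>) mod int p) * (int (j i) + r)) = unity p ((k i + \<kappa>) mod int p * (sgn4 i * (int (j i) + r)))"
      by (simp add: mult_ac)
    also have "\<dots> = unity p ((k i + \<kappa>) * (sgn4 i * (int (j i) + r)))"
      by (rule unity_mult_mod[OF assms])
    also have "\<dots> = unity p (sgn4 i * k i * (int (j i) + r)) * unity p (\<kappa> * (sgn4 i * (int (j i) + r)))"
      by (simp add: algebra_simps flip: unity_add)
    finally show "unity p (sgn4 i * (\<lambda>i\<in>{..<4}. (k i + \<kappa>) mod int p) i * (int (j i) + r)) =
      unity p (sgn4 i * k i * (int (j i) + r)) * unity p (\<kappa> * (sgn4 i * (int (j i) + r)))"
      using i by simp
  qed
  also have "\<dots> = (\<Prod>i<4. unity p (sgn4 i * k i * (int (j i) + r))) * unity p (\<kappa> * (\<Sum>i<4. sgn4 i * (int (j i) + r)))"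
    by (simp add: prod.distrib unity_sum sum_distrib_left)
  also have "(\<Sum>i<4. sgn4 i * (int (j i) + r)) = 0"
    unfolding sum_sgn4 using j by (simp add: quads_def algebra_simps flip: of_nat_add)
  finally show "(\<Prod>i<4. unity p (sgn4 i * (\<lambda>i\<in>{..<4}. (k i + \<kappa>) mod int p) i * (int (j i) + r))) =
      (\<Prod>i<4. unity p (sgn4 i * k i * (int (j i) + r)))" by simp
qed

lemma norm_quad_factor:
  "cmod (\<Sum>j<t. unity N (\<theta> * (\<epsilon> * int j)) * unity p (\<epsilon> * k * (int j + r)))
     = cmod (dirichlet_sum t (of_int \<theta> / of_nat N + of_int k / of_nat p))" if "\<epsilon> = 1 \<or> \<epsilon> = -1"
proof -
  let ?x = "of_int \<theta> / of_nat N + of_int k / of_nat p :: real"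
  have "unity N (\<theta> * (\<epsilon> * int j)) * unity p (\<epsilon> * k * (int j + r)) =
    unity p (\<epsilon> * k * r) * cis (2 * pi * (of_int \<epsilon> * ?x) * real j)" for j
    by (simp add: unity_def cis_mult ring_distribs add_divide_distrib mult_ac add_ac)
  then have "cmod (\<Sum>j<t. unity N (\<theta> * (\<epsilon> * int j)) * unity p (\<epsilon> * k * (int j + r))) =
    cmod (dirichlet_sum t (of_int \<epsilon> * ?x))"
    by (simp add: dirichlet_sum_def norm_mult flip: sum_distrib_left)
  moreover have "cmod (dirichlet_sum t (of_int \<epsilon> * ?x)) = cmod (dirichlet_sum t ?x)"
    using that dirichlet_sum_minus[of t ?x] by auto
  ultimately show ?thesis by simp
qed

text \<open>Expanding the indicator of \<open>quads t\<close> in characters modulo N separates the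
  four coordinates: for each \<theta> the sum over k factors into four sums of Dirichlet sums, each
  bounded uniformly in \<theta>.\<close>

lemma sum_norm_quad_kernel_le:
  fixes p t :: nat
  assumes p: "p > 0"
  shows "(\<Sum>k\<in>PiE {..<4} (\<lambda>_. {0..<int p}). cmod (quad_kernel p t r k)) \<le> (2 * real t + real p * (1 + ln p)) ^ 4"
proof -
  define N where "N = 2 * t + 1"
  define L where "L = 2 * real t + real p * (1 + ln p)"
  let ?J = "PiE {..<4::nat} (\<lambda>_. {..<t})" and ?K = "PiE {..<4::nat} (\<lambda>_. {0..<int p})"
  have finJ: "finite ?J" by (intro finite_PiE) auto
  let ?F = "\<lambda>\<theta> i k. \<Sum>j<t. unity N (\<theta> * (sgn4 i * int j)) * unity p (sgn4 i * k * (int j + r))"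
  have W: "quad_kernel p t r k = (\<Sum>\<theta>\<in>{0..<int N}. \<Prod>i<4. ?F \<theta> i (k i)) / of_nat N" for k
  proof -
    let ?u = "\<lambda>j. \<Prod>i<4. unity p (sgn4 i * k i * (int (j i) + r))"
    have "quad_kernel p t r k = (\<Sum>j\<in>?J. if j \<in> quads t then ?u j else 0)"
      unfolding quad_kernel_def using finJ by (subst sum.inter_filter[symmetric]) (auto simp: quads_def intro: sum.cong)
    also have "\<dots> = (\<Sum>j\<in>?J. (\<Sum>\<theta>\<in>{0..<int N}. \<Prod>i<4. unity N (\<theta> * (sgn4 i * int (j i)))) / of_nat N * ?u j)"
      unfolding N_def by (intro sum.cong refl) (simp only: quads_indicator, simp)
    also have "\<dots> = (\<Sum>j\<in>?J. \<Sum>\<theta>\<in>{0..<int N}. \<Prod>i<4. unity N (\<theta> * (sgn4 i * int (j i))) * unity p (sgn4 i * k i * (int (j i) + r))) / of_nat N"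
      by (simp add: sum_divide_distrib sum_distrib_right prod.distrib)
    also have "\<dots> = (\<Sum>\<theta>\<in>{0..<int N}. \<Sum>j\<in>?J. \<Prod>i<4. unity N (\<theta> * (sgn4 i * int (j i))) * unity p (sgn4 i * k i * (int (j i) + r))) / of_nat N"
      by (subst sum.swap) simp
    also have "\<dots> = (\<Sum>\<theta>\<in>{0..<int N}. \<Prod>i<4. ?F \<theta> i (k i)) / of_nat N"
      by (subst prod_sum_PiE) simp_all
    finally show ?thesis .
  qed
  have F: "(\<Sum>k\<in>{0..<int p}. cmod (?F \<theta> i k)) \<le> L" for \<theta> i
  proof -
    have "cmod (?F \<theta> i k) = cmod (dirichlet_sum t (of_int \<theta> / of_nat N + of_int k / of_nat p))" for k
      by (rule norm_quad_factor) (simp add: sgn4_def)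
    then show ?thesis unfolding L_def using sum_norm_dirichlet_sum_le[OF p] by simp
  qed
  have "(\<Sum>k\<in>?K. cmod (quad_kernel p t r k)) \<le> (\<Sum>k\<in>?K. (\<Sum>\<theta>\<in>{0..<int N}. \<Prod>i<4. cmod (?F \<theta> i (k i))) / N)"
  proof (rule sum_mono)
    fix k
    have "cmod (\<Sum>\<theta>\<in>{0..<int N}. \<Prod>i<4. ?F \<theta> i (k i)) \<le> (\<Sum>\<theta>\<in>{0..<int N}. \<Prod>i<4. cmod (?F \<theta> i (k i)))"
      by (rule order_trans[OF norm_sum]) (simp add: prod_norm)
    then show "cmod (quad_kernel p t r k) \<le> (\<Sum>\<theta>\<in>{0..<int N}. \<Prod>i<4. cmod (?F \<theta> i (k i))) / N"
      unfolding W by (simp add: norm_divide divide_right_mono del: of_nat_Suc of_nat_add)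
  qed
  also have "\<dots> = (\<Sum>\<theta>\<in>{0..<int N}. \<Sum>k\<in>?K. \<Prod>i<4. cmod (?F \<theta> i (k i))) / N"
    by (subst sum.swap) (simp add: sum_divide_distrib)
  also have "\<dots> = (\<Sum>\<theta>\<in>{0..<int N}. \<Prod>i<4::nat. \<Sum>k\<in>{0..<int p}. cmod (?F \<theta> i k)) / N"
    by (subst prod_sum_PiE) simp_all
  also have "\<dots> \<le> (\<Sum>\<theta>\<in>{0..<int N}. \<Prod>i<4::nat. L) / N"
    using F by (intro divide_right_mono sum_mono prod_mono conjI sum_nonneg) auto
  also have "\<dots> = L ^ 4" by (simp add: N_def)
  finally show ?thesis unfolding L_def .
qed

lemma sum_two_valued:
  fixes p :: nat
  assumes A: "\<alpha> \<in> A" "A \<subseteq> {..<4}" "\<gamma> \<in> {..<4} - A"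
  shows "(\<Sum>k\<in>PiE {..<4::nat} (\<lambda>_. {0..<int p}). if \<forall>i<4. k i = (if i \<in> A then k \<alpha> else k \<gamma>) then H k else 0)
    = (\<Sum>(u, v)\<in>{0..<int p} \<times> {0..<int p}. H (\<lambda>i\<in>{..<4}. if i \<in> A then u else v))"
proof -
  let ?K = "PiE {..<4::nat} (\<lambda>_. {0..<int p})"
  have "finite ?K" by (intro finite_PiE) auto
  then have "(\<Sum>k\<in>?K. if \<forall>i<4. k i = (if i \<in> A then k \<alpha> else k \<gamma>) then H k else 0) =
      (\<Sum>k\<in>{k \<in> ?K. \<forall>i<4. k i = (if i \<in> A then k \<alpha> else k \<gamma>)}. H k)"
    by (rule sum.inter_filter[symmetric])
  also have "\<dots> = (\<Sum>(u, v)\<in>{0..<int p} \<times> {0..<int p}. H (\<lambda>i\<in>{..<4}. if i \<in> A then u else v))"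
  proof (rule sum.reindex_bij_witness[of _ "\<lambda>(u, v). \<lambda>i\<in>{..<4}. if i \<in> A then u else v" "\<lambda>k. (k \<alpha>, k \<gamma>)"])
    fix k assume k: "k \<in> {k \<in> ?K. \<forall>i<4. k i = (if i \<in> A then k \<alpha> else k \<gamma>)}"
    then have kK: "k \<in> ?K" and kv: "\<forall>i<4. k i = (if i \<in> A then k \<alpha> else k \<gamma>)" by simp_all
    have "(\<lambda>i\<in>{..<4}. if i \<in> A then k \<alpha> else k \<gamma>) = k"
    proof
      fix i
      show "(\<lambda>i\<in>{..<4}. if i \<in> A then k \<alpha> else k \<gamma>) i = k i"
      proof (cases "i < 4")
        case True
        with kv have "k i = (if i \<in> A then k \<alpha> else k \<gamma>)" by blast
        moreover have "(\<lambda>i\<in>{..<4}. if i \<in> A then k \<alpha> else k \<gamma>) i = (if i \<in> A then k \<alpha> else k \<gamma>)"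
          using True by (intro restrict_apply') simp
        ultimately show ?thesis by (rule trans[OF _ sym, rotated])
      next
        case False
        with kK show ?thesis by (simp add: PiE_def extensional_def)
      qed
    qed
    then show "(case (k \<alpha>, k \<gamma>) of (u, v) \<Rightarrow> \<lambda>i\<in>{..<4}. if i \<in> A then u else v) = k"
      "(case (k \<alpha>, k \<gamma>) of (u, v) \<Rightarrow> H (\<lambda>i\<in>{..<4}. if i \<in> A then u else v)) = H k" by simp_all
    show "(k \<alpha>, k \<gamma>) \<in> {0..<int p} \<times> {0..<int p}" using kK A by (auto simp del: atLeastLessThan_iff)
  next
    fix b assume b: "b \<in> {0..<int p} \<times> {0..<int p}"
    obtain u v where uv: "b = (u, v)" by (cases b)
    define f where "f = (\<lambda>i\<in>{..<4}. if i \<in> A then u else v)"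
    have f: "f i = (if i \<in> A then u else v)" if "i < 4" for i using that by (simp add: f_def)
    have \<alpha>: "\<alpha> < 4" and \<gamma>: "\<gamma> < 4" "\<gamma> \<notin> A" using A by auto
    have "f \<alpha> = u" "f \<gamma> = v" using f[OF \<alpha>] f[OF \<gamma>(1)] A \<gamma> by simp_all
    moreover from this have "\<forall>i<4. f i = (if i \<in> A then f \<alpha> else f \<gamma>)" using f by simp
    moreover have "f \<in> ?K" using b uv by (auto simp: f_def)
    ultimately show "((case b of (u, v) \<Rightarrow> \<lambda>i\<in>{..<4}. if i \<in> A then u else v) \<alpha>,
        (case b of (u, v) \<Rightarrow> \<lambda>i\<in>{..<4}. if i \<in> A then u else v) \<gamma>) = b"
      and "(case b of (u, v) \<Rightarrow> \<lambda>i\<in>{..<4}. if i \<in> A then u else v)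
        \<in> {k \<in> ?K. \<forall>i<4. k i = (if i \<in> A then k \<alpha> else k \<gamma>)}"
      unfolding uv prod.case f_def[symmetric] by blast+
  qed
  finally show ?thesis .
qed

definition quads_dvd :: "nat \<Rightarrow> nat \<Rightarrow> int \<Rightarrow> nat set \<Rightarrow> (nat \<Rightarrow> nat) set" where
  "quads_dvd p t r A = {j \<in> quads t. int p dvd (\<Sum>i\<in>A. sgn4 i * (int (j i) + r))}"

text \<open>On a quadruple the signed sum over the complement of A is the negative of the one over
  A. The summations over u and v therefore impose the same divisibility, and each gives a factor
  p.\<close>

lemma sum_quad_kernel_two_valued:
  assumes p: "p > 0" and A: "\<alpha> \<in> A" "A \<subseteq> {..<4}" "\<gamma> \<in> {..<4} - A"
  shows "(\<Sum>k\<in>PiE {..<4} (\<lambda>_. {0..<int p}). if \<forall>i<4. k i = (if i \<in> A then k \<alpha> else k \<gamma>) then quad_kernel p t r k else 0)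
    = of_nat (p\<^sup>2 * card (quads_dvd p t r A))"
proof -
  have fin: "finite A" using A(2) finite_subset by blast
  define s where "s j = (\<Sum>i\<in>A. sgn4 i * (int (j i) + r))" for j
  have W: "quad_kernel p t r (\<lambda>i\<in>{..<4}. if i \<in> A then u else v) = (\<Sum>j\<in>quads t. unity p (u * s j) * unity p (v * (- s j)))" for u v
    unfolding quad_kernel_def
  proof (rule sum.cong[OF refl])
    fix j assume j: "j \<in> quads t"
    let ?x = "\<lambda>i. sgn4 i * (int (j i) + r)"
    have "(\<Sum>i<4. ?x i) = 0"
      unfolding sum_sgn4 using j by (simp add: quads_def algebra_simps flip: of_nat_add)
    moreover have "(\<Sum>i<4. ?x i) = (\<Sum>i\<in>{..<4} - A. ?x i) + s j"
      unfolding s_def by (rule sum.subset_diff[OF A(2)]) simp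
    ultimately have neg: "(\<Sum>i\<in>{..<4} - A. ?x i) = - s j" by simp
    have "(\<Prod>i<4. unity p (sgn4 i * (\<lambda>i\<in>{..<4}. if i \<in> A then u else v) i * (int (j i) + r)))
      = unity p (\<Sum>i<4. (if i \<in> A then u else v) * ?x i)"
      by (simp add: unity_sum mult_ac)
    also have "(\<Sum>i<4. (if i \<in> A then u else v) * ?x i) =
        (\<Sum>i\<in>{..<4} - A. (if i \<in> A then u else v) * ?x i) + (\<Sum>i\<in>A. (if i \<in> A then u else v) * ?x i)"
      by (rule sum.subset_diff[OF A(2)]) simp
    also have "(\<Sum>i\<in>A. (if i \<in> A then u else v) * ?x i) = u * s j"
      unfolding s_def sum_distrib_left by (rule sum.cong) auto
    also have "(\<Sum>i\<in>{..<4} - A. (if i \<in> A then u else v) * ?x i) = v * (- s j)"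
      unfolding neg[symmetric] sum_distrib_left by (rule sum.cong) auto
    finally show "(\<Prod>i<4. unity p (sgn4 i * (\<lambda>i\<in>{..<4}. if i \<in> A then u else v) i * (int (j i) + r)))
      = unity p (u * s j) * unity p (v * (- s j))"
      unfolding unity_add by (simp only: mult.commute)
  qed
  have "(\<Sum>k\<in>PiE {..<4} (\<lambda>_. {0..<int p}). if \<forall>i<4. k i = (if i \<in> A then k \<alpha> else k \<gamma>) then quad_kernel p t r k else 0)
      = (\<Sum>u\<in>{0..<int p}. \<Sum>v\<in>{0..<int p}. \<Sum>j\<in>quads t. unity p (u * s j) * unity p (v * (- s j)))"
    unfolding sum_two_valued[OF A] W by (rule sum.cartesian_product[symmetric])
  also have "\<dots> = (\<Sum>u\<in>{0..<int p}. \<Sum>j\<in>quads t. \<Sum>v\<in>{0..<int p}. unity p (u * s j) * unity p (v * (- s j)))"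
    by (intro sum.cong refl sum.swap)
  also have "\<dots> = (\<Sum>j\<in>quads t. \<Sum>u\<in>{0..<int p}. \<Sum>v\<in>{0..<int p}. unity p (u * s j) * unity p (v * (- s j)))"
    by (rule sum.swap)
  also have "\<dots> = (\<Sum>j\<in>quads t. (\<Sum>u\<in>{0..<int p}. unity p (u * s j)) * (\<Sum>v\<in>{0..<int p}. unity p (v * (- s j))))"
    by (simp only: sum_product)
  also have "\<dots> = (\<Sum>j\<in>quads t. if int p dvd s j then of_nat (p\<^sup>2) else 0)"
    unfolding sum_unity[OF p] by (intro sum.cong refl) (simp add: power2_eq_square)
  also have "\<dots> = of_nat (p\<^sup>2 * card (quads_dvd p t r A))"
    by (simp add: sum.inter_filter[symmetric] quads_dvd_def s_def mult.commute)
  finally show ?thesis .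
qed

lemma sum_quad_kernel_const:
  assumes p: "p > 0"
  shows "(\<Sum>k\<in>PiE {..<4} (\<lambda>_. {0..<int p}). if k 0 = k 1 \<and> k 0 = k 2 \<and> k 0 = k 3 then quad_kernel p t r k else 0)
    = of_nat (p * card (quads t))"
proof -
  let ?K = "PiE {..<4::nat} (\<lambda>_. {0..<int p})"
  have "finite ?K" by (intro finite_PiE) auto
  then have "(\<Sum>k\<in>?K. if k 0 = k 1 \<and> k 0 = k 2 \<and> k 0 = k 3 then quad_kernel p t r k else 0) =
      (\<Sum>k\<in>{k \<in> ?K. k 0 = k 1 \<and> k 0 = k 2 \<and> k 0 = k 3}. quad_kernel p t r k)"
    by (rule sum.inter_filter[symmetric])
  also have "\<dots> = (\<Sum>c\<in>{0..<int p}. quad_kernel p t r (\<lambda>i\<in>{..<4}. c))"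
  proof (rule sum.reindex_bij_witness[of _ "\<lambda>c. \<lambda>i\<in>{..<4}. c" "\<lambda>k. k 0"])
    fix k assume k: "k \<in> {k \<in> ?K. k 0 = k 1 \<and> k 0 = k 2 \<and> k 0 = k 3}"
    then have ext: "k \<in> extensional {..<4}" by (auto simp: PiE_def)
    show "(\<lambda>i\<in>{..<4}. k 0) = k"
    proof
      fix i :: nat
      show "(\<lambda>i\<in>{..<4}. k 0) i = k i"
      proof (cases "i < 4")
        case True
        then have "i = 0 \<or> i = 1 \<or> i = 2 \<or> i = 3" by linarith
        moreover from k have "k 1 = k 0" "k 2 = k 0" "k 3 = k 0" by simp_all
        ultimately have "k i = k 0" by (elim disjE) (simp_all only:)
        then show ?thesis using True by (simp only: restrict_apply lessThan_iff if_True)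
      qed (use ext in \<open>auto simp: extensional_def\<close>)
    qed
    then show "quad_kernel p t r (\<lambda>i\<in>{..<4}. k 0) = quad_kernel p t r k" by simp
    from k have "k \<in> ?K" by simp
    then show "k 0 \<in> {0..<int p}" by (rule PiE_mem) simp
  next
    fix c assume "c \<in> {0..<int p}"
    then show "(\<lambda>i\<in>{..<4::nat}. c) 0 = c" "(\<lambda>i\<in>{..<4::nat}. c) \<in> {k \<in> ?K. k 0 = k 1 \<and> k 0 = k 2 \<and> k 0 = k 3}"
      by simp_all
  qed
  also have "\<dots> = (\<Sum>c\<in>{0..<int p}. of_nat (card (quads t)))"
  proof (rule sum.cong[OF refl])
    fix c
    have "(\<Prod>i<4. unity p (sgn4 i * (\<lambda>i\<in>{..<4}. c) i * (int (j i) + r))) = 1" if j: "j \<in> quads t" for j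
    proof -
      have "(\<Prod>i<4. unity p (sgn4 i * (\<lambda>i\<in>{..<4}. c) i * (int (j i) + r))) = unity p (c * (\<Sum>i<4. sgn4 i * (int (j i) + r)))"
        by (simp add: unity_sum sum_distrib_left mult_ac)
      also have "(\<Sum>i<4. sgn4 i * (int (j i) + r)) = 0"
        unfolding sum_sgn4 using j by (simp add: quads_def algebra_simps flip: of_nat_add)
      finally show ?thesis by simp
    qed
    then show "quad_kernel p t r (\<lambda>i\<in>{..<4}. c) = of_nat (card (quads t))"
      unfolding quad_kernel_def by simp
  qed
  finally show ?thesis by simp
qed

text \<open>This is the fourth power of the L^4 norm of f_{r,t}.\<close>

definition quad_sum :: "(int \<Rightarrow> real) \<Rightarrow> nat \<Rightarrow> int \<Rightarrow> real" where
  "quad_sum a t r = (\<Sum>j\<in>quads t. \<Prod>i<4. a (int (j i) + r))"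

context balanced_class_sequence
begin

text \<open>A real sequence equals its conjugate, so its expansion may be conjugated; for i >= 2
  this is what turns the sign of the exponent.\<close>

lemma a_eq_sum_dft4:
  "of_real (a x) = (\<Sum>k\<in>{0..<int p}. dft4 i (- k) * unity p (sgn4 i * k * x)) / of_nat p"
proof -
  have 1: "of_real (a x) = (\<Sum>k\<in>{0..<int p}. dft p a (- k) * unity p (k * x)) / of_nat p"
    by (rule dft_inversion) (simp_all add: p0 a_mod)
  have "of_real (a x) = cnj (of_real (a x))" by simp
  also have "\<dots> = (\<Sum>k\<in>{0..<int p}. cnj (dft p a (- k)) * unity p (- (k * x))) / of_nat p"
    unfolding 1 by (simp add: cnj_unity)
  finally show ?thesis using 1 by (simp add: dft4_def sgn4_def)
qed

lemma quad_sum_eq_kernel_sum: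
  "of_real (quad_sum a t r) =
    (\<Sum>k\<in>PiE {..<4} (\<lambda>_. {0..<int p}). (\<Prod>i<4. dft4 i (- k i)) * quad_kernel p t r k) / of_nat p ^ 4"
proof -
  let ?K = "PiE {..<4::nat} (\<lambda>_. {0..<int p})"
  have "complex_of_real (quad_sum a t r) = (\<Sum>j\<in>quads t. \<Prod>i<4. of_real (a (int (j i) + r)))"
    by (simp add: quad_sum_def)
  also have "\<dots> = (\<Sum>j\<in>quads t. (\<Sum>k\<in>?K. \<Prod>i<4. dft4 i (- k i) * unity p (sgn4 i * k i * (int (j i) + r))) / of_nat p ^ 4)"
  proof (rule sum.cong[OF refl])
    fix j :: "nat \<Rightarrow> nat"
    have "(\<Prod>i<4. complex_of_real (a (int (j i) + r))) =
        (\<Prod>i<4. (\<Sum>k\<in>{0..<int p}. dft4 i (- k) * unity p (sgn4 i * k * (int (j i) + r))) / of_nat p)"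
      by (intro prod.cong refl a_eq_sum_dft4)
    also have "\<dots> = (\<Prod>i<4. \<Sum>k\<in>{0..<int p}. dft4 i (- k) * unity p (sgn4 i * k * (int (j i) + r))) / of_nat p ^ 4"
      by (simp add: prod_dividef)
    also have "(\<Prod>i<4. \<Sum>k\<in>{0..<int p}. dft4 i (- k) * unity p (sgn4 i * k * (int (j i) + r))) =
        (\<Sum>k\<in>?K. \<Prod>i<4. dft4 i (- k i) * unity p (sgn4 i * k i * (int (j i) + r)))"
      by (rule prod_sum_PiE) simp_all
    finally show "(\<Prod>i<4. complex_of_real (a (int (j i) + r))) =
      (\<Sum>k\<in>?K. \<Prod>i<4. dft4 i (- k i) * unity p (sgn4 i * k i * (int (j i) + r))) / of_nat p ^ 4" .
  qed
  also have "\<dots> = (\<Sum>k\<in>?K. \<Sum>j\<in>quads t. \<Prod>i<4. dft4 i (- k i) * unity p (sgn4 i * k i * (int (j i) + r))) / of_nat p ^ 4"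
    unfolding sum_divide_distrib[symmetric] by (subst sum.swap) (rule refl)
  finally show ?thesis by (simp add: prod.distrib quad_kernel_def sum_distrib_left)
qed

lemma dft4_mod [simp]: "dft4 i (x mod int p) = dft4 i x"
  by (simp only: dft4_def dft_mod[OF p0])

text \<open>The kernel does not change when all four frequencies are shifted by the same $\kappa$, so the
  product of Fourier coefficients may be averaged over $\kappa$.\<close>

lemma quad_sum_eq:
  "of_real (quad_sum a t r) =
    (\<Sum>k\<in>PiE {..<4} (\<lambda>_. {0..<int p}). fourth_corr k * quad_kernel p t r k) / of_nat p ^ 4"
proof -
  let ?K = "PiE {..<4::nat} (\<lambda>_. {0..<int p})"
  let ?S = "\<Sum>k\<in>?K. (\<Prod>i<4. dft4 i (- k i)) * quad_kernel p t r k"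
  have shift: "?S = (\<Sum>k\<in>?K. (\<Prod>i<4. dft4 i (\<kappa> - k i)) * quad_kernel p t r k)" for \<kappa>
  proof -
    let ?sh = "\<lambda>c k. \<lambda>i\<in>{..<4::nat}. (k i + c) mod int p"
    have inv: "?sh (- c) (?sh c k) = k" if "k \<in> ?K" for c k
    proof
      fix i
      show "?sh (- c) (?sh c k) i = k i"
      proof (cases "i < 4")
        case True
        have "k i \<in> {0..<int p}" by (rule PiE_mem[OF that]) (use True in simp)
        then show ?thesis using True by (simp add: mod_simps)
      next
        case False
        then show ?thesis using that by (auto simp: PiE_def extensional_def)
      qed
    qed
    have "bij_betw (?sh (- \<kappa>)) ?K ?K"
    proof (rule bij_betwI[of _ _ _ "?sh \<kappa>"])
      show "?sh (- \<kappa>) \<in> ?K \<rightarrow> ?K" "?sh \<kappa> \<in> ?K \<rightarrow> ?K" using p0 by auto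
      show "?sh \<kappa> (?sh (- \<kappa>) k) = k" if "k \<in> ?K" for k using inv[OF that, of "- \<kappa>"] by simp
      show "?sh (- \<kappa>) (?sh \<kappa> k) = k" if "k \<in> ?K" for k using inv[OF that] .
    qed
    then have "?S = (\<Sum>k\<in>?K. (\<Prod>i<4. dft4 i (- ?sh (- \<kappa>) k i)) * quad_kernel p t r (?sh (- \<kappa>) k))"
      by (rule sum.reindex_bij_betw[symmetric])
    also have "\<dots> = (\<Sum>k\<in>?K. (\<Prod>i<4. dft4 i (\<kappa> - k i)) * quad_kernel p t r k)"
    proof (intro sum.cong refl arg_cong2[of _ _ _ _ times] prod.cong)
      fix k and i :: nat assume i: "i \<in> {..<4}"
      have "dft4 i (- ((k i + - \<kappa>) mod int p)) = dft4 i ((- ((k i + - \<kappa>) mod int p)) mod int p)" by simp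
      also have "(- ((k i + - \<kappa>) mod int p)) mod int p = (\<kappa> - k i) mod int p" by (simp add: mod_simps)
      finally show "dft4 i (- ?sh (- \<kappa>) k i) = dft4 i (\<kappa> - k i)" using i by simp
    qed (rule quad_kernel_shift[OF p0])
    finally show ?thesis .
  qed
  have "of_nat p * ?S = (\<Sum>\<kappa>\<in>{0..<int p}. ?S)" by simp
  also have "\<dots> = (\<Sum>\<kappa>\<in>{0..<int p}. \<Sum>k\<in>?K. (\<Prod>i<4. dft4 i (\<kappa> - k i)) * quad_kernel p t r k)"
    by (rule sum.cong[OF refl]) (rule shift)
  also have "\<dots> = (\<Sum>k\<in>?K. (of_nat p * fourth_corr k) * quad_kernel p t r k)"
    by (subst sum.swap) (simp add: fourth_corr_def p0 sum_distrib_right)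
  finally have "?S = (\<Sum>k\<in>?K. fourth_corr k * quad_kernel p t r k)"
    using p0 by (simp add: mult.assoc flip: sum_distrib_left)
  then show ?thesis unfolding quad_sum_eq_kernel_sum by simp
qed

definition total_corr :: real where
  "total_corr = (\<Sum>u\<in>{0..<int p}. (autocorr p a u)\<^sup>2)"

text \<open>The last summand exchanges 2 p^2 + \<open>reflection_corr\<close>^2, which the three
  pairings together assign to equal frequencies, for the true value
  \<open>total_corr\<close>.\<close>

definition quad_sum_main :: "nat \<Rightarrow> int \<Rightarrow> real" where
  "quad_sum_main t r = card (quads_dvd p t r {0, 2}) + card (quads_dvd p t r {0, 3})
     + (reflection_corr / p)\<^sup>2 * card (quads_dvd p t r {0, 1})
     + (total_corr - 2 * (real p)\<^sup>2 - reflection_corr\<^sup>2) / real p ^ 3 * card (quads t)"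

lemma sum_fourth_corr_main:
  "(\<Sum>k\<in>PiE {..<4} (\<lambda>_. {0..<int p}).
      (of_real (fourth_corr_main k) + (if k 0 = k 1 \<and> k 0 = k 2 \<and> k 0 = k 3
        then of_real (total_corr - 2 * (real p)\<^sup>2 - reflection_corr\<^sup>2) else 0)) * quad_kernel p t r k)
   = of_nat p ^ 4 * of_real (quad_sum_main t r)"
proof -
  let ?K = "PiE {..<4::nat} (\<lambda>_. {0..<int p})" and ?W = "quad_kernel p t r"
  let ?P = "\<lambda>A \<alpha> \<gamma> k. \<forall>i<4. k i = (if i \<in> A then k \<alpha> else k \<gamma>)"
  have iff: "(\<forall>i<4. Q i) \<longleftrightarrow> Q 0 \<and> Q 1 \<and> Q 2 \<and> Q (3::nat)" for Q
  proof -
    have "(\<forall>i<4. Q i) \<longleftrightarrow> (\<forall>i\<in>{..<4}. Q i)" by auto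
    then show ?thesis unfolding lessThan_4 by simp
  qed
  have P: "?P {0, 2} 0 1 k \<longleftrightarrow> k 0 = k 2 \<and> k 1 = k 3" "?P {0, 3} 0 1 k \<longleftrightarrow> k 0 = k 3 \<and> k 1 = k 2"
    "?P {0, 1} 0 2 k \<longleftrightarrow> k 0 = k 1 \<and> k 2 = k 3" for k :: "nat \<Rightarrow> int"
    unfolding iff by auto
  have T1: "(\<Sum>k\<in>?K. if ?P {0, 2} 0 1 k then ?W k else 0) = of_nat (p\<^sup>2 * card (quads_dvd p t r {0, 2}))"
    by (rule sum_quad_kernel_two_valued[OF p0]) simp_all
  have T2: "(\<Sum>k\<in>?K. if ?P {0, 3} 0 1 k then ?W k else 0) = of_nat (p\<^sup>2 * card (quads_dvd p t r {0, 3}))"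
    by (rule sum_quad_kernel_two_valued[OF p0]) simp_all
  have T3: "(\<Sum>k\<in>?K. if ?P {0, 1} 0 2 k then ?W k else 0) = of_nat (p\<^sup>2 * card (quads_dvd p t r {0, 1}))"
    by (rule sum_quad_kernel_two_valued[OF p0]) simp_all
  let ?c = "of_real (total_corr - 2 * (real p)\<^sup>2 - reflection_corr\<^sup>2) :: complex"
  have "(\<Sum>k\<in>?K. (of_real (fourth_corr_main k) + (if k 0 = k 1 \<and> k 0 = k 2 \<and> k 0 = k 3 then ?c else 0)) * ?W k)
    = (\<Sum>k\<in>?K. of_nat (p\<^sup>2) * (if ?P {0, 2} 0 1 k then ?W k else 0) + of_nat (p\<^sup>2) * (if ?P {0, 3} 0 1 k then ?W k else 0)
       + of_real (reflection_corr\<^sup>2) * (if ?P {0, 1} 0 2 k then ?W k else 0)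
       + ?c * (if k 0 = k 1 \<and> k 0 = k 2 \<and> k 0 = k 3 then ?W k else 0))"
    unfolding P fourth_corr_main_def
  proof (rule sum.cong[OF refl])
    have gen: "(of_real ((if a then x else 0) + (if b then x else 0) + (if c then z else 0)) + (if d then w else 0)) * W
      = of_real x * (if a then W else 0) + of_real x * (if b then W else 0) + of_real z * (if c then W else 0)
        + w * (if d then W else 0)" for a b c d and x z :: real and w W :: complex
      by (cases a; cases b; cases c; cases d) (simp_all add: algebra_simps)
    have "complex_of_nat (p\<^sup>2) = of_real ((real p)\<^sup>2)" by simp
    then show "(of_real ((if k 0 = k 2 \<and> k 1 = k 3 then (real p)\<^sup>2 else 0) + (if k 0 = k 3 \<and> k 1 = k 2 then (real p)\<^sup>2 else 0)
        + (if k 0 = k 1 \<and> k 2 = k 3 then reflection_corr\<^sup>2 else 0)) + (if k 0 = k 1 \<and> k 0 = k 2 \<and> k 0 = k 3 then ?c else 0)) * ?W k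
      = of_nat (p\<^sup>2) * (if k 0 = k 2 \<and> k 1 = k 3 then ?W k else 0) + of_nat (p\<^sup>2) * (if k 0 = k 3 \<and> k 1 = k 2 then ?W k else 0)
       + of_real (reflection_corr\<^sup>2) * (if k 0 = k 1 \<and> k 2 = k 3 then ?W k else 0)
       + ?c * (if k 0 = k 1 \<and> k 0 = k 2 \<and> k 0 = k 3 then ?W k else 0)" for k :: "nat \<Rightarrow> int"
      by (simp only: gen)
  qed
  also have "\<dots> = of_nat (p\<^sup>2) * of_nat (p\<^sup>2 * card (quads_dvd p t r {0, 2})) + of_nat (p\<^sup>2) * of_nat (p\<^sup>2 * card (quads_dvd p t r {0, 3}))
       + of_real (reflection_corr\<^sup>2) * of_nat (p\<^sup>2 * card (quads_dvd p t r {0, 1})) + ?c * of_nat (p * card (quads t))"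
    unfolding sum.distrib sum_distrib_left[symmetric] sum_quad_kernel_const[OF p0] T1 T2 T3 ..
  also have "\<dots> = of_nat p ^ 4 * of_real (quad_sum_main t r)"
  proof -
    have 1: "real p ^ 4 * (z / p)\<^sup>2 = z\<^sup>2 * (real p)\<^sup>2" for z
      using p0 by (simp add: power2_eq_square power4_eq_xxxx)
    have 2: "real p ^ 4 * (c / real p ^ 3) = c * real p" for c
      using p0 by (simp add: power3_eq_cube power4_eq_xxxx)
    have "real p ^ 4 * quad_sum_main t r = (real p)\<^sup>2 * ((real p)\<^sup>2 * card (quads_dvd p t r {0, 2}))
       + (real p)\<^sup>2 * ((real p)\<^sup>2 * card (quads_dvd p t r {0, 3}))
       + reflection_corr\<^sup>2 * ((real p)\<^sup>2 * card (quads_dvd p t r {0, 1}))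
       + (total_corr - 2 * (real p)\<^sup>2 - reflection_corr\<^sup>2) * (real p * card (quads t))"
    proof -
      have "real p ^ 4 * quad_sum_main t r = real p ^ 4 * real (card (quads_dvd p t r {0, 2}) + card (quads_dvd p t r {0, 3}))
        + (real p ^ 4 * (reflection_corr / p)\<^sup>2) * card (quads_dvd p t r {0, 1})
        + (real p ^ 4 * ((total_corr - 2 * (real p)\<^sup>2 - reflection_corr\<^sup>2) / real p ^ 3)) * card (quads t)"
        unfolding quad_sum_main_def by (simp only: distrib_left mult.assoc)
      then show ?thesis unfolding 1 2 by (simp only: of_nat_add distrib_left power2_eq_square power4_eq_xxxx mult.assoc)
    qed
    from arg_cong[OF this, of complex_of_real] show ?thesis by simp
  qed
  finally show ?thesis .
qed

end

text \<open>The main term is exact where all frequencies agree. Elsewhere the uniform error of the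
  correlations is multiplied by the total absolute weight of the kernel.\<close>

lemma quad_sum_estimate:
  assumes "m > 0"
  shows "\<exists>C\<ge>0. \<forall>p g a t r. balanced_class_sequence m p g a \<longrightarrow>
    \<bar>quad_sum a t r - balanced_class_sequence.quad_sum_main p a t r\<bar>
      \<le> C * (real p * sqrt p) * (2 * real t + real p * (1 + ln p)) ^ 4 / real p ^ 4"
proof -
  from fourth_corr_estimate[OF assms] obtain C where C: "C \<ge> 0"
    and bound: "\<forall>p g a k. balanced_class_sequence m p g a \<longrightarrow> (\<forall>i<4. k i \<in> {0..<int p}) \<longrightarrow>
    \<not> (k 0 = k 1 \<and> k 0 = k 2 \<and> k 0 = k 3) \<longrightarrow>
    cmod (balanced_class_sequence.fourth_corr p a k - of_real (balanced_class_sequence.fourth_corr_main p a k))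
      \<le> C * (real p * sqrt p)"
    by (elim exE conjE) (rule that)
  have *: "\<bar>quad_sum a t r - balanced_class_sequence.quad_sum_main p a t r\<bar>
      \<le> C * (real p * sqrt p) * (2 * real t + real p * (1 + ln p)) ^ 4 / real p ^ 4"
    if a: "balanced_class_sequence m p g a" for p g a t r
  proof -
    interpret balanced_class_sequence m p g a by (rule a)
    let ?K = "PiE {..<4::nat} (\<lambda>_. {0..<int p})" and ?W = "quad_kernel p t r"
    let ?c = "\<lambda>k. (if k 0 = k 1 \<and> k 0 = k 2 \<and> k 0 = k 3
        then of_real (total_corr - 2 * (real p)\<^sup>2 - reflection_corr\<^sup>2) else 0) :: complex"
    let ?e = "\<lambda>k. fourth_corr k - (of_real (fourth_corr_main k) + ?c k)"
    have e: "cmod (?e k) \<le> C * (real p * sqrt p)" if k: "k \<in> ?K" for k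
    proof (cases "k 0 = k 1 \<and> k 0 = k 2 \<and> k 0 = k 3")
      case True
      then have eqs: "k 1 = k 0" "k 2 = k 0" "k 3 = k 0" by simp_all
      have "k i = k 0" if "i < 4" for i
      proof -
        have "i = 0 \<or> i = 1 \<or> i = 2 \<or> i = 3" using that by linarith
        then show ?thesis using eqs by (elim disjE) (simp_all only:)
      qed
      then have "fourth_corr k = of_real total_corr" unfolding total_corr_def by (rule fourth_corr_const)
      moreover have "fourth_corr_main k = 2 * (real p)\<^sup>2 + reflection_corr\<^sup>2"
        unfolding fourth_corr_main_def eqs by simp
      ultimately have "?e k = 0" unfolding if_P[OF True] by simp
      then show ?thesis using C by simp
    next
      case False
      have k4: "\<forall>i<4. k i \<in> {0..<int p}" using k by (blast intro: PiE_mem)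
      have "cmod (fourth_corr k - of_real (fourth_corr_main k)) \<le> C * (real p * sqrt p)"
        by (rule bound[THEN spec, THEN spec, THEN spec, THEN spec, THEN mp, THEN mp, THEN mp, OF a k4 False])
      then show ?thesis unfolding if_not_P[OF False] by simp
    qed
    have "(\<Sum>k\<in>?K. ?e k * ?W k) = (\<Sum>k\<in>?K. fourth_corr k * ?W k) - of_nat p ^ 4 * of_real (quad_sum_main t r)"
      unfolding sum_fourth_corr_main[symmetric] by (simp add: left_diff_distrib sum_subtractf)
    also have "\<dots> = of_nat p ^ 4 * of_real (quad_sum a t r - quad_sum_main t r)"
    proof -
      have "(\<Sum>k\<in>?K. fourth_corr k * ?W k) = of_nat p ^ 4 * of_real (quad_sum a t r)"
        unfolding quad_sum_eq[of t r] using p0 by simp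
      then show ?thesis by (simp add: right_diff_distrib)
    qed
    finally have "cmod (of_nat p ^ 4 * of_real (quad_sum a t r - quad_sum_main t r)) = cmod (\<Sum>k\<in>?K. ?e k * ?W k)" by simp
    also have "\<dots> \<le> (\<Sum>k\<in>?K. C * (real p * sqrt p) * cmod (?W k))"
      by (rule sum_norm_le) (simp only: norm_mult, intro mult_right_mono e, auto)
    also have "\<dots> = C * (real p * sqrt p) * (\<Sum>k\<in>?K. cmod (?W k))" by (simp add: sum_distrib_left)
    also have "\<dots> \<le> C * (real p * sqrt p) * (2 * real t + real p * (1 + ln p)) ^ 4"
      using C by (intro mult_left_mono sum_norm_quad_kernel_le[OF p0]) auto
    finally have "real p ^ 4 * \<bar>quad_sum a t r - quad_sum_main t r\<bar> \<le> C * (real p * sqrt p) * (2 * real t + real p * (1 + ln p)) ^ 4"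
      unfolding norm_mult norm_power norm_of_nat norm_of_real .
    then show ?thesis using p0 by (simp add: pos_le_divide_eq mult.commute)
  qed
  show ?thesis by (intro exI[of _ C] conjI allI impI C) (rule *)
qed

section \<open>Norms of polynomials on the unit circle\<close>

lemma has_integral_cos_int:
  "((\<lambda>\<phi>. cos (of_int n * \<phi>)) has_integral (if n = 0 then 2 * pi else 0)) {0..2 * pi}"
proof (cases "n = 0")
  case True
  have "((\<lambda>\<phi>::real. 1::real) has_integral (2 * pi - 0)) {0..2 * pi}"
    using has_integral_const_real[of "1::real" 0 "2 * pi"] by simp
  then show ?thesis using True by simp
next
  case False
  have "((\<lambda>\<phi>. cos (of_int n * \<phi>)) has_integral
      (sin (of_int n * (2 * pi)) / of_int n - sin (of_int n * 0) / of_int n)) {0..2 * pi}"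
    using False
    by (intro fundamental_theorem_of_calculus)
      (auto intro!: derivative_eq_intros simp flip: has_real_derivative_iff_has_vector_derivative)
  moreover have "sin (of_int n * (2 * pi)) = 0"
    using sin_int_2pin[of n] by (simp add: mult_ac)
  ultimately show ?thesis using False by simp
qed

lemma has_integral_trig_sum:
  assumes "finite J" "\<And>\<phi>. F \<phi> = (\<Sum>j\<in>J. b j * cos (of_int (n j) * \<phi>))"
  shows "(F has_integral 2 * pi * (\<Sum>j\<in>{j \<in> J. n j = 0}. b j)) {0..2 * pi}"
proof -
  have "((\<lambda>\<phi>. \<Sum>j\<in>J. b j * cos (of_int (n j) * \<phi>)) has_integral
      (\<Sum>j\<in>J. b j * (if n j = 0 then 2 * pi else 0))) {0..2 * pi}"
    by (intro has_integral_sum assms(1) has_integral_mult_right has_integral_cos_int)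
  moreover have "(\<Sum>j\<in>J. b j * (if n j = 0 then 2 * pi else 0)) = 2 * pi * (\<Sum>j\<in>{j \<in> J. n j = 0}. b j)"
    using assms(1) by (simp add: sum.inter_filter sum_distrib_left if_distrib mult.commute cong: if_cong)
  moreover have "F = (\<lambda>\<phi>. \<Sum>j\<in>J. b j * cos (of_int (n j) * \<phi>))" using assms(2) by blast
  ultimately show ?thesis by simp
qed

definition seq_poly :: "(nat \<Rightarrow> real) \<Rightarrow> nat \<Rightarrow> complex poly" where
  "seq_poly b t = (\<Sum>j<t. Polynomial.monom (of_real (b j)) j)"

lemma poly_seq_poly_cis: "poly (seq_poly b t) (cis \<phi>) = (\<Sum>j<t. of_real (b j) * cis (real j * \<phi>))"
  by (simp add: seq_poly_def poly_sum poly_monom Complex.DeMoivre)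

text \<open>Expanding f f and its conjugate square gives a sum of characters; as |f|^4 is real, only
  cosines remain and real integration suffices.\<close>

lemma norm_power4_seq_poly:
  "cmod (poly (seq_poly b t) (cis \<phi>)) ^ 4 =
    (\<Sum>j\<in>PiE {..<4} (\<lambda>_. {..<t}). (\<Prod>i<4. b (j i)) * cos (of_int (\<Sum>i<4. sgn4 i * int (j i)) * \<phi>))"
proof -
  let ?z = "poly (seq_poly b t) (cis \<phi>)"
  let ?F = "\<lambda>i. \<Sum>j<t. of_real (b j) * cis (of_int (sgn4 i * int j) * \<phi>)"
  have F: "?F i = (if i < 2 then ?z else cnj ?z)" for i
    by (simp add: poly_seq_poly_cis sgn4_def cis_cnj)
  have "of_real (cmod ?z ^ 4) = of_real ((cmod ?z)\<^sup>2) * (of_real ((cmod ?z)\<^sup>2) :: complex)"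
    by (simp flip: of_real_mult power_add)
  also have "\<dots> = (?z * cnj ?z) * (?z * cnj ?z)" by (simp only: complex_norm_square)
  also have "\<dots> = (\<Prod>i<4. ?F i)" unfolding F by (simp add: numeral_eq_Suc mult_ac)
  also have "\<dots> = (\<Sum>j\<in>PiE {..<4} (\<lambda>_. {..<t}). \<Prod>i<4. of_real (b (j i)) * cis (of_int (sgn4 i * int (j i)) * \<phi>))"
    by (rule prod_sum_PiE) simp_all
  also have "\<dots> = (\<Sum>j\<in>PiE {..<4} (\<lambda>_. {..<t}). of_real (\<Prod>i<4. b (j i)) * cis (of_int (\<Sum>i<4. sgn4 i * int (j i)) * \<phi>))"
  proof (rule sum.cong[OF refl])
    fix j :: "nat \<Rightarrow> nat"
    have cis_sum: "(\<Prod>i\<in>A. cis (h i)) = cis (\<Sum>i\<in>A. h i)" if "finite A" for A :: "nat set" and h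
      using that by (induction A rule: finite_induct) (simp_all add: cis_mult)
    have "(\<Prod>i<4. of_real (b (j i)) * cis (of_int (sgn4 i * int (j i)) * \<phi>)) =
        of_real (\<Prod>i<4. b (j i)) * cis (\<Sum>i<4. of_int (sgn4 i * int (j i)) * \<phi>)"
      by (simp only: prod.distrib of_real_prod cis_sum finite_lessThan)
    also have "(\<Sum>i<4. of_int (sgn4 i * int (j i)) * \<phi>) = of_int (\<Sum>i<4. sgn4 i * int (j i)) * \<phi>"
      by (simp only: of_int_sum sum_distrib_right)
    finally show "(\<Prod>i<4. of_real (b (j i)) * cis (of_int (sgn4 i * int (j i)) * \<phi>)) =
        of_real (\<Prod>i<4. b (j i)) * cis (of_int (\<Sum>i<4. sgn4 i * int (j i)) * \<phi>)" .
  qed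
  finally have "Re (of_real (cmod ?z ^ 4)) =
    Re (\<Sum>j\<in>PiE {..<4} (\<lambda>_. {..<t}). of_real (\<Prod>i<4. b (j i)) * cis (of_int (\<Sum>i<4. sgn4 i * int (j i)) * \<phi>))"
    by (rule arg_cong)
  then show ?thesis by (simp del: of_real_prod of_int_sum)
qed

lemma norm_power2_seq_poly:
  "(cmod (poly (seq_poly b t) (cis \<phi>)))\<^sup>2 =
    (\<Sum>(j, k)\<in>{..<t} \<times> {..<t}. b j * b k * cos (of_int (int j - int k) * \<phi>))"
proof -
  let ?z = "poly (seq_poly b t) (cis \<phi>)"
  have "of_real ((cmod ?z)\<^sup>2) = ?z * cnj ?z" by (rule complex_norm_square)
  also have "\<dots> = (\<Sum>j<t. \<Sum>k<t. of_real (b j * b k) * cis (of_int (int j - int k) * \<phi>))"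
    by (simp add: poly_seq_poly_cis sum_product cis_cnj cis_mult algebra_simps)
  finally have "Re (of_real ((cmod ?z)\<^sup>2)) = Re (\<Sum>j<t. \<Sum>k<t. of_real (b j * b k) * cis (of_int (int j - int k) * \<phi>))"
    by (rule arg_cong)
  then show ?thesis by (simp add: sum.cartesian_product case_prod_beta)
qed

lemma integral_norm_power4:
  "integral {0..2 * pi} (\<lambda>\<phi>. cmod (poly (seq_poly b t) (cis \<phi>)) powr 4) = 2 * pi * (\<Sum>j\<in>quads t. \<Prod>i<4. b (j i))"
proof -
  have pw: "x powr 4 = x ^ 4" if "x \<ge> 0" for x :: real
    using powr_realpow[of x 4] that by (cases "x = 0") auto
  have "{j \<in> PiE {..<4} (\<lambda>_. {..<t}). (\<Sum>i<4. sgn4 i * int (j i)) = 0} = quads t"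
    unfolding quads_def sum_sgn4 by (intro Collect_cong conj_cong refl) linarith
  moreover have "((\<lambda>\<phi>. cmod (poly (seq_poly b t) (cis \<phi>)) ^ 4) has_integral
      2 * pi * (\<Sum>j\<in>{j \<in> PiE {..<4} (\<lambda>_. {..<t}). (\<Sum>i<4. sgn4 i * int (j i)) = 0}. \<Prod>i<4. b (j i))) {0..2 * pi}"
    by (rule has_integral_trig_sum) (simp_all only: norm_power4_seq_poly finite_PiE finite_lessThan)
  ultimately show ?thesis by (simp add: pw integral_unique)
qed

lemma integral_norm_power2:
  "integral {0..2 * pi} (\<lambda>\<phi>. cmod (poly (seq_poly b t) (cis \<phi>)) powr 2) = 2 * pi * (\<Sum>j<t. (b j)\<^sup>2)"
proof -
  have pw: "x powr 2 = x\<^sup>2" if "x \<ge> 0" for x :: real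
    using powr_realpow[of x 2] that by (cases "x = 0") auto
  have "((\<lambda>\<phi>. (cmod (poly (seq_poly b t) (cis \<phi>)))\<^sup>2) has_integral
      2 * pi * (\<Sum>x\<in>{x \<in> {..<t} \<times> {..<t}. int (fst x) - int (snd x) = 0}. b (fst x) * b (snd x))) {0..2 * pi}"
    by (rule has_integral_trig_sum) (simp_all add: norm_power2_seq_poly case_prod_beta)
  moreover have "(\<Sum>x\<in>{x \<in> {..<t} \<times> {..<t}. int (fst x) - int (snd x) = 0}. b (fst x) * b (snd x)) = (\<Sum>j<t. (b j)\<^sup>2)"
    by (rule sum.reindex_bij_witness[of _ "\<lambda>j. (j, j)" fst]) (auto simp: power2_eq_square)
  ultimately show ?thesis by (simp add: pw integral_unique)
qed

lemma merit_factor_seq_poly: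
  assumes b: "\<And>j. (b j)\<^sup>2 = 1" and q: "0 \<le> (\<Sum>j\<in>quads t. \<Prod>i<4. b (j i))"
  shows "merit_factor (seq_poly b t) = (real t)\<^sup>2 / ((\<Sum>j\<in>quads t. \<Prod>i<4. b (j i)) - (real t)\<^sup>2)"
proof -
  have p4: "(x powr (1 / 4)) ^ 4 = x" if "x \<ge> 0" for x :: real
    using that by (cases "x = 0") (simp_all add: powr_power)
  have p2: "(x powr (1 / 2)) ^ 4 = x\<^sup>2" if "x \<ge> 0" for x :: real
    using that by (cases "x = 0") (simp_all add: powr_power powr_numeral)
  have "circle_norm 4 (seq_poly b t) ^ 4 = (\<Sum>j\<in>quads t. \<Prod>i<4. b (j i))"
    unfolding circle_norm_def integral_norm_power4 using q by (simp add: p4)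
  moreover have "circle_norm 2 (seq_poly b t) ^ 4 = (real t)\<^sup>2"
    unfolding circle_norm_def integral_norm_power2 by (simp add: p2 b)
  ultimately show ?thesis unfolding merit_factor_def by simp
qed

text \<open>The sign is visible only through the integral of |f|^4. It ensures that the fourth power
  of \<open>circle_norm 4\<close> undoes the fourth root.\<close>

lemma quad_sum_nonneg:
  fixes b :: "nat \<Rightarrow> real"
  shows "0 \<le> (\<Sum>j\<in>quads t. \<Prod>i<4. b (j i))"
proof -
  have "0 \<le> integral {0..2 * pi} (\<lambda>\<phi>. cmod (poly (seq_poly b t) (cis \<phi>)) powr 4)"
    by (cases "(\<lambda>\<phi>. cmod (poly (seq_poly b t) (cis \<phi>)) powr 4) integrable_on {0..2 * pi}")
      (simp_all add: integral_nonneg not_integrable_integral)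
  then show ?thesis unfolding integral_norm_power4 using pi_gt_zero by (auto simp: zero_le_mult_iff)
qed

section \<open>Counting quadruples with a divisibility condition\<close>

definition diff_pairs :: "nat \<Rightarrow> int \<Rightarrow> (nat \<times> nat) set" where
  "diff_pairs t u = {(x, y). x < t \<and> y < t \<and> int x - int y = u}"

lemma card_diff_pairs: "card (diff_pairs t u) = nat (int t - \<bar>u\<bar>)"
proof (cases "u \<ge> 0")
  case True
  have "bij_betw (\<lambda>y. (y + nat u, y)) {..<nat (int t - u)} (diff_pairs t u)"
    using True by (intro bij_betwI[of _ _ _ snd]) (auto simp: diff_pairs_def)
  then show ?thesis using True by (simp add: bij_betw_same_card[symmetric])
next
  case False
  have "bij_betw (\<lambda>x. (x, x + nat (- u))) {..<nat (int t + u)} (diff_pairs t u)"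
    using False by (intro bij_betwI[of _ _ _ fst]) (auto simp: diff_pairs_def)
  then show ?thesis using False by (simp add: bij_betw_same_card[symmetric])
qed

lemma finite_diff_pairs: "finite (diff_pairs t u)"
  by (rule finite_subset[of _ "{..<t} \<times> {..<t}"]) (auto simp: diff_pairs_def)

definition tuple4 :: "nat \<Rightarrow> nat \<Rightarrow> nat \<Rightarrow> nat \<Rightarrow> nat \<Rightarrow> nat" where
  "tuple4 x y z w = (\<lambda>i\<in>{..<4}. if i = 0 then x else if i = 1 then y else if i = 2 then z else w)"

lemma tuple4_simps [simp]:
  "tuple4 x y z w 0 = x" "tuple4 x y z w (Suc 0) = y" "tuple4 x y z w 2 = z" "tuple4 x y z w 3 = w"
  by (simp_all add: tuple4_def)

lemma tuple4_mem_quads: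
  "tuple4 x y z w \<in> quads t \<longleftrightarrow> x < t \<and> y < t \<and> z < t \<and> w < t \<and> x + y = z + w"
proof -
  have "{..<4 :: nat} = {0, 1, 2, 3}" by auto
  then have "tuple4 x y z w \<in> PiE {..<4} (\<lambda>_. {..<t}) \<longleftrightarrow> x < t \<and> y < t \<and> z < t \<and> w < t"
    by (auto simp: PiE_iff tuple4_def extensional_def)
  then show ?thesis by (auto simp: quads_def)
qed

lemma tuple4_eta:
  assumes "j \<in> quads t" shows "tuple4 (j 0) (j (Suc 0)) (j 2) (j 3) = j"
proof
  fix i
  show "tuple4 (j 0) (j (Suc 0)) (j 2) (j 3) i = j i"
  proof (cases "i < 4")
    case True
    then have "i = 0 \<or> i = 1 \<or> i = 2 \<or> i = 3" by linarith
    then show ?thesis by (elim disjE) simp_all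
  next
    case False
    then show ?thesis using assms by (simp add: quads_def PiE_def extensional_def tuple4_def)
  qed
qed

lemma quads_bounds:
  assumes "j \<in> quads t"
  shows "j 0 < t" "j (Suc 0) < t" "j 2 < t" "j 3 < t" "j 0 + j (Suc 0) = j 2 + j 3"
  using assms by (auto simp: quads_def PiE_iff)

text \<open>The weight is the number of pairs of pairs with common difference u. All three
  divisibility conditions on quadruples reduce to a condition on such a u.\<close>

definition pair_count :: "nat \<Rightarrow> (int \<Rightarrow> bool) \<Rightarrow> nat" where
  "pair_count t Q = (\<Sum>u\<in>{- int t..int t}. if Q u then (nat (int t - \<bar>u\<bar>))\<^sup>2 else 0)"

lemma card_quads_eq_pair_count:
  assumes f: "bij_betw f {j \<in> quads t. P j} (SIGMA u:{u \<in> {- int t..int t}. Q u}. diff_pairs t u \<times> diff_pairs t u)"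
  shows "card {j \<in> quads t. P j} = pair_count t Q"
proof -
  have "card {j \<in> quads t. P j} = (\<Sum>u\<in>{u \<in> {- int t..int t}. Q u}. (card (diff_pairs t u))\<^sup>2)"
    unfolding bij_betw_same_card[OF f]
    by (subst card_SigmaI)
      (auto simp: finite_diff_pairs card_cartesian_product power2_eq_square intro: finite_subset[of _ "{- int t..int t}"])
  also have "\<dots> = (\<Sum>u\<in>{- int t..int t}. if Q u then (card (diff_pairs t u))\<^sup>2 else 0)"
    by (rule sum.inter_filter) simp
  finally show ?thesis by (simp only: pair_count_def card_diff_pairs)
qed

text \<open>The additive relation says that j0 - j2 = j3 - j1, which is the common difference
  u.\<close>

lemma card_quads_diff_02: "card {j \<in> quads t. Q (int (j 0) - int (j 2))} = pair_count t Q"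
proof (rule card_quads_eq_pair_count)
  show "bij_betw (\<lambda>j. (int (j 0) - int (j 2), (j 0, j 2), (j 3, j (Suc 0)))) {j \<in> quads t. Q (int (j 0) - int (j 2))}
     (SIGMA u:{u \<in> {- int t..int t}. Q u}. diff_pairs t u \<times> diff_pairs t u)"
    by (rule bij_betwI[of _ _ _ "\<lambda>(u, (x, z), (w, y)). tuple4 x y z w"])
      (auto simp: diff_pairs_def tuple4_mem_quads tuple4_eta dest: quads_bounds)
qed

lemma card_quads_diff_03: "card {j \<in> quads t. Q (int (j 0) - int (j 3))} = pair_count t Q"
proof (rule card_quads_eq_pair_count)
  show "bij_betw (\<lambda>j. (int (j 0) - int (j 3), (j 0, j 3), (j 2, j (Suc 0)))) {j \<in> quads t. Q (int (j 0) - int (j 3))}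
     (SIGMA u:{u \<in> {- int t..int t}. Q u}. diff_pairs t u \<times> diff_pairs t u)"
    by (rule bij_betwI[of _ _ _ "\<lambda>(u, (x, w), (z, y)). tuple4 x y z w"])
      (auto simp: diff_pairs_def tuple4_mem_quads tuple4_eta dest: quads_bounds)
qed

text \<open>Reflecting j1 and j3 by the map from x to t - 1 - x turns equal sums into equal
  differences. This shifts the sum by t - 1 and produces the same weights as before.\<close>

lemma card_quads_sum_01:
  "card {j \<in> quads t. Q (int (j 0) + int (j (Suc 0)) - (int t - 1))} = pair_count t Q"
proof (rule card_quads_eq_pair_count)
  define f where "f j = (int (j 0) + int (j (Suc 0)) - (int t - 1), (j 0, t - 1 - j (Suc 0)), (j 2, t - 1 - j 3))"
    for j :: "nat \<Rightarrow> nat"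
  define h where "h = (\<lambda>(u :: int, (x, y), (z, w)). tuple4 x (t - 1 - y) z (t - 1 - w))"
  let ?A = "{j \<in> quads t. Q (int (j 0) + int (j (Suc 0)) - (int t - 1))}"
  let ?B = "SIGMA u:{u \<in> {- int t..int t}. Q u}. diff_pairs t u \<times> diff_pairs t u"
  show "bij_betw f ?A ?B"
  proof (rule bij_betwI[of _ _ _ h])
    show "f \<in> ?A \<rightarrow> ?B"
    proof (rule funcsetI)
      fix j assume j: "j \<in> ?A"
      then have "j \<in> quads t" by simp
      note quads_bounds[OF this]
      with j show "f j \<in> ?B" by (auto simp: f_def diff_pairs_def of_nat_diff)
    qed
    have hB: "h b \<in> ?A \<and> f (h b) = b" if "b \<in> ?B" for b
    proof -
      obtain u x y z w where b: "b = (u, (x, y), (z, w))" by (cases b) auto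
      have bb: "Q u" "x < t" "y < t" "z < t" "w < t" "int x - int y = u" "int z - int w = u"
        using that unfolding b by (auto simp: diff_pairs_def)
      have u: "int x + int (t - 1 - y) - (int t - 1) = u" using bb by (simp add: of_nat_diff)
      have "x + (t - 1 - y) = z + (t - 1 - w)" using bb by linarith
      then have "tuple4 x (t - 1 - y) z (t - 1 - w) \<in> quads t" unfolding tuple4_mem_quads using bb by auto
      moreover have "t - 1 - (t - 1 - y) = y" "t - 1 - (t - 1 - w) = w" using bb by linarith+
      ultimately show ?thesis
        unfolding b h_def f_def prod.case mem_Collect_eq tuple4_simps u using bb(1) by simp
    qed
    show "h \<in> ?B \<rightarrow> ?A" using hB by blast
    show "f (h b) = b" if "b \<in> ?B" for b using hB[OF that] by blast
    show "h (f j) = j" if "j \<in> ?A" for j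
    proof -
      have j: "j \<in> quads t" using that by simp
      have "t - 1 - (t - 1 - j (Suc 0)) = j (Suc 0)" "t - 1 - (t - 1 - j 3) = j 3"
        using quads_bounds[OF j] by linarith+
      then show ?thesis using tuple4_eta[OF j] by (simp add: f_def h_def)
    qed
  qed
qed

text \<open>The summand 0 gives the condition the shape required by
  \<open>pair_count_dvd\<close>.\<close>

lemma card_quads_dvd_02: "card (quads_dvd p t r {0, 2}) = pair_count t (\<lambda>u. int p dvd u + 0)"
proof -
  have "quads_dvd p t r {0, 2} = {j \<in> quads t. int p dvd (int (j 0) - int (j 2)) + 0}"
    by (simp add: quads_dvd_def sgn4_def)
  then show ?thesis by (simp only: card_quads_diff_02[of t "\<lambda>u. int p dvd u + 0"])
qed

lemma card_quads_dvd_03: "card (quads_dvd p t r {0, 3}) = pair_count t (\<lambda>u. int p dvd u + 0)"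
proof -
  have "quads_dvd p t r {0, 3} = {j \<in> quads t. int p dvd (int (j 0) - int (j 3)) + 0}"
    by (simp add: quads_dvd_def sgn4_def)
  then show ?thesis by (simp only: card_quads_diff_03[of t "\<lambda>u. int p dvd u + 0"])
qed

lemma card_quads_dvd_01:
  "card (quads_dvd p t r {0, 1}) = pair_count t (\<lambda>u. int p dvd u + (int t - 1 + 2 * r))"
proof -
  have "quads_dvd p t r {0, 1} =
     {j \<in> quads t. int p dvd (int (j 0) + int (j (Suc 0)) - (int t - 1)) + (int t - 1 + 2 * r)}"
    by (simp add: quads_dvd_def sgn4_def algebra_simps)
  then show ?thesis by (simp only: card_quads_sum_01[of t "\<lambda>u. int p dvd u + (int t - 1 + 2 * r)"])
qed

lemma card_quads: "real (card (quads t)) = real t * (2 * (real t)\<^sup>2 + 1) / 3"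
proof -
  have pos: "(\<Sum>u\<in>{1..int n}. f u) = (\<Sum>k<n. f (int k + 1))" for f :: "int \<Rightarrow> nat" and n
    by (rule sum.reindex_bij_witness[of _ "\<lambda>k. int k + 1" "\<lambda>u. nat (u - 1)"]) auto
  have neg: "(\<Sum>u\<in>{- int n..-1}. f u) = (\<Sum>k<n. f (- int k - 1))" for f :: "int \<Rightarrow> nat" and n
    by (rule sum.reindex_bij_witness[of _ "\<lambda>k. - int k - 1" "\<lambda>u. nat (- u - 1)"]) auto
  have rev: "(\<Sum>k<t. (nat (int t - (int k + 1)))\<^sup>2) = (\<Sum>k<t. k\<^sup>2)"
    by (rule sum.reindex_bij_witness[of _ "\<lambda>k. t - 1 - k" "\<lambda>k. t - 1 - k"]) (auto simp: nat_diff_distrib' intro!: arg_cong[of _ _ "\<lambda>x. x\<^sup>2"])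
  have "card (quads t) = card {j \<in> quads t. True}" by simp
  also have "\<dots> = pair_count t (\<lambda>_. True)" by (rule card_quads_diff_02)
  also have "\<dots> = (\<Sum>u\<in>{- int t..int t}. (nat (int t - \<bar>u\<bar>))\<^sup>2)" by (simp add: pair_count_def)
  also have "{- int t..int t} = insert 0 ({- int t..-1} \<union> {1..int t})" by auto
  also have "(\<Sum>u\<in>insert 0 ({- int t..-1} \<union> {1..int t}). (nat (int t - \<bar>u\<bar>))\<^sup>2)
    = t\<^sup>2 + ((\<Sum>u\<in>{- int t..-1}. (nat (int t - \<bar>u\<bar>))\<^sup>2) + (\<Sum>u\<in>{1..int t}. (nat (int t - \<bar>u\<bar>))\<^sup>2))"
    by (subst sum.insert) (auto simp: sum.union_disjoint)
  also have "(\<Sum>u\<in>{- int t..-1}. (nat (int t - \<bar>u\<bar>))\<^sup>2) = (\<Sum>k<t. k\<^sup>2)"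
    unfolding neg rev[symmetric] by (intro sum.cong refl) simp
  also have "(\<Sum>u\<in>{1..int t}. (nat (int t - \<bar>u\<bar>))\<^sup>2) = (\<Sum>k<t. k\<^sup>2)"
    unfolding pos rev[symmetric] by (intro sum.cong refl) simp
  finally have "real (card (quads t)) = (real t)\<^sup>2 + 2 * (\<Sum>k<t. (real k)\<^sup>2)" by simp
  moreover have "(\<Sum>k<t. (real k)\<^sup>2) = real t * (real t - 1) * (2 * real t - 1) / 6"
    by (induction t) (simp_all add: power2_eq_square field_simps)
  ultimately show ?thesis by (simp add: power2_eq_square field_simps)
qed

text \<open>With u = p n - c, the scaled weight (1 - |u| / t)^2 is a squared tent in n whose width t
  / p and centre c / p converge in the application. The range \<open>M\<close> is kept apart so that
  the limit can be taken in a fixed finite sum.\<close>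

lemma pair_count_dvd:
  assumes p: "p > 0" and t: "t > 0" and M: "int t + \<bar>c\<bar> \<le> int p * M"
  shows "real (pair_count t (\<lambda>u. int p dvd u + c)) / (real t)\<^sup>2 =
    (\<Sum>n\<in>{- M..M}. (max 0 (1 - \<bar>of_int n - of_int c / real p\<bar> / (real t / real p)))\<^sup>2)"
proof -
  let ?f = "\<lambda>u::int. (max 0 (1 - \<bar>of_int u\<bar> / real t))\<^sup>2"
  have f: "real ((nat (int t - \<bar>u\<bar>))\<^sup>2) / (real t)\<^sup>2 = ?f u" for u
  proof -
    have "real (nat x) / real t = max 0 (of_int x / real t)" for x
      using t by (cases "x \<ge> 0") (simp_all add: max_def divide_le_0_iff zero_le_divide_iff)
    then have "real (nat (int t - \<bar>u\<bar>)) / real t = max 0 (of_int (int t - \<bar>u\<bar>) / real t)" .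
    also have "of_int (int t - \<bar>u\<bar>) / real t = 1 - \<bar>of_int u\<bar> / real t"
      using t by (simp add: diff_divide_distrib)
    finally have "real (nat (int t - \<bar>u\<bar>)) / real t = max 0 (1 - \<bar>of_int u\<bar> / real t)" .
    then show ?thesis by (metis of_nat_power power_divide)
  qed
  have "real (pair_count t (\<lambda>u. int p dvd u + c)) / (real t)\<^sup>2 =
      (\<Sum>u\<in>{- int t..int t}. if int p dvd u + c then ?f u else 0)"
    unfolding pair_count_def of_nat_sum sum_divide_distrib by (intro sum.cong refl) (simp add: f[symmetric])
  also have "\<dots> = (\<Sum>u\<in>{u \<in> {- int t..int t}. int p dvd u + c}. ?f u)"
    by (rule sum.inter_filter[symmetric]) simp
  also have "\<dots> = (\<Sum>n\<in>{n \<in> {- M..M}. \<bar>int p * n - c\<bar> \<le> int t}. ?f (int p * n - c))"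
  proof (rule sum.reindex_bij_witness[of _ "\<lambda>n. int p * n - c" "\<lambda>u. (u + c) div int p"])
    fix u assume u: "u \<in> {u \<in> {- int t..int t}. int p dvd u + c}"
    then obtain n where n: "u + c = int p * n" by (auto elim: dvdE)
    then have d: "(u + c) div int p = n" using p by simp
    have "\<bar>int p * n\<bar> \<le> int p * M" using u n M by auto
    then have "int p * \<bar>n\<bar> \<le> int p * M" by (simp add: abs_mult)
    then have "\<bar>n\<bar> \<le> M" using p by simp
    then show "(u + c) div int p \<in> {n \<in> {- M..M}. \<bar>int p * n - c\<bar> \<le> int t}"
      unfolding d using n u by auto
    show "int p * ((u + c) div int p) - c = u" unfolding d using n by simp
    then show "?f (int p * ((u + c) div int p) - c) = ?f u" by simp
  qed (use p in auto)
  also have "\<dots> = (\<Sum>n\<in>{- M..M}. ?f (int p * n - c))"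
  proof (rule sum.mono_neutral_left)
    show "\<forall>n\<in>{- M..M} - {n \<in> {- M..M}. \<bar>int p * n - c\<bar> \<le> int t}. ?f (int p * n - c) = 0"
    proof
      fix n assume "n \<in> {- M..M} - {n \<in> {- M..M}. \<bar>int p * n - c\<bar> \<le> int t}"
      then have "int t < \<bar>int p * n - c\<bar>" by auto
      then have "real t \<le> \<bar>of_int (int p * n - c)\<bar>" by linarith
      then have "1 - \<bar>of_int (int p * n - c)\<bar> / real t \<le> 0" using t by (simp add: field_simps)
      then show "?f (int p * n - c) = 0" by (simp only: max_absorb1 power_zero_numeral)
    qed
  qed auto
  also have "\<dots> = (\<Sum>n\<in>{- M..M}. (max 0 (1 - \<bar>of_int n - of_int c / real p\<bar> / (real t / real p)))\<^sup>2)"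
  proof (rule sum.cong[OF refl])
    fix n
    have "of_int (int p * n - c) = real p * (of_int n - of_int c / real p)" using p by (simp add: field_simps)
    then have "\<bar>of_int (int p * n - c)\<bar> = real p * \<bar>of_int n - of_int c / real p\<bar>"
      by (metis abs_mult abs_of_nat)
    then have E: "\<bar>of_int (int p * n - c)\<bar> / real t = \<bar>of_int n - of_int c / real p\<bar> / (real t / real p)" by simp
    then show "?f (int p * n - c) = (max 0 (1 - \<bar>of_int n - of_int c / real p\<bar> / (real t / real p)))\<^sup>2"
      by (simp only: E)
  qed
  finally show ?thesis .
qed

section \<open>The limit function\<close>

text \<open>Both sums in \<open>phi\<close> come from this function: the one over positive integers
  from \<gamma> = 0 by symmetry, the other from \<gamma> = T + 2 R.\<close>

definition tent_sum :: "real \<Rightarrow> real \<Rightarrow> real" where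
  "tent_sum T \<gamma> = (\<Sum>\<^sub>\<infinity>n\<in>(UNIV :: int set). (max 0 (1 - \<bar>of_int n - \<gamma>\<bar> / T))\<^sup>2)"

lemma tent_eq_0:
  fixes T \<gamma> :: real
  assumes "T > 0" "T + \<bar>\<gamma>\<bar> \<le> of_int M" "n \<notin> {- M..M}"
  shows "(max 0 (1 - \<bar>of_int n - \<gamma>\<bar> / T))\<^sup>2 = 0"
proof -
  have "of_int M \<le> \<bar>real_of_int n\<bar>" using assms(3) by auto
  then have "T \<le> \<bar>of_int n - \<gamma>\<bar>" using assms(2) by linarith
  then have "1 - \<bar>of_int n - \<gamma>\<bar> / T \<le> 0" using assms(1) by simp
  then show ?thesis by (simp only: max_absorb1 power_zero_numeral)
qed

lemma tent_sum_eq: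
  assumes "T > 0" "T + \<bar>\<gamma>\<bar> \<le> of_int M"
  shows "tent_sum T \<gamma> = (\<Sum>n\<in>{- M..M}. (max 0 (1 - \<bar>of_int n - \<gamma>\<bar> / T))\<^sup>2)"
proof -
  have "tent_sum T \<gamma> = (\<Sum>\<^sub>\<infinity>n\<in>{- M..M}. (max 0 (1 - \<bar>of_int n - \<gamma>\<bar> / T))\<^sup>2)"
    unfolding tent_sum_def using tent_eq_0[OF assms] by (intro infsum_cong_neutral) auto
  then show ?thesis by simp
qed

lemma tent_sum_0:
  assumes T: "T > 0"
  shows "tent_sum T 0 = 1 + 2 * (\<Sum>\<^sub>\<infinity>n\<in>{1::nat..}. (max 0 (1 - real n / T))\<^sup>2)"
proof -
  define N where "N = nat \<lceil>T\<rceil>"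
  have N: "T \<le> real N" unfolding N_def using T by linarith
  let ?f = "\<lambda>x::real. (max 0 (1 - x / T))\<^sup>2"
  have "(\<Sum>\<^sub>\<infinity>n\<in>{1::nat..}. ?f (real n)) = (\<Sum>\<^sub>\<infinity>n\<in>{1..N}. ?f (real n))"
  proof (rule infsum_cong_neutral)
    fix n assume "n \<in> {1..} - {1..N}"
    then have "T \<le> real n" using N by auto
    then have "1 - real n / T \<le> 0" using T by simp
    then show "?f (real n) = 0" by (simp only: max_absorb1 power_zero_numeral)
  qed auto
  then have 1: "(\<Sum>\<^sub>\<infinity>n\<in>{1::nat..}. ?f (real n)) = (\<Sum>n\<in>{1..N}. ?f (real n))" by simp
  have "tent_sum T 0 = (\<Sum>n\<in>{- int N..int N}. ?f \<bar>of_int n\<bar>)"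
    using tent_sum_eq[OF T, of 0 "int N"] N by simp
  also have "{- int N..int N} = insert 0 ({- int N..-1} \<union> {1..int N})" by auto
  also have "(\<Sum>n\<in>insert 0 ({- int N..-1} \<union> {1..int N}). ?f \<bar>of_int n\<bar>) =
      1 + ((\<Sum>n\<in>{- int N..-1}. ?f \<bar>of_int n\<bar>) + (\<Sum>n\<in>{1..int N}. ?f \<bar>of_int n\<bar>))"
    by (subst sum.insert) (auto simp: sum.union_disjoint)
  also have "(\<Sum>n\<in>{- int N..-1}. ?f \<bar>of_int n\<bar>) = (\<Sum>n\<in>{1..N}. ?f (real n))"
    by (rule sum.reindex_bij_witness[of _ "\<lambda>k. - int k" "\<lambda>u. nat (- u)"]) auto
  also have "(\<Sum>n\<in>{1..int N}. ?f \<bar>of_int n\<bar>) = (\<Sum>n\<in>{1..N}. ?f (real n))"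
    by (rule sum.reindex_bij_witness[of _ int nat]) auto
  finally show ?thesis unfolding 1 by simp
qed

lemma phi_eq:
  assumes T: "T > 0"
  shows "phi \<nu> R T = 1 / (2 * tent_sum T 0 + \<nu> * tent_sum T (T + 2 * R) - 2 * (1 + \<nu>) * T / 3 - 1)"
proof -
  have "\<bar>1 + (2 * R - real_of_int n) / T\<bar> = \<bar>of_int n - (T + 2 * R)\<bar> / T" for n
  proof -
    have "1 + (2 * R - real_of_int n) / T = - ((of_int n - (T + 2 * R)) / T)"
      using T by (simp add: field_simps)
    then show ?thesis using T by (simp only: abs_minus_cancel abs_divide abs_of_pos)
  qed
  then show ?thesis unfolding phi_def tent_sum_0[OF T] by (simp add: tent_sum_def algebra_simps)
qed

section \<open>Positivity of the limiting denominator\<close>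

text \<open>The cubic P(z) = z (z + 1/2) (z + 1) / 3 satisfies P(z) - P(z - 1) = z^2, as in the
  formula for a sum of squares. Lowering z by one reduces the claim to -1 <= z <= 0, where P is at
  most 1/60.\<close>

lemma sum_power2_pos_part_ge:
  fixes z :: real
  assumes "- 1 \<le> z" "z \<le> real K"
  shows "z * (z + 1 / 2) * (z + 1) / 3 - 1 / 60 \<le> (\<Sum>j<K. (max 0 (z - real j))\<^sup>2)"
proof -
  have neg: "z * (z + 1 / 2) * (z + 1) / 3 - 1 / 60 \<le> 0" if "- 1 \<le> z" "z \<le> 0" for z :: real
  proof -
    define u where "u = z + 1 / 2"
    have u: "- 1 / 2 \<le> u" "u \<le> 1 / 2" using that by (simp_all add: u_def)
    \<comment> \<open>\<open>u^3 - u / 4\<close> has its maximum on the interval at \<open>- 1 / sqrt 12\<close>, which is close to \<open>- 29 / 100\<close>.\<close>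
    have "0 \<le> (u + 29 / 100)\<^sup>2 * (58 / 100 - u)" using u by (intro mult_nonneg_nonneg) auto
    also have "(u + 29 / 100)\<^sup>2 * (58 / 100 - u) = - (u ^ 3) + 2523 / 10000 * u + 48778 / 1000000"
      by (simp add: power2_eq_square power3_eq_cube field_simps)
    finally have "u ^ 3 - u / 4 \<le> 1 / 20" using u by linarith
    moreover have "z * (z + 1 / 2) * (z + 1) = u ^ 3 - u / 4"
      by (simp add: u_def power3_eq_cube field_simps)
    ultimately show ?thesis by simp
  qed
  from assms show ?thesis
  proof (induction K arbitrary: z)
    case 0
    then show ?case using neg[of z] by simp
  next
    case (Suc K)
    have split: "(\<Sum>j<Suc K. (max 0 (z - real j))\<^sup>2) = (max 0 z)\<^sup>2 + (\<Sum>j<K. (max 0 (z - 1 - real j))\<^sup>2)"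
      unfolding sum.lessThan_Suc_shift by (simp add: algebra_simps)
    show ?case
    proof (cases "0 \<le> z")
      case True
      then have IH: "(z - 1) * (z - 1 + 1 / 2) * (z - 1 + 1) / 3 - 1 / 60 \<le> (\<Sum>j<K. (max 0 (z - 1 - real j))\<^sup>2)"
        using Suc.prems by (intro Suc.IH) auto
      have E: "z * (z + 1 / 2) * (z + 1) / 3 = z\<^sup>2 + (z - 1) * (z - 1 + 1 / 2) * (z - 1 + 1) / 3"
        by (simp add: power2_eq_square field_simps)
      have m: "max 0 z = z" using True by simp
      show ?thesis unfolding split m E add_diff_eq[symmetric] by (rule add_left_mono[OF IH])
    next
      case False
      then have "z * (z + 1 / 2) * (z + 1) / 3 - 1 / 60 \<le> 0" using Suc.prems by (intro neg) auto
      also have "0 \<le> (\<Sum>j<Suc K. (max 0 (z - real j))\<^sup>2)" by (intro sum_nonneg) auto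
      finally show ?thesis .
    qed
  qed
qed

text \<open>The integers from \<gamma> upwards have the distances y + j from it, those below have 1
  - y + j; the terms left out are nonnegative.\<close>

lemma tent_sum_ge_two_sided:
  assumes T: "T > 0" and y: "y = of_int \<lceil>\<gamma>\<rceil> - \<gamma>"
  shows "((\<Sum>j<K. (max 0 (T - y - real j))\<^sup>2) + (\<Sum>j<K. (max 0 (T - 1 + y - real j))\<^sup>2)) / T\<^sup>2 \<le> tent_sum T \<gamma>"
proof -
  let ?f = "\<lambda>n. (max 0 (1 - \<bar>of_int n - \<gamma>\<bar> / T))\<^sup>2"
  define c where "c = \<lceil>\<gamma>\<rceil>"
  define M where "M = \<bar>c\<bar> + int K + \<lceil>T + \<bar>\<gamma>\<bar>\<rceil>"
  have M: "T + \<bar>\<gamma>\<bar> \<le> of_int M" unfolding M_def by linarith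
  have M0: "\<lceil>T + \<bar>\<gamma>\<bar>\<rceil> \<ge> 0" using T by linarith
  have y01: "0 \<le> y" "y < 1" unfolding y by linarith+
  have scale: "(max 0 (1 - a / T))\<^sup>2 = (max 0 (T - a))\<^sup>2 / T\<^sup>2" for a
  proof -
    have "max 0 (1 - a / T) = max 0 (T - a) / T" using T by (simp add: max_def field_simps)
    then show ?thesis by (simp add: power_divide)
  qed
  have up: "?f (c + int j) = (max 0 (T - y - real j))\<^sup>2 / T\<^sup>2" for j
  proof -
    have "of_int (c + int j) - \<gamma> = y + real j" by (simp add: y c_def)
    then have A: "\<bar>of_int (c + int j) - \<gamma>\<bar> = y + real j" using y01 by (simp only: abs_of_nonneg add_nonneg_nonneg of_nat_0_le_iff)
    show ?thesis unfolding scale A by (intro arg_cong[of _ _ "\<lambda>x. (max 0 x)\<^sup>2 / T\<^sup>2"]) simp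
  qed
  have down: "?f (c - 1 - int j) = (max 0 (T - 1 + y - real j))\<^sup>2 / T\<^sup>2" for j
  proof -
    have "of_int (c - 1 - int j) - \<gamma> = - (1 - y + real j)" by (simp add: y c_def)
    then have A: "\<bar>of_int (c - 1 - int j) - \<gamma>\<bar> = 1 - y + real j" using y01 by linarith
    show ?thesis unfolding scale A by (intro arg_cong[of _ _ "\<lambda>x. (max 0 x)\<^sup>2 / T\<^sup>2"]) simp
  qed
  have "{c - int K..<c + int K} \<subseteq> {- M..M}"
    using M0 unfolding M_def by (intro subsetI) (simp only: atLeastLessThan_iff atLeastAtMost_iff, linarith)
  then have "(\<Sum>n\<in>{c - int K..<c + int K}. ?f n) \<le> tent_sum T \<gamma>"
    unfolding tent_sum_eq[OF T M] by (intro sum_mono2) auto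
  moreover have "(\<Sum>n\<in>{c - int K..<c + int K}. ?f n) = (\<Sum>n\<in>{c - int K..<c}. ?f n) + (\<Sum>n\<in>{c..<c + int K}. ?f n)"
    by (subst sum.union_disjoint[symmetric]) (auto intro: sum.cong)
  moreover have "(\<Sum>n\<in>{c - int K..<c}. ?f n) = (\<Sum>j<K. ?f (c - 1 - int j))"
    by (rule sum.reindex_bij_witness[of _ "\<lambda>j. c - 1 - int j" "\<lambda>n. nat (c - 1 - n)"]) auto
  moreover have "(\<Sum>n\<in>{c..<c + int K}. ?f n) = (\<Sum>j<K. ?f (c + int j))"
    by (rule sum.reindex_bij_witness[of _ "\<lambda>j. c + int j" "\<lambda>n. nat (n - c)"]) auto
  ultimately show ?thesis unfolding up down by (simp add: add_divide_distrib sum_divide_distrib)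
qed

text \<open>The cubic bounds of both sides are added. The square of y - 1/2 is kept because for
  integral \<gamma> it equals 1/4, which gives the better bound at \<gamma> = 0.\<close>

lemma tent_sum_ge:
  assumes T: "T > 0" and y: "y = of_int \<lceil>\<gamma>\<rceil> - \<gamma>"
  shows "2 * T / 3 - 1 / (6 * T) + 2 * (y - 1 / 2)\<^sup>2 / T - 1 / (30 * T\<^sup>2) \<le> tent_sum T \<gamma>"
proof -
  define K where "K = nat \<lceil>T\<rceil>"
  have K: "T \<le> real K" unfolding K_def using T by linarith
  have y01: "0 \<le> y" "y < 1" unfolding y by linarith+
  let ?P = "\<lambda>z::real. z * (z + 1 / 2) * (z + 1) / 3 - 1 / 60"
  have "?P (T - y) + ?P (T - 1 + y) \<le> (\<Sum>j<K. (max 0 (T - y - real j))\<^sup>2) + (\<Sum>j<K. (max 0 (T - 1 + y - real j))\<^sup>2)"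
    using T K y01 by (intro add_mono sum_power2_pos_part_ge) auto
  then have "(?P (T - y) + ?P (T - 1 + y)) / T\<^sup>2 \<le> tent_sum T \<gamma>"
    using tent_sum_ge_two_sided[OF T y, of K] T by (meson divide_right_mono order_trans zero_le_power2)
  moreover have "?P (T - y) + ?P (T - 1 + y) = T\<^sup>2 * (2 * T / 3 - 1 / (6 * T) + 2 * (y - 1 / 2)\<^sup>2 / T - 1 / (30 * T\<^sup>2))"
    using T by (simp add: power2_eq_square field_simps)
  ultimately show ?thesis using T by simp
qed

lemma tent_sum_nonneg: "0 \<le> tent_sum T \<gamma>"
  unfolding tent_sum_def by (intro infsum_nonneg) auto

lemma tent_sum_0_ge_1: "T > 0 \<Longrightarrow> 1 \<le> tent_sum T 0"
  unfolding tent_sum_0 by (simp add: infsum_nonneg)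

text \<open>Only the two integers next to \<gamma> are used: their unscaled heights a and b add up
  to at least 2 T - 1, and a^2 + b^2 is at least half the square of a + b.\<close>

lemma tent_sum_ge_half_square:
  assumes T: "T > 1 / 2" shows "(2 * T - 1)\<^sup>2 / (2 * T\<^sup>2) \<le> tent_sum T \<gamma>"
proof -
  have T0: "T > 0" using T by simp
  define y where "y = of_int \<lceil>\<gamma>\<rceil> - \<gamma>"
  define a b where "a = max 0 (T - y)" and "b = max 0 (T - 1 + y)"
  have "2 * T - 1 \<le> a + b" by (simp add: a_def b_def)
  then have "(2 * T - 1)\<^sup>2 \<le> (a + b)\<^sup>2" using T by (intro power_mono) auto
  also have "\<dots> \<le> 2 * (a\<^sup>2 + b\<^sup>2)"
    using zero_le_power2[of "a - b"] by (simp add: power2_eq_square algebra_simps)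
  finally have "(2 * T - 1)\<^sup>2 / (2 * T\<^sup>2) \<le> (a\<^sup>2 + b\<^sup>2) / T\<^sup>2" using T0 by (simp add: field_simps)
  also have "\<dots> \<le> tent_sum T \<gamma>"
    using tent_sum_ge_two_sided[OF T0 y_def, of 1] by (simp add: a_def b_def)
  finally show ?thesis .
qed

text \<open>The expression is affine in \<nu>, so it suffices to treat \<nu> = 0 and \<nu> = 1,
  which are \<open>E0\<close> and \<open>E1\<close>.\<close>

lemma phi_denominator_pos:
  assumes T: "T > 0" and \<nu>: "0 \<le> \<nu>" "\<nu> \<le> 1"
  shows "0 < 2 * tent_sum T 0 + \<nu> * tent_sum T \<gamma> - 2 * (1 + \<nu>) * T / 3 - 1"
proof -
  define E0 where "E0 = 2 * tent_sum T 0 - 2 * T / 3 - 1"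
  define E1 where "E1 = 2 * tent_sum T 0 + tent_sum T \<gamma> - 4 * T / 3 - 1"
  have "0 < E0 \<and> 0 < E1"
  proof (cases "1 \<le> T")
    case True
    have S0: "2 * T / 3 + 1 / (3 * T) - 1 / (30 * T\<^sup>2) \<le> tent_sum T 0"
      using tent_sum_ge[OF T, of 0 0] T by (simp add: power2_eq_square field_simps)
    have S1: "2 * T / 3 - 1 / (6 * T) - 1 / (30 * T\<^sup>2) \<le> tent_sum T \<gamma>"
    proof -
      have "0 \<le> 2 * (of_int \<lceil>\<gamma>\<rceil> - \<gamma> - 1 / 2)\<^sup>2 / T" using T by simp
      then show ?thesis using tent_sum_ge[OF T, of _ \<gamma>, OF refl] by linarith
    qed
    \<comment> \<open>Inserting \<open>S0\<close> and \<open>S1\<close> into \<open>E1\<close> and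
      multiplying by T^2 leaves the cubic 2/3 (T - 1/2)^3 + 1/12 - 1/10, which is at least 1/15 for
      T >= 1.\<close>
    have "1 / 12 \<le> 2 / 3 * (T - 1 / 2) ^ 3"
      using power_mono[of "1 / 2" "T - 1 / 2" 3] True by (simp add: power3_eq_cube)
    then have "0 < 2 / 3 * (T - 1 / 2) ^ 3 + 1 / 12 - 1 / 10" by simp
    also have "\<dots> = T\<^sup>2 * (2 * T / 3 + 1 / (2 * T) - 1 / (10 * T\<^sup>2) - 1)"
      using T by (simp add: power2_eq_square power3_eq_cube field_simps)
    finally have "0 < 2 * T / 3 + 1 / (2 * T) - 1 / (10 * T\<^sup>2) - 1" using T by (simp add: zero_less_mult_iff)
    moreover have "2 * T / 3 + 1 / (2 * T) - 1 / (10 * T\<^sup>2) - 1 =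
      2 * (2 * T / 3 + 1 / (3 * T) - 1 / (30 * T\<^sup>2)) + (2 * T / 3 - 1 / (6 * T) - 1 / (30 * T\<^sup>2)) - 4 * T / 3 - 1"
      using T by (simp add: field_simps)
    ultimately have E1: "0 < E1" unfolding E1_def using S0 S1 by linarith
    have "1 / T\<^sup>2 \<le> 1 / T" using True by (simp add: power2_eq_square field_simps)
    moreover have "1 / (30 * T\<^sup>2) = 1 / T\<^sup>2 / 30" "1 / (3 * T) = 1 / T / 3" by simp_all
    moreover have "1 / T > 0" using T by simp
    moreover have "2 \<le> T + 1 / T"
    proof -
      have "0 \<le> (T - 1)\<^sup>2 / T" using T by simp
      also have "\<dots> = T + 1 / T - 2" using T by (simp add: power2_eq_square field_simps)
      finally show ?thesis by simp
    qed
    ultimately have "0 < E0" unfolding E0_def using S0 True by linarith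
    with E1 show ?thesis by blast
  next
    case False
    have S0: "1 \<le> tent_sum T 0" using tent_sum_0_ge_1[OF T] .
    have "0 < E0" unfolding E0_def using S0 False by simp
    \<comment> \<open>Below 3/4 the bound \<open>tent_sum T 0\<close> >= 1 alone gives E1 >= 1 - 4 T
      / 3 > 0. From 3/4 on the two integers next to \<gamma> contribute as well.\<close>
    moreover have "0 < E1"
    proof (cases "T < 3 / 4")
      case True
      then show ?thesis unfolding E1_def using S0 tent_sum_nonneg[of T \<gamma>] by simp
    next
      case F: False
      define d where "d = 1 - T"
      have d: "0 \<le> d" "d \<le> 1 / 4" using False F by (simp_all add: d_def)
      have "d\<^sup>2 \<le> (1 / 4)\<^sup>2" using d by (intro power_mono) auto
      then have "0 < 1 / 3 - 2 * d\<^sup>2 + 8 / 3 * d ^ 3" using d by (simp add: power2_eq_square add_pos_nonneg)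
      also have "\<dots> = 2 * T\<^sup>2 * (1 - 4 * T / 3 + (2 * T - 1)\<^sup>2 / (2 * T\<^sup>2))"
        unfolding d_def using T by (simp add: power2_eq_square power3_eq_cube field_simps)
      finally have "0 < 1 - 4 * T / 3 + (2 * T - 1)\<^sup>2 / (2 * T\<^sup>2)" using T by (simp add: zero_less_mult_iff)
      then show ?thesis unfolding E1_def using S0 tent_sum_ge_half_square[of T \<gamma>] F by linarith
    qed
    ultimately show ?thesis by blast
  qed
  then have "0 < (1 - \<nu>) * E0 + \<nu> * E1"
    using \<nu> by (cases "\<nu> = 0") (auto intro: add_nonneg_pos)
  also have "\<dots> = 2 * tent_sum T 0 + \<nu> * tent_sum T \<gamma> - 2 * (1 + \<nu>) * T / 3 - 1"
    by (simp add: E0_def E1_def algebra_simps add_divide_distrib diff_divide_distrib)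
  finally show ?thesis .
qed

lemma tendsto_tent_finite_sum:
  fixes f h :: "'a \<Rightarrow> real"
  assumes "(f \<longlongrightarrow> T) F" "(h \<longlongrightarrow> \<gamma>) F" "T > 0"
  shows "((\<lambda>x. \<Sum>n\<in>{- M..M}. (max 0 (1 - \<bar>of_int n - h x\<bar> / f x))\<^sup>2) \<longlongrightarrow>
    (\<Sum>n\<in>{- M..M}. (max 0 (1 - \<bar>of_int n - \<gamma>\<bar> / T))\<^sup>2)) F"
  using assms by (intro tendsto_intros) auto

section \<open>Unions of cyclotomic classes\<close>

lemma GFp_simps:
  "carrier (GFp p) = {0..int p - 1}" "x \<otimes>\<^bsub>GFp p\<^esub> y = (x * y) mod int p"
  "x \<oplus>\<^bsub>GFp p\<^esub> y = (x + y) mod int p" "\<zero>\<^bsub>GFp p\<^esub> = 0" "\<one>\<^bsub>GFp p\<^esub> = 1"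
  by (simp_all add: residue_ring_def)

lemma carrier_mult_of_GFp: "carrier (mult_of (GFp p)) = {1..<int p}"
  by (auto simp: GFp_simps)

lemma nat_pow_mult_of_GFp:
  assumes "p > 1"
  shows "x [^]\<^bsub>mult_of (GFp p)\<^esub> (n :: nat) = x ^ n mod int p"
  using assms by (induction n) (simp_all add: GFp_simps nat_pow_def mod_simps mult.commute)

lemma mult_mult_of_GFp: "x \<otimes>\<^bsub>mult_of (GFp p)\<^esub> y = (x * y) mod int p"
  by (simp add: GFp_simps)

lemma primitive_element_powers:
  assumes p: "prime p" and \<omega>: "primitive_element p \<omega>" and x: "x \<in> {1..<int p}"
  shows "\<exists>k. x = \<omega> ^ k mod int p"
proof -
  have p1: "p > 1" using prime_gt_1_nat[OF p] .
  interpret residues_prime p "GFp p" by unfold_locales (rule p)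
  interpret field "GFp p" by (rule is_field)
  interpret M: group "mult_of (GFp p)" by (rule field_mult_group)
  have "\<omega> \<in> carrier (mult_of (GFp p))" "generate (mult_of (GFp p)) {\<omega>} = carrier (mult_of (GFp p))"
    using \<omega> by (simp_all only: primitive_element_def)
  moreover have "finite (carrier (mult_of (GFp p)))" unfolding carrier_mult_of_GFp by simp
  ultimately have "carrier (mult_of (GFp p)) = {\<omega> [^]\<^bsub>mult_of (GFp p)\<^esub> k | k. k \<in> (UNIV :: nat set)}"
    using M.generate_pow_on_finite_carrier by (simp only:)
  then show ?thesis using x unfolding carrier_mult_of_GFp nat_pow_mult_of_GFp[OF p1] by blast
qed

text \<open>\<open>primitive_element\<close> speaks of the generated subgroup,
  \<open>residue_primroot\<close> of the order. The powers of \<omega> cover p - 1 residues, and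
  there are only \<open>ord p g\<close> of them, so the order is p - 1.\<close>

lemma residue_primroot_primitive_element:
  assumes p: "prime p" and \<omega>: "primitive_element p \<omega>"
  shows "residue_primroot p (nat \<omega>)" "\<omega> = int (nat \<omega>)"
proof -
  have p1: "p > 1" using prime_gt_1_nat[OF p] .
  have w: "\<omega> \<in> {1..<int p}" using \<omega> unfolding primitive_element_def carrier_mult_of_GFp by blast
  then show eq: "\<omega> = int (nat \<omega>)" by simp
  define g where "g = nat \<omega>"
  have g: "0 < g" "g < p" using w by (auto simp: g_def)
  then have "\<not> p dvd g" by (auto dest: dvd_imp_le)
  then have cop: "coprime p g" using p prime_imp_coprime by blast
  have d: "ord p g dvd p - 1" using order_divides_totient[OF cop] p by (simp add: totient_prime)
  have ord0: "ord p g > 0" using cop by simp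
  have "{1..<int p} \<subseteq> (\<lambda>k. int (g ^ k mod p)) ` {..<ord p g}"
  proof
    fix x assume "x \<in> {1..<int p}"
    from primitive_element_powers[OF p \<omega> this] obtain k where k: "x = \<omega> ^ k mod int p" by blast
    have "[k = k mod ord p g] (mod ord p g)" by simp
    then have "[g ^ k = g ^ (k mod ord p g)] (mod p)" using order_divides_expdiff[OF cop] by blast
    moreover have "x = int (g ^ k mod p)" unfolding k by (subst eq) (simp add: g_def zmod_int)
    ultimately have "x = int (g ^ (k mod ord p g) mod p)" by (simp add: cong_def)
    then show "x \<in> (\<lambda>k. int (g ^ k mod p)) ` {..<ord p g}" using ord0 by (intro image_eqI[of _ _ "k mod ord p g"]) auto
  qed
  then have "card {1..<int p} \<le> card {..<ord p g}" by (rule surj_card_le[rotated]) simp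
  then have "p - 1 \<le> ord p g" by simp
  moreover have "ord p g \<le> p - 1" using d p1 by (intro dvd_imp_le) auto
  ultimately have "ord p g = totient p" using p by (simp add: totient_prime)
  then show "residue_primroot p (nat \<omega>)" using cop p1 by (simp add: residue_primroot_def g_def)
qed

section \<open>The sequence attached to a union of classes\<close>

locale cyclotomic_set =
  fixes m p :: nat and S :: "int set" and \<omega> v :: int and D :: "int set"
  assumes m: "m > 0" and even_m: "even m" and S: "S \<subseteq> {0..int m - 1}" and card_S: "card S = m div 2"
    and p: "prime p" and p_mod: "[p = 1] (mod m)" and \<omega>: "primitive_element p \<omega>"
    and D: "D = (\<Union>s\<in>S. cyclotomic_class p m \<omega> s)" and v: "additive_generator p v"
begin

definition g :: nat where "g = nat \<omega>"
definition q :: nat where "q = (p - 1) div m"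

lemma p0: "p > 0" and p1: "p > 1" and p2: "p \<ge> 2"
  using p prime_gt_0_nat prime_gt_1_nat prime_ge_2_nat by auto

lemma m_dvd: "m dvd p - 1"
  using p_mod p1 by (metis One_nat_def cong_altdef_nat cong_sym less_imp_le_nat)

lemma qm: "q * m = p - 1"
  using m_dvd by (simp add: q_def)

lemma q0: "q > 0"
  using qm p1 by (cases "q = 0") auto

lemma primroot: "residue_primroot p g" and int_g: "int g = \<omega>"
  using residue_primroot_primitive_element[OF p \<omega>] by (simp_all add: g_def)

lemma primroot_power_eq_iff: "[int g ^ e = int g ^ f] (mod int p) \<longleftrightarrow> [e = f] (mod (p - 1))"
proof -
  have "coprime p g" "ord p g = p - 1" using primroot p by (simp_all add: residue_primroot_def totient_prime)
  then have "[g ^ e = g ^ f] (mod p) \<longleftrightarrow> [e = f] (mod (p - 1))" using order_divides_expdiff by metis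
  then show ?thesis by (metis cong_int_iff of_nat_power)
qed

definition cls_sign :: "int \<Rightarrow> real" where
  "cls_sign s = (if s mod int m \<in> S then 1 else -1)"

lemma cls_sign_mod: "cls_sign (s mod int m) = cls_sign s"
  by (simp add: cls_sign_def)

lemma mem_D_cases:
  assumes "y \<in> D"
  obtains s x where "s \<in> S" "x \<in> {1..<int p}" "y = (int g ^ nat s * x ^ m) mod int p"
proof -
  obtain s where s: "s \<in> S" "y \<in> cyclotomic_class p m \<omega> s" using assms unfolding D by blast
  then obtain c where c: "c \<in> mth_powers p m" "y = \<omega> [^]\<^bsub>mult_of (GFp p)\<^esub> s \<otimes>\<^bsub>mult_of (GFp p)\<^esub> c"
    unfolding cyclotomic_class_def by blast
  then obtain x where x: "x \<in> {1..<int p}" "c = x [^]\<^bsub>mult_of (GFp p)\<^esub> m"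
    unfolding mth_powers_def carrier_mult_of_GFp by blast
  have "s \<ge> 0" using s(1) S by auto
  then have "\<omega> [^]\<^bsub>mult_of (GFp p)\<^esub> s = int g ^ nat s mod int p"
    using int_pow_int[of "mult_of (GFp p)" \<omega> "nat s"] by (simp add: nat_pow_mult_of_GFp[OF p1] int_g)
  then have "y = (int g ^ nat s * x ^ m) mod int p"
    unfolding c(2) x(2) mult_mult_of_GFp nat_pow_mult_of_GFp[OF p1] by (simp add: mod_simps)
  then show ?thesis using that s(1) x(1) by blast
qed

text \<open>Exponents of a primitive root are determined modulo p - 1, hence modulo its divisor m,
  where they name the class.\<close>

lemma primroot_power_mem_D: "int g ^ e mod int p \<in> D \<longleftrightarrow> int e mod int m \<in> S"
proof
  assume "int g ^ e mod int p \<in> D"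
  then obtain s x where s: "s \<in> S" and x: "x \<in> {1..<int p}"
    and eq: "int g ^ e mod int p = (int g ^ nat s * x ^ m) mod int p"
    by (rule mem_D_cases)
  obtain k where k: "x = \<omega> ^ k mod int p" using primitive_element_powers[OF p \<omega> x] by blast
  have s': "s \<ge> 0" "s < int m" using s S by auto
  have "x ^ m mod int p = (int g ^ k) ^ m mod int p"
    unfolding k int_g by (rule power_mod)
  then have "[x ^ m = int g ^ (k * m)] (mod int p)" by (simp add: cong_def power_mult)
  then have "[int g ^ nat s * x ^ m = int g ^ nat s * int g ^ (k * m)] (mod int p)"
    by (rule cong_scalar_left)
  then have "[int g ^ e = int g ^ (nat s + k * m)] (mod int p)"
    using eq by (simp only: cong_def power_add)
  then have "[e = nat s + k * m] (mod (p - 1))" by (simp only: primroot_power_eq_iff)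
  then have "[e = nat s + k * m] (mod m)" using m_dvd by (rule cong_dvd_modulus_nat)
  then have "int e mod int m = int (nat s + k * m) mod int m" by (metis cong_def cong_int_iff)
  then show "int e mod int m \<in> S" using s s' by simp
next
  assume mem: "int e mod int m \<in> S"
  have eq: "\<omega> [^]\<^bsub>mult_of (GFp p)\<^esub> (int e mod int m) = int g ^ (e mod m) mod int p"
    using int_pow_int[of "mult_of (GFp p)" \<omega> "e mod m"]
    by (simp add: nat_pow_mult_of_GFp[OF p1] int_g zmod_int)
  define x where "x = int g ^ (e div m) mod int p"
  have x: "x \<in> {1..<int p}"
  proof -
    have "x \<noteq> 0" unfolding x_def using primroot_power_not_dvd[OF p primroot] by (simp add: dvd_eq_mod_eq_0)
    moreover have "0 \<le> x" "x < int p" using p0 by (simp_all add: x_def)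
    ultimately show ?thesis by simp
  qed
  have "int g ^ e = int g ^ (e mod m) * (int g ^ (e div m)) ^ m"
    by (metis mod_mult_div_eq mult.commute power_add power_mult)
  then have "int g ^ e mod int p = (int g ^ (e mod m) mod int p) \<otimes>\<^bsub>mult_of (GFp p)\<^esub> (x [^]\<^bsub>mult_of (GFp p)\<^esub> m)"
    unfolding mult_mult_of_GFp nat_pow_mult_of_GFp[OF p1] x_def by (simp add: mod_simps)
  then have "int g ^ e mod int p \<in> cyclotomic_class p m \<omega> (int e mod int m)"
    unfolding cyclotomic_class_def mth_powers_def carrier_mult_of_GFp eq using x by blast
  then show "int g ^ e mod int p \<in> D" unfolding D using mem by blast
qed

lemma D_subset: "D \<subseteq> {1..<int p}"
proof
  fix y assume "y \<in> D"
  then obtain s x where x: "x \<in> {1..<int p}" and y: "y = (int g ^ nat s * x ^ m) mod int p"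
    by (rule mem_D_cases)
  have pp: "prime (int p)" using p by simp
  have "\<not> int p dvd x" using x by (auto dest: zdvd_imp_le)
  then have "\<not> int p dvd int g ^ nat s * x ^ m"
    using pp primroot_power_not_dvd[OF p primroot] by (metis prime_dvd_mult_iff prime_dvd_power)
  then have "y \<noteq> 0" unfolding y by (simp add: dvd_eq_mod_eq_0)
  moreover have "0 \<le> y" "y < int p" using p0 by (simp_all add: y)
  ultimately show "y \<in> {1..<int p}" by simp
qed

definition b :: "int \<Rightarrow> real" where
  "b y = (if y mod int p \<in> D then 1 else -1)"

text \<open>Multiplication by v permutes the classes, so \<open>a\<close> is again constant on them,
  and complete sums do not depend on v.\<close>

definition a :: "int \<Rightarrow> real" where
  "a x = b (x * v)"

lemma v_not_dvd: "\<not> int p dvd v"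
proof -
  have "v \<in> {1..<int p}" using v unfolding additive_generator_def carrier_mult_of_GFp by blast
  then show ?thesis by (auto dest: zdvd_imp_le)
qed

lemma b_mod: "b (y mod int p) = b y"
  by (simp add: b_def)

lemma a_mod: "a (x mod int p) = a x"
  unfolding a_def using b_mod[of "x mod int p * v"] b_mod[of "x * v"] by (simp add: mod_simps)

lemma b_primroot: "b (int g ^ e) = cls_sign (int e)"
  unfolding b_def cls_sign_def primroot_power_mem_D ..

lemma b_0: "b 0 = -1"
  using D_subset by (auto simp: b_def)

lemma b_pm: "b x = 1 \<or> b x = -1"
  by (simp add: b_def)

lemma b_cong: "[x = y] (mod int p) \<Longrightarrow> b x = b y"
  by (simp add: b_def cong_def)

lemma class_function_b: "class_function p q b"
  unfolding class_function_def
proof (intro conjI allI impI)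
  fix x y assume x: "\<not> int p dvd x" and y: "\<not> int p dvd y" and xy: "[x ^ q = y ^ q] (mod int p)"
  obtain e where e: "[x = int g ^ e] (mod int p)" using primroot_power_exists[OF p primroot x] by blast
  obtain f where f: "[y = int g ^ f] (mod int p)" using primroot_power_exists[OF p primroot y] by blast
  have "[int g ^ (e * q) = x ^ q] (mod int p)" "[y ^ q = int g ^ (f * q)] (mod int p)"
    using cong_pow[OF e, of q] cong_pow[OF f, of q] by (simp_all add: power_mult cong_sym)
  then have "[int g ^ (e * q) = int g ^ (f * q)] (mod int p)" using xy cong_trans by blast
  then have "[e * q = f * q] (mod (q * m))" unfolding primroot_power_eq_iff qm .
  then have "e * q mod (q * m) = f * q mod (q * m)" by (simp add: cong_def)
  then have "q * (e mod m) = q * (f mod m)" by (simp add: mult_mod_right mult.commute)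
  then have "int (e mod m) = int (f mod m)" using q0 by simp
  then have "int e mod int m = int f mod int m" by (simp add: zmod_int)
  then have "cls_sign (int e) = cls_sign (int f)" by (simp add: cls_sign_def)
  then show "b x = b y" using b_cong[OF e] b_cong[OF f] by (simp add: b_primroot)
qed (rule b_mod)

lemma class_function_a: "class_function p q a"
  unfolding class_function_def
proof (intro conjI allI impI)
  fix x y assume "\<not> int p dvd x" "\<not> int p dvd y" and xy: "[x ^ q = y ^ q] (mod int p)"
  moreover have pp: "prime (int p)" using p by simp
  ultimately have "\<not> int p dvd x * v" "\<not> int p dvd y * v" using v_not_dvd by (auto simp: prime_dvd_mult_iff)
  moreover have "[(x * v) ^ q = (y * v) ^ q] (mod int p)"
    unfolding power_mult_distrib using xy by (intro cong_mult cong_refl)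
  ultimately show "a x = a y" using class_function_b unfolding a_def class_function_def by blast
qed (rule a_mod)

lemma sum_over_mod_m: "(\<Sum>e<p - 1. h (int e mod int m)) = real q * (\<Sum>s\<in>{0..<int m}. h s)"
proof -
  have "(\<Sum>e<p - 1. h (int e mod int m)) = (\<Sum>e<q * m. (\<lambda>s. h (int s)) (e mod m))"
    unfolding qm by (simp add: zmod_int)
  also have "\<dots> = real q * (\<Sum>s<m. h (int s))" by (rule sum_mod_blocks)
  also have "(\<Sum>s<m. h (int s)) = (\<Sum>s\<in>{0..<int m}. h s)"
    by (rule sum.reindex_bij_witness[of _ nat int]) auto
  finally show ?thesis .
qed

lemma sum_residues_split: "(\<Sum>x\<in>{0..<int p}. f x) = f 0 + (\<Sum>x\<in>{1..<int p}. (f x :: real))"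
proof -
  have "{0..<int p} = insert 0 {1..<int p}" using p1 by auto
  then show ?thesis by simp
qed

lemma finite_S: "finite S"
  using S finite_subset by blast

lemma sum_mem_S: "(\<Sum>s\<in>{0..<int m}. if s mod int m \<in> S then 1 else 0) = real m / 2"
proof -
  have "(\<Sum>s\<in>{0..<int m}. if s mod int m \<in> S then 1 else 0) = (\<Sum>s\<in>{0..<int m}. if s \<in> S then 1 else (0::real))"
    by (rule sum.cong) auto
  also have "\<dots> = real (card ({0..<int m} \<inter> S))" by (simp add: sum.If_cases)
  also have "{0..<int m} \<inter> S = S" using S by auto
  also have "real (card S) = real m / 2" unfolding card_S using even_m by (simp add: real_of_nat_div)
  finally show ?thesis .
qed

lemma cls_sign_eq: "cls_sign s = 2 * (if s mod int m \<in> S then 1 else 0) - 1"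
  by (simp add: cls_sign_def)

lemma sum_cls_sign: "(\<Sum>s\<in>{0..<int m}. cls_sign s) = 0"
  unfolding cls_sign_eq sum_subtractf sum_distrib_left[symmetric] sum_mem_S by simp

lemma sum_b: "(\<Sum>x\<in>{0..<int p}. b x) = -1"
proof -
  have "(\<Sum>x\<in>{1..<int p}. b x) = (\<Sum>e<p - 1. b (int g ^ e))" by (rule sum_primroot_powers) (simp_all add: p primroot b_mod)
  also have "\<dots> = (\<Sum>e<p - 1. cls_sign (int e mod int m))" unfolding b_primroot cls_sign_mod ..
  also have "\<dots> = real q * (\<Sum>s\<in>{0..<int m}. cls_sign s)" by (rule sum_over_mod_m)
  also have "\<dots> = 0" by (simp add: sum_cls_sign)
  finally show ?thesis unfolding sum_residues_split b_0 by simp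
qed

lemma sum_mult_v:
  assumes "\<And>x. f (x mod int p) = f x"
  shows "(\<Sum>x\<in>{0..<int p}. f (x * v)) = (\<Sum>x\<in>{0..<int p}. f x)"
  using sum_residues_mult[OF p v_not_dvd, of f] assms by (simp add: mult.commute)

sublocale seq: balanced_class_sequence m p g a
proof
  show "(\<Sum>x\<in>{0..<int p}. a x) = -1" unfolding a_def sum_mult_v[of b, OF b_mod] by (rule sum_b)
  show "class_function p ((p - 1) div m) a" using class_function_a by (simp add: q_def)
  show "a x = 1 \<or> a x = -1" for x unfolding a_def by (rule b_pm)
qed (rule m p m_dvd primroot)+

section \<open>Reflection and translates of D\<close>

text \<open>Since -1 = g^((p - 1) / 2), reflection shifts the index of a class by (p - 1) / 2. This
  is the normalized correlation of the class signs under that shift, and its square is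
  \<nu>.\<close>

definition refl_ratio :: real where
  "refl_ratio = (\<Sum>s\<in>{0..<int m}. cls_sign s * cls_sign (s + int ((p - 1) div 2))) / real m"

lemma reflection_corr_eq: "seq.reflection_corr = 1 + real (p - 1) * refl_ratio"
proof -
  define h where "h = (p - 1) div 2"
  have "even (p - 1)" using even_m m_dvd by (meson dvd_trans)
  then obtain k where "p - 1 = 2 * k" by (elim evenE)
  then have h: "h + h = p - 1" unfolding h_def by simp
  have minus: "[- 1 = int g ^ h] (mod int p)"
  proof -
    have "[int g ^ (h + h) = 1] (mod int p)" unfolding h by (rule primroot_power_order[OF p primroot])
    then have "int p dvd (int g ^ h) * (int g ^ h) - 1" by (simp add: cong_iff_dvd_diff power_add)
    also have "(int g ^ h) * (int g ^ h) - 1 = (int g ^ h - 1) * (int g ^ h + 1)" by (simp add: algebra_simps)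
    finally have "int p dvd (int g ^ h - 1) \<or> int p dvd (int g ^ h + 1)" using p by (simp add: prime_dvd_mult_iff)
    moreover have "\<not> int p dvd int g ^ h - 1"
    proof
      assume "int p dvd int g ^ h - 1"
      then have "[int g ^ h = int g ^ 0] (mod int p)" by (simp add: cong_iff_dvd_diff)
      then have "[h = 0] (mod (p - 1))" unfolding primroot_power_eq_iff .
      then have "p - 1 dvd h" by (simp add: cong_0_iff)
      moreover have "h < p - 1" "h > 0" using h p1 by linarith+
      ultimately show False by (auto dest: dvd_imp_le)
    qed
    ultimately have "int p dvd int g ^ h - - 1" by simp
    then have "[int g ^ h = - 1] (mod int p)" by (simp only: cong_iff_dvd_diff)
    then show ?thesis by (rule cong_sym)
  qed
  have bm: "b (- (int g ^ e)) = cls_sign (int e + int h)" for e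
  proof -
    have "[- 1 * int g ^ e = int g ^ h * int g ^ e] (mod int p)" using minus by (intro cong_mult cong_refl)
    then have "b (- (int g ^ e)) = b (int g ^ (e + h))" by (intro b_cong) (simp add: power_add mult.commute)
    then show ?thesis by (simp add: b_primroot)
  qed
  have "seq.reflection_corr = (\<Sum>x\<in>{0..<int p}. (\<lambda>y. b y * b (- y)) (x * v))"
    by (simp add: seq.reflection_corr_def a_def)
  also have "\<dots> = (\<Sum>x\<in>{0..<int p}. b x * b (- x))"
  proof (rule sum_mult_v)
    show "b (x mod int p) * b (- (x mod int p)) = b x * b (- x)" for x
      using b_mod[of "- (x mod int p)"] b_mod[of "- x"] by (simp add: b_mod mod_simps)
  qed
  also have "\<dots> = 1 + (\<Sum>x\<in>{1..<int p}. b x * b (- x))" unfolding sum_residues_split by (simp add: b_0)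
  also have "(\<Sum>x\<in>{1..<int p}. b x * b (- x)) = (\<Sum>e<p - 1. b (int g ^ e) * b (- (int g ^ e)))"
  proof (rule sum_primroot_powers[OF p primroot])
    show "b (x mod int p) * b (- (x mod int p)) = b x * b (- x)" for x
      using b_mod[of "- (x mod int p)"] b_mod[of "- x"] by (simp add: b_mod mod_simps)
  qed
  also have "\<dots> = (\<Sum>e<p - 1. (\<lambda>s. cls_sign s * cls_sign (s + int h)) (int e mod int m))"
  proof (rule sum.cong[OF refl])
    fix e
    have "cls_sign (int e mod int m + int h) = cls_sign (int e + int h)" by (simp add: cls_sign_def mod_simps)
    then show "b (int g ^ e) * b (- (int g ^ e)) = (\<lambda>s. cls_sign s * cls_sign (s + int h)) (int e mod int m)"
      by (simp add: b_primroot bm cls_sign_mod)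
  qed
  also have "\<dots> = real q * (\<Sum>s\<in>{0..<int m}. cls_sign s * cls_sign (s + int h))" by (rule sum_over_mod_m)
  also have "\<dots> = real (p - 1) * refl_ratio"
  proof -
    have "real (p - 1) = real q * real m" unfolding qm[symmetric] by simp
    then show ?thesis unfolding refl_ratio_def h_def using m by simp
  qed
  finally show ?thesis .
qed

text \<open>Here (p - 1) / 2 is a multiple of m, so -1 is an m-th power and reflection preserves
  every class.\<close>

lemma refl_ratio_even: assumes "even q" shows "refl_ratio = 1"
proof -
  obtain k where k: "q = 2 * k" using assms by (elim evenE)
  have "p - 1 = 2 * (k * m)" unfolding qm[symmetric] k by simp
  then have "(p - 1) div 2 = k * m" by simp
  then have "cls_sign (s + int ((p - 1) div 2)) = cls_sign s" for s by (simp add: cls_sign_def)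
  moreover have "cls_sign s * cls_sign s = 1" for s by (simp add: cls_sign_def)
  ultimately show ?thesis using m by (simp add: refl_ratio_def)
qed

definition N :: nat where
  "N = card {(s, s'). s \<in> S \<and> s' \<in> S \<and> [s - s' = int (m div 2)] (mod int m)}"

lemma N_eq: "N = card {s \<in> S. (s + int (m div 2)) mod int m \<in> S}"
proof -
  have "bij_betw snd {(s, s'). s \<in> S \<and> s' \<in> S \<and> [s - s' = int (m div 2)] (mod int m)}
    {s \<in> S. (s + int (m div 2)) mod int m \<in> S}"
  proof (rule bij_betwI[of _ _ _ "\<lambda>s'. ((s' + int (m div 2)) mod int m, s')"])
    have key: "s = (s' + int (m div 2)) mod int m" if "s \<in> S" "[s - s' = int (m div 2)] (mod int m)" for s s'
    proof -
      have "[s = s' + int (m div 2)] (mod int m)" using that(2) by (simp add: cong_iff_dvd_diff algebra_simps)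
      moreover have "s mod int m = s" using that(1) S by auto
      ultimately show ?thesis by (simp add: cong_def)
    qed
    show "snd \<in> {(s, s'). s \<in> S \<and> s' \<in> S \<and> [s - s' = int (m div 2)] (mod int m)} \<rightarrow>
      {s \<in> S. (s + int (m div 2)) mod int m \<in> S}"
      using key by fastforce
    show "(\<lambda>s'. ((s' + int (m div 2)) mod int m, s')) \<in> {s \<in> S. (s + int (m div 2)) mod int m \<in> S} \<rightarrow>
      {(s, s'). s \<in> S \<and> s' \<in> S \<and> [s - s' = int (m div 2)] (mod int m)}"
      by (auto simp: cong_def mod_simps)
    show "((snd x + int (m div 2)) mod int m, snd x) = x"
      if "x \<in> {(s, s'). s \<in> S \<and> s' \<in> S \<and> [s - s' = int (m div 2)] (mod int m)}" for x
      using that key by auto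
  qed auto
  then show ?thesis unfolding N_def by (rule bij_betw_same_card)
qed

text \<open>For odd q the shift (p - 1) / 2 is congruent to m / 2 modulo m. Writing the signs as 2 i
  - 1 with the indicator i of S, the correlation is 4 N - m - m + m.\<close>

lemma refl_ratio_odd: assumes "odd q" shows "refl_ratio = 4 * real N / real m - 1"
proof -
  define h where "h = int (m div 2)"
  let ?i = "\<lambda>s. if s mod int m \<in> S then 1 else (0 :: real)"
  obtain k where k: "q = 2 * k + 1" using assms by (elim oddE)
  have half: "((2 * k + 1) * M) div 2 = k * M + M div 2" if "even M" for M :: nat
    using that by (elim evenE) (simp add: algebra_simps)
  have "p - 1 = (2 * k + 1) * m" unfolding qm[symmetric] k ..
  then have "(p - 1) div 2 = k * m + m div 2" using half[OF even_m] by simp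
  then have "int ((p - 1) div 2) = int k * int m + h" by (simp add: h_def)
  then have eq: "cls_sign (s + int ((p - 1) div 2)) = cls_sign (s + h)" for s
    by (simp add: cls_sign_def add.left_commute[of s] mod_simps)
  have shift: "(\<Sum>s\<in>{0..<int m}. ?i (s + h)) = (\<Sum>s\<in>{0..<int m}. ?i s)"
    by (rule sum_residues_add[OF m]) simp
  have "(\<Sum>s\<in>{0..<int m}. ?i s * ?i (s + h)) = real N"
  proof -
    have "(\<Sum>s\<in>{0..<int m}. ?i s * ?i (s + h)) = (\<Sum>s\<in>{0..<int m}. if s \<in> S \<and> (s + h) mod int m \<in> S then 1 else 0)"
      by (rule sum.cong) auto
    also have "\<dots> = real (card ({0..<int m} \<inter> {s. s \<in> S \<and> (s + h) mod int m \<in> S}))" by (simp add: sum.If_cases)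
    also have "{0..<int m} \<inter> {s. s \<in> S \<and> (s + h) mod int m \<in> S} = {s \<in> S. (s + int (m div 2)) mod int m \<in> S}"
      using S by (auto simp: h_def)
    finally show ?thesis by (simp add: N_eq)
  qed
  moreover have "(\<Sum>s\<in>{0..<int m}. cls_sign s * cls_sign (s + h)) =
      4 * (\<Sum>s\<in>{0..<int m}. ?i s * ?i (s + h)) - 2 * (\<Sum>s\<in>{0..<int m}. ?i s) - 2 * (\<Sum>s\<in>{0..<int m}. ?i (s + h)) + real m"
    unfolding cls_sign_eq by (simp add: algebra_simps sum.distrib sum_subtractf sum_distrib_left)
  ultimately have "(\<Sum>s\<in>{0..<int m}. cls_sign s * cls_sign (s + h)) = 4 * real N - real m"
    unfolding shift sum_mem_S by simp
  then show ?thesis unfolding refl_ratio_def eq using m by (simp add: diff_divide_distrib)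
qed

text \<open>This places 4 N / m - 1 between -1 and 1, so that \<nu> <= 1, as the positivity of the
  limiting denominator requires.\<close>

lemma N_le: "2 * N \<le> m"
proof -
  have "N \<le> card S" unfolding N_eq by (rule card_mono[OF finite_S]) auto
  then show ?thesis using card_S even_m by auto
qed

lemma card_D: "2 * real (card D) = real p - 1"
proof -
  have "(\<Sum>x\<in>{0..<int p}. b x) = (\<Sum>x\<in>{0..<int p}. 2 * (if x \<in> D then 1 else 0) - 1)"
    by (rule sum.cong) (auto simp: b_def)
  also have "\<dots> = 2 * (\<Sum>x\<in>{0..<int p}. if x \<in> D then 1 else 0) - real p"
    by (simp add: sum_subtractf sum_distrib_left)
  also have "(\<Sum>x\<in>{0..<int p}. if x \<in> D then 1 else 0) = real (card ({0..<int p} \<inter> D))" by (simp add: sum.If_cases)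
  also have "{0..<int p} \<inter> D = D" using D_subset by auto
  finally show ?thesis using sum_b by simp
qed

text \<open>With 2 |D| = p - 1 the linear terms contribute -2 (p - 1). If k is the deviation of the
  intersection from p / 4, the autocorrelation is 4 k + 2.\<close>

lemma autocorr_b: "autocorr p b u = 4 * real (card (translate p D u \<inter> D)) - real p + 2"
proof -
  let ?i = "\<lambda>x. if x mod int p \<in> D then 1 else (0 :: real)"
  have D_eq: "{0..<int p} \<inter> D = D" using D_subset by auto
  have b: "b x = 2 * ?i x - 1" for x by (simp add: b_def)
  have sD: "(\<Sum>x\<in>{0..<int p}. ?i x) = real (card D)"
  proof -
    have "(\<Sum>x\<in>{0..<int p}. ?i x) = (\<Sum>x\<in>{0..<int p}. if x \<in> D then 1 else 0)" by (rule sum.cong) auto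
    then show ?thesis by (simp add: sum.If_cases D_eq)
  qed
  have shift: "(\<Sum>x\<in>{0..<int p}. ?i (x + u)) = real (card D)"
    unfolding sD[symmetric] by (rule sum_residues_add[OF p0]) simp
  have "(\<Sum>x\<in>{0..<int p}. ?i x * ?i (x + u)) = real (card (translate p D u \<inter> D))"
  proof -
    have "(\<Sum>x\<in>{0..<int p}. ?i x * ?i (x + u)) = (\<Sum>x\<in>{0..<int p}. if x \<in> D \<and> (x + u) mod int p \<in> D then 1 else 0)"
      by (rule sum.cong) auto
    also have "\<dots> = real (card ({0..<int p} \<inter> {x. x \<in> D \<and> (x + u) mod int p \<in> D}))" by (simp add: sum.If_cases)
    also have "{0..<int p} \<inter> {x. x \<in> D \<and> (x + u) mod int p \<in> D} = {x \<in> D. (x + u) mod int p \<in> D}"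
      using D_eq by auto
    also have "card {x \<in> D. (x + u) mod int p \<in> D} = card ((\<lambda>x. (x + u) mod int p) ` {x \<in> D. (x + u) mod int p \<in> D})"
    proof (rule card_image[symmetric])
      show "inj_on (\<lambda>x. (x + u) mod int p) {x \<in> D. (x + u) mod int p \<in> D}"
        using bij_betw_mod_add[OF p0, of u] D_eq unfolding bij_betw_def by (auto intro: inj_on_subset)
    qed
    also have "(\<lambda>x. (x + u) mod int p) ` {x \<in> D. (x + u) mod int p \<in> D} = translate p D u \<inter> D"
      by (auto simp: translate_def GFp_simps)
    finally show ?thesis .
  qed
  moreover have "autocorr p b u = 4 * (\<Sum>x\<in>{0..<int p}. ?i x * ?i (x + u)) - 2 * (\<Sum>x\<in>{0..<int p}. ?i x)
      - 2 * (\<Sum>x\<in>{0..<int p}. ?i (x + u)) + real p"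
    unfolding autocorr_def b by (simp add: algebra_simps sum.distrib sum_subtractf sum_distrib_left)
  ultimately show ?thesis unfolding sD shift using card_D by simp
qed

text \<open>The term u = 0 equals p^2. The others are estimated by (4 k + 2)^2 <= 32 k^2 + 8, with k
  the deviation from p / 4.\<close>

lemma total_corr_bounds:
  defines "H \<equiv> \<Sum>u\<in>carrier (mult_of (GFp p)). (real (card (translate p D u \<inter> D)) - real p / 4)\<^sup>2"
  shows "(real p)\<^sup>2 \<le> seq.total_corr" "seq.total_corr \<le> (real p)\<^sup>2 + 32 * H + 8 * real p"
proof -
  have "autocorr p a u = autocorr p b (u * v)" for u
  proof -
    have "autocorr p a u = (\<Sum>x\<in>{0..<int p}. (\<lambda>z. b z * b (z + u * v)) (x * v))"
      by (simp add: autocorr_def a_def distrib_right)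
    also have "\<dots> = autocorr p b (u * v)" unfolding autocorr_def
    proof (rule sum_mult_v)
      show "b (x mod int p) * b (x mod int p + u * v) = b x * b (x + u * v)" for x
        using b_mod[of "x mod int p + u * v"] b_mod[of "x + u * v"] by (simp add: b_mod mod_simps)
    qed
    finally show ?thesis .
  qed
  then have "seq.total_corr = (\<Sum>u\<in>{0..<int p}. (autocorr p b (u * v))\<^sup>2)" by (simp add: seq.total_corr_def)
  also have "\<dots> = (\<Sum>u\<in>{0..<int p}. (autocorr p b u)\<^sup>2)"
    by (rule sum_mult_v) (simp add: autocorr_mod b_mod)
  also have "\<dots> = (real p)\<^sup>2 + (\<Sum>u\<in>{1..<int p}. (autocorr p b u)\<^sup>2)"
  proof -
    have "b x * b x = 1" for x using b_pm[of x] by auto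
    then have "autocorr p b 0 = real p" by (simp add: autocorr_def)
    then show ?thesis unfolding sum_residues_split by simp
  qed
  finally have tc: "seq.total_corr = (real p)\<^sup>2 + (\<Sum>u\<in>{1..<int p}. (autocorr p b u)\<^sup>2)" .
  show "(real p)\<^sup>2 \<le> seq.total_corr" unfolding tc by (simp add: sum_nonneg)
  have "(\<Sum>u\<in>{1..<int p}. (autocorr p b u)\<^sup>2) \<le>
      (\<Sum>u\<in>{1..<int p}. 32 * (real (card (translate p D u \<inter> D)) - real p / 4)\<^sup>2 + 8)"
  proof (rule sum_mono)
    fix u
    define k where "k = real (card (translate p D u \<inter> D)) - real p / 4"
    have "autocorr p b u = 4 * k + 2" by (simp add: autocorr_b k_def)
    moreover have "0 \<le> (4 * k - 2)\<^sup>2" by simp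
    ultimately have "(autocorr p b u)\<^sup>2 \<le> 32 * k\<^sup>2 + 8" by (simp add: power2_eq_square algebra_simps)
    then show "(autocorr p b u)\<^sup>2 \<le> 32 * (real (card (translate p D u \<inter> D)) - real p / 4)\<^sup>2 + 8"
      by (simp only: k_def)
  qed
  also have "\<dots> = 32 * H + 8 * real (p - 1)"
    unfolding H_def carrier_mult_of_GFp sum.distrib sum_distrib_left using p1
    by (simp add: nat_diff_distrib' of_nat_diff)
  also have "\<dots> \<le> 32 * H + 8 * real p" by simp
  finally show "seq.total_corr \<le> (real p)\<^sup>2 + 32 * H + 8 * real p" unfolding tc by simp
qed

lemma characteristic_poly_eq: "characteristic_poly p D v r t = seq_poly (\<lambda>j. a (int j + r)) t"
proof -
  have "pm_indicator D (((int j + r) mod int p) \<otimes>\<^bsub>GFp p\<^esub> v) = of_real (a (int j + r))" for j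
    by (simp add: pm_indicator_def GFp_simps a_def b_def mod_simps)
  then show ?thesis by (simp add: characteristic_poly_def seq_poly_def)
qed

lemma merit_factor_eq:
  "merit_factor (characteristic_poly p D v r t) = (real t)\<^sup>2 / (quad_sum a t r - (real t)\<^sup>2)"
  unfolding characteristic_poly_eq quad_sum_def
  by (rule merit_factor_seq_poly[OF _ quad_sum_nonneg]) (simp add: power2_eq_square seq.a_sq)

end

section \<open>Asymptotics of the merit factor\<close>

text \<open>Apart from the four factors of order log p, the error relative to t^2 is of order
  p^(-1/2). Writing this as the fourth power of p^(-1/8) gives each factor its own share.\<close>

lemma quad_sum_error_tendsto_0:
  fixes t :: "nat \<Rightarrow> nat" and C T :: real
  assumes F: "F \<le> at_top" and t: "((\<lambda>p. real (t p) / real p) \<longlongrightarrow> T) F" and T: "T > 0"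
  shows "((\<lambda>p. C * (real p * sqrt p) * (2 * real (t p) + real p * (1 + ln p)) ^ 4 / real p ^ 4 / (real (t p))\<^sup>2) \<longlongrightarrow> 0) F"
proof -
  let ?x = "\<lambda>p. real (t p) / real p" and ?w = "\<lambda>p::nat. real p powr (-1/8)"
  have "(?w \<longlongrightarrow> 0) at_top" "((\<lambda>p. (1 + ln (real p)) * ?w p) \<longlongrightarrow> 0) at_top" by real_asymp+
  then have "(?w \<longlongrightarrow> 0) F" "((\<lambda>p. (1 + ln (real p)) * ?w p) \<longlongrightarrow> 0) F"
    using F tendsto_mono by blast+
  then have "((\<lambda>p. C * (2 * ?x p * ?w p + (1 + ln (real p)) * ?w p) ^ 4 / (?x p)\<^sup>2) \<longlongrightarrow> C * (2 * T * 0 + 0) ^ 4 / T\<^sup>2) F"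
    using T by (intro tendsto_intros t) auto
  moreover have "C * (2 * ?x p * ?w p + (1 + ln (real p)) * ?w p) ^ 4 / (?x p)\<^sup>2
      = C * (real p * sqrt p) * (2 * real (t p) + real p * (1 + ln p)) ^ 4 / real p ^ 4 / (real (t p))\<^sup>2" if "p > 0" for p
  proof -
    have "2 * ?x p * ?w p + (1 + ln (real p)) * ?w p = (2 * real (t p) + real p * (1 + ln p)) / real p * ?w p"
      using that by (simp add: field_simps)
    moreover have "?w p ^ 4 = real p * sqrt p / (real p)\<^sup>2"
    proof -
      have "?w p ^ 4 = real p powr (-1/2)"
        using that by (simp add: powr_powr flip: powr_numeral)
      also have "\<dots> = 1 / sqrt p" using that by (simp add: powr_minus_divide powr_half_sqrt)
      also have "\<dots> = real p * sqrt p / (real p)\<^sup>2" using that by (simp add: power2_eq_square field_simps)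
      finally show ?thesis .
    qed
    ultimately have "(2 * ?x p * ?w p + (1 + ln (real p)) * ?w p) ^ 4
       = (2 * real (t p) + real p * (1 + ln p)) ^ 4 / real p ^ 4 * (real p * sqrt p / (real p)\<^sup>2)"
      by (simp only: power_mult_distrib power_divide)
    moreover have "C * (A / x ^ 4 * (x * s / x\<^sup>2)) / (u / x)\<^sup>2 = C * (x * s) * A / x ^ 4 / u\<^sup>2"
      if "x > 0" for A x s u :: real
      using that by (simp add: power_divide power2_eq_square eval_nat_numeral)
    ultimately show ?thesis using that by simp
  qed
  moreover have "eventually (\<lambda>p. p > 0) F" using F eventually_gt_at_top filter_leD by blast
  ultimately show ?thesis
    by (auto elim!: Lim_transform_eventually eventually_mono)
qed

lemma pair_count_dvd_tendsto:
  fixes t :: "nat \<Rightarrow> nat" and c :: "nat \<Rightarrow> int"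
  assumes F: "F \<le> at_top" and t: "((\<lambda>p. real (t p) / real p) \<longlongrightarrow> T) F" and T: "T > 0"
    and c: "((\<lambda>p. real_of_int (c p) / real p) \<longlongrightarrow> \<gamma>) F"
  shows "((\<lambda>p. real (pair_count (t p) (\<lambda>u. int p dvd u + c p)) / (real (t p))\<^sup>2) \<longlongrightarrow> tent_sum T \<gamma>) F"
proof -
  \<comment> \<open>The range lies strictly above T + |\<gamma>|, so it contains the support of the
    limit tent and, for all large p, that of the approximating tents.\<close>
  define M where "M = \<lfloor>T + \<bar>\<gamma>\<bar>\<rfloor> + 1"
  have M: "T + \<bar>\<gamma>\<bar> < of_int M" unfolding M_def by linarith
  have "((\<lambda>p. real (t p) / real p + \<bar>real_of_int (c p) / real p\<bar>) \<longlongrightarrow> T + \<bar>\<gamma>\<bar>) F"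
    by (intro tendsto_intros t c)
  then have "eventually (\<lambda>p. real (t p) / real p + \<bar>real_of_int (c p) / real p\<bar> < of_int M) F"
    using M by (rule order_tendstoD)
  moreover have "eventually (\<lambda>p. real (t p) / real p > 0) F" using t T by (rule order_tendstoD)
  ultimately have "eventually (\<lambda>p. (\<Sum>n\<in>{- M..M}. (max 0 (1 - \<bar>of_int n - of_int (c p) / real p\<bar> / (real (t p) / real p)))\<^sup>2)
      = real (pair_count (t p) (\<lambda>u. int p dvd u + c p)) / (real (t p))\<^sup>2) F"
  proof eventually_elim
    case (elim p)
    then have p: "p > 0" "t p > 0" by (auto simp: zero_less_divide_iff)
    have "real (t p) + \<bar>real_of_int (c p)\<bar> < real p * of_int M"
      using elim(1) p by (simp add: field_simps)
    then have "real_of_int (int (t p) + \<bar>c p\<bar>) \<le> real_of_int (int p * M)" by simp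
    then show ?case using p by (intro pair_count_dvd[symmetric]) linarith+
  qed
  then show ?thesis unfolding tent_sum_eq[OF T less_imp_le[OF M]]
    by (rule Lim_transform_eventually[rotated]) (intro tendsto_tent_finite_sum t c T)
qed

lemma quad_sum_tendsto:
  fixes t :: "nat \<Rightarrow> nat" and r :: "nat \<Rightarrow> int" and g :: "nat \<Rightarrow> nat" and a :: "nat \<Rightarrow> int \<Rightarrow> real"
  assumes m: "m > 0" and F: "F \<le> at_top"
    and a: "eventually (\<lambda>p. balanced_class_sequence m p (g p) (a p)) F"
    and t: "((\<lambda>p. real (t p) / real p) \<longlongrightarrow> T) F" and T: "T > 0"
    and r: "((\<lambda>p. real_of_int (r p) / real p) \<longlongrightarrow> R) F"
    and refl: "((\<lambda>p. balanced_class_sequence.reflection_corr p (a p) / real p) \<longlongrightarrow> y) F"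
    and total: "((\<lambda>p. balanced_class_sequence.total_corr p (a p) / (real p)\<^sup>2) \<longlongrightarrow> 1) F"
  shows "((\<lambda>p. quad_sum (a p) (t p) (r p) / (real (t p))\<^sup>2) \<longlongrightarrow>
    2 * tent_sum T 0 + y\<^sup>2 * tent_sum T (T + 2 * R) - 2 * (1 + y\<^sup>2) * T / 3) F"
proof -
  from quad_sum_estimate[OF m] obtain C where "\<forall>p g a t r. balanced_class_sequence m p g a \<longrightarrow>
    \<bar>quad_sum a t r - balanced_class_sequence.quad_sum_main p a t r\<bar>
      \<le> C * (real p * sqrt p) * (2 * real t + real p * (1 + ln p)) ^ 4 / real p ^ 4"
    by (elim exE conjE) (rule that)
  then have est: "\<bar>quad_sum a t r - balanced_class_sequence.quad_sum_main p a t r\<bar>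
      \<le> C * (real p * sqrt p) * (2 * real t + real p * (1 + ln p)) ^ 4 / real p ^ 4"
    if "balanced_class_sequence m p g a" for p g a t r
    using that by blast
  let ?main = "\<lambda>p. balanced_class_sequence.quad_sum_main p (a p) (t p) (r p)"
    and ?refl = "\<lambda>p. balanced_class_sequence.reflection_corr p (a p)"
    and ?total = "\<lambda>p. balanced_class_sequence.total_corr p (a p)"
    and ?n = "\<lambda>p c. real (pair_count (t p) (\<lambda>u. int p dvd u + c)) / (real (t p))\<^sup>2"
    and ?x = "\<lambda>p. real (t p) / real p"
  have p_pos: "eventually (\<lambda>p. p > 0) F" using F eventually_gt_at_top filter_leD by blast
  have inv: "((\<lambda>p. 1 / real p) \<longlongrightarrow> 0) F"
    by (rule tendsto_mono[OF F]) real_asymp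
  have t_pos: "eventually (\<lambda>p. ?x p > 0) F" using t T by (rule order_tendstoD)

  have n0: "((\<lambda>p. ?n p 0) \<longlongrightarrow> tent_sum T 0) F"
    by (rule pair_count_dvd_tendsto[OF F t T]) simp
  have n1: "((\<lambda>p. ?n p (int (t p) - 1 + 2 * r p)) \<longlongrightarrow> tent_sum T (T + 2 * R)) F"
  proof (rule pair_count_dvd_tendsto[OF F t T])
    have "((\<lambda>p. ?x p - 1 / real p + 2 * (real_of_int (r p) / real p)) \<longlongrightarrow> T - 0 + 2 * R) F"
      by (intro tendsto_intros t r inv)
    then show "((\<lambda>p. real_of_int (int (t p) - 1 + 2 * r p) / real p) \<longlongrightarrow> T + 2 * R) F"
      by (simp add: add_divide_distrib diff_divide_distrib)
  qed
  \<comment> \<open>Two of the pairings give the same count, hence the factor 2. The coefficient of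
    the last term tends to 1 - 2 - y^2, and the number of quadruples divided by t^2 p tends to 2 T /
    3.\<close>
  have "((\<lambda>p. 2 * ?n p 0 + (?refl p / p)\<^sup>2 * ?n p (int (t p) - 1 + 2 * r p)
      + (?total p / (real p)\<^sup>2 - 2 - (?refl p / p)\<^sup>2) * ((2 * ?x p + (1 / real p)\<^sup>2 / ?x p) / 3)) \<longlongrightarrow>
      2 * tent_sum T 0 + y\<^sup>2 * tent_sum T (T + 2 * R) + (1 - 2 - y\<^sup>2) * ((2 * T + 0\<^sup>2 / T) / 3)) F"
    using T by (intro tendsto_intros n0 n1 refl total t inv) auto
  moreover have "2 * tent_sum T 0 + y\<^sup>2 * tent_sum T (T + 2 * R) + (1 - 2 - y\<^sup>2) * ((2 * T + 0\<^sup>2 / T) / 3)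
      = 2 * tent_sum T 0 + y\<^sup>2 * tent_sum T (T + 2 * R) - 2 * (1 + y\<^sup>2) * T / 3"
    by (simp add: field_simps)
  moreover have "eventually (\<lambda>p. 2 * ?n p 0 + (?refl p / p)\<^sup>2 * ?n p (int (t p) - 1 + 2 * r p)
      + (?total p / (real p)\<^sup>2 - 2 - (?refl p / p)\<^sup>2) * ((2 * ?x p + (1 / real p)\<^sup>2 / ?x p) / 3)
      = ?main p / (real (t p))\<^sup>2) F"
    using a t_pos
  proof eventually_elim
    case (elim p)
    then have pos: "real p > 0" "real (t p) > 0" by (auto simp: zero_less_divide_iff)
    interpret balanced_class_sequence m p "g p" "a p" by (rule elim(1))
    have "(?total p - 2 * (real p)\<^sup>2 - (?refl p)\<^sup>2) / real p ^ 3 * card (quads (t p)) / (real (t p))\<^sup>2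
       = (?total p / (real p)\<^sup>2 - 2 - (?refl p / p)\<^sup>2) * ((2 * ?x p + (1 / real p)\<^sup>2 / ?x p) / 3)"
    proof -
      have "(?total p - 2 * (real p)\<^sup>2 - (?refl p)\<^sup>2) / real p ^ 3
          = (?total p / (real p)\<^sup>2 - 2 - (?refl p / p)\<^sup>2) / real p"
        using pos by (simp add: diff_divide_distrib power_divide power2_eq_square power3_eq_cube)
      moreover have "card (quads (t p)) / (real (t p))\<^sup>2 / real p = (2 * ?x p + (1 / real p)\<^sup>2 / ?x p) / 3"
      proof -
        have "u * (2 * u\<^sup>2 + 1) / 3 / u\<^sup>2 / x = (2 * (u / x) + (1 / x)\<^sup>2 / (u / x)) / 3"
          if "x > 0" "u > 0" for u x :: real
          using that by (simp add: divide_simps power2_eq_square) algebra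
        from this[OF pos] show ?thesis unfolding card_quads .
      qed
      moreover have "A / x * B / u = A * (B / u / x)" for A B u x :: real by simp
      ultimately show ?thesis by (simp only:)
    qed
    then show ?case
      unfolding quad_sum_main_def card_quads_dvd_02 card_quads_dvd_03 card_quads_dvd_01
      by (simp add: add_divide_distrib)
  qed
  ultimately have main: "((\<lambda>p. ?main p / (real (t p))\<^sup>2) \<longlongrightarrow>
      2 * tent_sum T 0 + y\<^sup>2 * tent_sum T (T + 2 * R) - 2 * (1 + y\<^sup>2) * T / 3) F"
    by (simp only: Lim_transform_eventually)

  have "((\<lambda>p. quad_sum (a p) (t p) (r p) / (real (t p))\<^sup>2 - ?main p / (real (t p))\<^sup>2) \<longlongrightarrow> 0) F"
  proof (rule Lim_null_comparison[OF _ quad_sum_error_tendsto_0[OF F t T]])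
    show "eventually (\<lambda>p. norm (quad_sum (a p) (t p) (r p) / (real (t p))\<^sup>2 - ?main p / (real (t p))\<^sup>2)
      \<le> C * (real p * sqrt p) * (2 * real (t p) + real p * (1 + ln p)) ^ 4 / real p ^ 4 / (real (t p))\<^sup>2) F"
      using a
    proof eventually_elim
      case (elim p)
      show ?case using divide_right_mono[OF est[OF elim], of "(real (t p))\<^sup>2"]
        by (simp add: abs_divide flip: diff_divide_distrib)
    qed
  qed
  from tendsto_add[OF this main] show ?thesis by simp
qed

text \<open>Both cases of the theorem are covered by the constant value y of
  \<open>refl_ratio\<close>: y = 1 for even (p - 1) / m, and y = 4 N / m - 1 for odd.\<close>

lemma merit_factor_tendsto:
  fixes m :: nat and S :: "int set" and P :: "nat set"
    and \<omega> v r :: "nat \<Rightarrow> int" and t :: "nat \<Rightarrow> nat"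
    and D :: "nat \<Rightarrow> int set" and R T y :: real
  defines "F \<equiv> inf at_top (principal P)"
  assumes m: "m > 0" and cyc: "\<And>p. p \<in> P \<Longrightarrow> cyclotomic_set m p S (\<omega> p) (v p) (D p)"
    and corr: "((\<lambda>p. (ln (real p)) ^ 3 / (real p)\<^sup>2 *
            (\<Sum>u\<in>carrier (mult_of (GFp p)).
               (real (card (translate p (D p) u \<inter> D p)) - real p / 4)\<^sup>2)) \<longlongrightarrow> 0) F"
    and t: "((\<lambda>p. real (t p) / real p) \<longlongrightarrow> T) F" and T: "T > 0"
    and r: "((\<lambda>p. real_of_int (r p) / real p) \<longlongrightarrow> R) F"
    and y: "\<And>p. p \<in> P \<Longrightarrow> cyclotomic_set.refl_ratio m p S = y" "\<bar>y\<bar> \<le> 1"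
  shows "((\<lambda>p. merit_factor (characteristic_poly p (D p) (v p) (r p) (t p))) \<longlongrightarrow> phi (y\<^sup>2) R T) F"
proof -
  have F: "F \<le> at_top" by (simp add: F_def)
  have P: "eventually (\<lambda>p. p \<in> P) F" unfolding F_def eventually_inf_principal by simp
  have inv: "((\<lambda>p. 1 / real p) \<longlongrightarrow> 0) F"
    by (rule tendsto_mono[OF F]) real_asymp
  have p3: "eventually (\<lambda>p. p \<ge> 3) F" using F eventually_ge_at_top filter_leD by blast
  let ?g = "\<lambda>p. cyclotomic_set.g (\<omega> p)" and ?a = "\<lambda>p. cyclotomic_set.a p (v p) (D p)"
  let ?refl = "\<lambda>p. balanced_class_sequence.reflection_corr p (?a p)"
    and ?total = "\<lambda>p. balanced_class_sequence.total_corr p (?a p)"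
    and ?H = "\<lambda>p. \<Sum>u\<in>carrier (mult_of (GFp p)). (real (card (translate p (D p) u \<inter> D p)) - real p / 4)\<^sup>2"
    and ?d = "2 * tent_sum T 0 + y\<^sup>2 * tent_sum T (T + 2 * R) - 2 * (1 + y\<^sup>2) * T / 3"
  have seq: "eventually (\<lambda>p. balanced_class_sequence m p (?g p) (?a p)) F"
    using P
  proof eventually_elim
    case (elim p)
    interpret cyclotomic_set m p S "\<omega> p" "v p" "D p" by (rule cyc[OF elim])
    show ?case by (rule seq.balanced_class_sequence_axioms)
  qed
  have "eventually (\<lambda>p. 1 / real p + (1 - 1 / real p) * y = ?refl p / real p) F"
    using P
  proof eventually_elim
    case (elim p)
    interpret cyclotomic_set m p S "\<omega> p" "v p" "D p" by (rule cyc[OF elim])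
    have "real (p - 1) = real p - 1" using p1 by simp
    then have "?refl p = 1 + (real p - 1) * y"
      using reflection_corr_eq unfolding y(1)[OF elim] by simp
    then show ?case using p0 by (simp add: field_simps)
  qed
  moreover have "((\<lambda>p. 1 / real p + (1 - 1 / real p) * y) \<longlongrightarrow> 0 + (1 - 0) * y) F"
    by (intro tendsto_intros inv)
  ultimately have refl: "((\<lambda>p. ?refl p / real p) \<longlongrightarrow> y) F"
    by (simp add: tendsto_cong)
  have total: "((\<lambda>p. ?total p / (real p)\<^sup>2) \<longlongrightarrow> 1) F"
  proof (rule tendsto_sandwich)
    show "eventually (\<lambda>p. 1 \<le> ?total p / (real p)\<^sup>2) F"
      using P
    proof eventually_elim
      case (elim p)
      interpret cyclotomic_set m p S "\<omega> p" "v p" "D p" by (rule cyc[OF elim])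
      show ?case using total_corr_bounds(1) p0 by simp
    qed
    show "eventually (\<lambda>p. ?total p / (real p)\<^sup>2 \<le>
        1 + 32 * ((ln (real p)) ^ 3 / (real p)\<^sup>2 * ?H p) + 8 * (1 / real p)) F"
      using P p3
    proof eventually_elim
      case (elim p)
      interpret cyclotomic_set m p S "\<omega> p" "v p" "D p" by (rule cyc[OF elim(1)])
      \<comment> \<open>For p >= 3 one has ln p >= 1, so the weighted sum of the hypothesis
        dominates the plain one.\<close>
      have "exp 1 \<le> real p" using exp_le elim(2) by linarith
      then have "1 \<le> ln (real p)" using p0 by (simp add: ln_ge_iff)
      then have "1 * ?H p \<le> (ln (real p)) ^ 3 * ?H p"
        by (intro mult_right_mono one_le_power sum_nonneg) auto
      then have "?total p \<le> (real p)\<^sup>2 + 32 * ((ln (real p)) ^ 3 * ?H p) + 8 * real p"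
        using total_corr_bounds(2) by linarith
      then have "?total p / (real p)\<^sup>2 \<le> ((real p)\<^sup>2 + 32 * ((ln (real p)) ^ 3 * ?H p) + 8 * real p) / (real p)\<^sup>2"
        by (rule divide_right_mono) simp
      also have "\<dots> = 1 + 32 * ((ln (real p)) ^ 3 / (real p)\<^sup>2 * ?H p) + 8 * (1 / real p)"
        using p0 by (simp add: add_divide_distrib power2_eq_square)
      finally show ?case .
    qed
    have "((\<lambda>p. 1 + 32 * ((ln (real p)) ^ 3 / (real p)\<^sup>2 * ?H p) + 8 * (1 / real p)) \<longlongrightarrow> 1 + 32 * 0 + 8 * 0) F"
      by (intro tendsto_intros corr inv)
    then show "((\<lambda>p. 1 + 32 * ((ln (real p)) ^ 3 / (real p)\<^sup>2 * ?H p) + 8 * (1 / real p)) \<longlongrightarrow> 1) F" by simp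
  qed simp
  have d: "0 < ?d - 1"
    using phi_denominator_pos[OF T, of "y\<^sup>2" "T + 2 * R"] y(2) by (simp add: abs_square_le_1)
  have "((\<lambda>p. 1 / (quad_sum (?a p) (t p) (r p) / (real (t p))\<^sup>2 - 1)) \<longlongrightarrow> 1 / (?d - 1)) F"
    using d by (intro tendsto_intros quad_sum_tendsto[OF m F seq t T r refl total]) simp
  also have "1 / (?d - 1) = phi (y\<^sup>2) R T" unfolding phi_eq[OF T] by simp
  finally show ?thesis
  proof (rule Lim_transform_eventually)
    have "eventually (\<lambda>p. real (t p) / real p > 0) F" using t T by (rule order_tendstoD)
    with P show "eventually (\<lambda>p. 1 / (quad_sum (?a p) (t p) (r p) / (real (t p))\<^sup>2 - 1) =
      merit_factor (characteristic_poly p (D p) (v p) (r p) (t p))) F"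
    proof eventually_elim
      case (elim p)
      interpret cyclotomic_set m p S "\<omega> p" "v p" "D p" by (rule cyc[OF elim(1)])
      have "(real (t p))\<^sup>2 \<noteq> 0" using elim(2) by (cases "t p = 0") auto
      then have "quad_sum (?a p) (t p) (r p) / (real (t p))\<^sup>2 - 1
          = (quad_sum (?a p) (t p) (r p) - (real (t p))\<^sup>2) / (real (t p))\<^sup>2"
        by (simp add: diff_divide_distrib)
      then show ?case unfolding merit_factor_eq by simp
    qed
  qed
qed

theorem theorem2p3:
  fixes m :: nat and S :: "int set" and P :: "nat set"
    and \<omega> v r :: "nat \<Rightarrow> int" and t :: "nat \<Rightarrow> nat"
    and D :: "nat \<Rightarrow> int set" and R T :: real
  assumes "m > 0" and "even m"
    and "S \<subseteq> {0..int m - 1}" and "card S = m div 2"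
    and "infinite P" and "\<And>p. p \<in> P \<Longrightarrow> prime p" and "\<And>p. p \<in> P \<Longrightarrow> [p = 1] (mod m)"
    and "\<And>p. p \<in> P \<Longrightarrow> primitive_element p (\<omega> p)"
    and "\<And>p. p \<in> P \<Longrightarrow> D p = (\<Union>s\<in>S. cyclotomic_class p m (\<omega> p) s)"
    and "((\<lambda>p. (ln (real p)) ^ 3 / (real p)\<^sup>2 *
            (\<Sum>u\<in>carrier (mult_of (GFp p)).
               (real (card (translate p (D p) u \<inter> D p)) - real p / 4)\<^sup>2))
          \<longlongrightarrow> 0) (inf at_top (principal P))"
    and "\<And>p. p \<in> P \<Longrightarrow> additive_generator p (v p)"
    and "T > 0"
    and "((\<lambda>p. real_of_int (r p) / real p) \<longlongrightarrow> R) (inf at_top (principal P))"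
    and "((\<lambda>p. real (t p) / real p) \<longlongrightarrow> T) (inf at_top (principal P))"
  shows "((\<forall>p\<in>P. even ((p - 1) div m)) \<longrightarrow>
            ((\<lambda>p. merit_factor (characteristic_poly p (D p) (v p) (r p) (t p))) \<longlongrightarrow> phi 1 R T)
              (inf at_top (principal P))) \<and>
         ((\<forall>p\<in>P. odd ((p - 1) div m)) \<longrightarrow>
            (let N = card {(s, s'). s \<in> S \<and> s' \<in> S \<and> [s - s' = int (m div 2)] (mod int m)};
                 \<nu> = (4 * real N / real m - 1)\<^sup>2
             in ((\<lambda>p. merit_factor (characteristic_poly p (D p) (v p) (r p) (t p))) \<longlongrightarrow> phi \<nu> R T)
                  (inf at_top (principal P))))"
proof -
  have cyc: "cyclotomic_set m p S (\<omega> p) (v p) (D p)" if "p \<in> P" for p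
    by unfold_locales (fact assms(1-4) assms(6-9)[OF that] assms(11)[OF that])+
  let ?N = "card {(s, s'). s \<in> S \<and> s' \<in> S \<and> [s - s' = int (m div 2)] (mod int m)}"
  note lim = merit_factor_tendsto[OF assms(1) cyc assms(10) assms(14) assms(12) assms(13)]
  show ?thesis unfolding Let_def
  proof (intro conjI impI)
    assume even: "\<forall>p\<in>P. even ((p - 1) div m)"
    have "cyclotomic_set.refl_ratio m p S = 1" if "p \<in> P" for p
      using cyclotomic_set.refl_ratio_even[OF cyc[OF that]] cyclotomic_set.q_def[OF cyc[OF that]] even that by simp
    from lim[OF _ this] show "((\<lambda>p. merit_factor (characteristic_poly p (D p) (v p) (r p) (t p))) \<longlongrightarrow> phi 1 R T)
        (inf at_top (principal P))" by simp
  next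
    assume odd: "\<forall>p\<in>P. odd ((p - 1) div m)"
    \<comment> \<open>N depends only on m and S, but its bound is proved in the locale; any member
      of \<open>P\<close> provides an instance.\<close>
    obtain p where p: "p \<in> P" using assms(5) by (metis finite.emptyI ex_in_conv)
    have N: "cyclotomic_set.N m S = ?N"
      using cyclotomic_set.N_def[OF cyc[OF p]] .
    have "2 * ?N \<le> m" using cyclotomic_set.N_le[OF cyc[OF p]] N by simp
    then have "0 \<le> 4 * real ?N / real m" "4 * real ?N / real m \<le> 2"
      using assms(1) by (simp_all add: divide_le_eq)
    then have le: "\<bar>4 * real ?N / real m - 1\<bar> \<le> 1" by linarith
    have "cyclotomic_set.refl_ratio m p S = 4 * real ?N / real m - 1" if "p \<in> P" for p
      using cyclotomic_set.refl_ratio_odd[OF cyc[OF that]] cyclotomic_set.q_def[OF cyc[OF that]] odd that N by simp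
    from lim[OF _ this le] show "((\<lambda>p. merit_factor (characteristic_poly p (D p) (v p) (r p) (t p)))
        \<longlongrightarrow> phi ((4 * real ?N / real m - 1)\<^sup>2) R T) (inf at_top (principal P))" by simp
  qed
qed

end
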